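(* Let $(M,g,J,D)$, $\dim M=2n\ge 6$, be a Kähler manifold of quasi-constant holomorphic sectional curvatures with $B_0$-distribution $D$ ($D^\perp=\mathrm{span}\{\xi,J\xi\}$), with functions $a$ and $k$. Then any integral submanifold $Q^{2n-1}$ of the distribution $\Delta(p)=\{X\in T_pM : g(\xi,X)=0\}$, with its induced almost contact Riemannian structure $(g,\varphi,\tilde\xi,\tilde\eta)$, is a $\frac{k}{2}$-Sasakian space form, and it is of type I if and only if $a+k^2>0$; of type II if and only if $a+k^2=0$; of type III if and only if $a+k^2<0$.
   Context: $(M,g,J,D)$: $g$ is a positive definite Kähler metric with Levi-Civita connection $\nabla$, $D$ is a $J$-invariant distribution of real codimension 2 with orthogonal complement $D^\perp=\mathrm{span}\{\xi,J\xi\}$, $\xi$ a unit vector field. $D$ is a $B_0$-distribution if there are functions $k$ (nowhere zero) and $p^*$ with $\nabla_{x_0}\xi=\frac{k}{2}x_0$ for $x_0\in D$, $\nabla_{J\xi}\xi=-p^*J\xi$, $\nabla_\xi\xi=0$ (then the 1-form $\eta=g(\xi,\cdot)$ is closed, so $\Delta$ is integrable, and $dk=\xi(k)\eta$, so $k$ is constant on each connected integral submanifold of $\Delta$). $(M,g,J,D)$ is of quasi-constant holomorphic sectional curvatures if the sectional curvature of any $J$-invariant 2-plane $E\subset T_pM$ depends only on $p$ and on the angle between $E$ and $D^\perp(p)$; then $a(p)$ denotes the common holomorphic sectional curvature of the $J$-invariant 2-planes contained in $D(p)$. Integral submanifolds are connected. Induced structure on an integral submanifold $Q^{2n-1}$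 of $\Delta$: the induced metric $g$, $\tilde\xi=J\xi$, $\tilde\eta(x)=g(x,\tilde\xi)$, $\varphi x=Jx+\tilde\eta(x)\xi$ for $x$ tangent to $Q^{2n-1}$. An almost contact Riemannian manifold $(Q,g,\varphi,\tilde\xi,\tilde\eta)$ (i.e. $g(\varphi x,\varphi y)=g(x,y)-\tilde\eta(x)\tilde\eta(y)$, $\varphi^2x=-x+\tilde\eta(x)\tilde\xi$, $\varphi\tilde\xi=0$) with Levi-Civita connection $\mathcal D$ is $\alpha$-Sasakian, $\alpha=\mathrm{const}$, if $\mathcal D_x\tilde\xi=\alpha\varphi x$ and $(\mathcal D_x\varphi)(y)=\alpha(\tilde\eta(y)x-g(x,y)\tilde\xi)$. It is an $\alpha$-Sasakian space form if in addition it has constant $\varphi$-holomorphic sectional curvature $c$, i.e. the sectional curvature of every plane $\mathrm{span}\{x,\varphi x\}$ with $x\perp\tilde\xi$, $x\neq0$, equals the constant $c$. It is of type I, II, III according to $c+3\alpha^2>0$, $c+3\alpha^2=0$, $c+3\alpha^2<0$, respectively. *)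

theory Defs
  imports "HOL-Analysis.Analysis" "HOL-Library.Function_Algebras"
begin

text \<open>The pointwise real vector space structure on functions, so that \<^const>\<open>span\<close>,
  \<^const>\<open>subspace\<close> and \<^const>\<open>dim\<close> apply to the tangent spaces below.\<close>

instantiation "fun" :: (type, real_vector) real_vector
begin

definition scaleR_fun :: "real \<Rightarrow> ('a \<Rightarrow> 'b) \<Rightarrow> 'a \<Rightarrow> 'b"
  where "scaleR_fun r f = (\<lambda>x. r *\<^sub>R f x)"

instance
  by standard (simp_all add: scaleR_fun_def fun_eq_iff scaleR_add_right scaleR_add_left)

end

definition linear_between :: "'a::real_vector set \<Rightarrow> 'b::real_vector set \<Rightarrow> ('a \<Rightarrow> 'b) \<Rightarrow> bool"
  where "linear_between S T f \<longleftrightarrow> f ` S \<subseteq> T \<and>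
    (\<forall>x\<in>S. \<forall>y\<in>S. f (x + y) = f x + f y) \<and> (\<forall>r. \<forall>x\<in>S. f (r *\<^sub>R x) = r *\<^sub>R f x)"


section \<open>Smooth manifolds\<close>

text \<open>The two notions below are used for open \<open>S\<close> only.\<close>

primrec Ck_on :: "nat \<Rightarrow> 'a::euclidean_space set \<Rightarrow> ('a \<Rightarrow> 'b::real_normed_vector) \<Rightarrow> bool"
  where
    "Ck_on 0 S f \<longleftrightarrow> continuous_on S f"
  | "Ck_on (Suc k) S f \<longleftrightarrow>
       f differentiable_on S \<and> (\<forall>v. Ck_on k S (\<lambda>x. frechet_derivative f (at x) v))"

definition smooth_on :: "'a::euclidean_space set \<Rightarrow> ('a \<Rightarrow> 'b::real_normed_vector) \<Rightarrow> bool"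
  where "smooth_on S f \<longleftrightarrow> (\<forall>k. Ck_on k S f)"

text \<open>A chart is a pair of its domain and its coordinate map; the values of the coordinate map
  outside the domain are irrelevant.\<close>

type_synonym ('m, 'e) chart = "'m set \<times> ('m \<Rightarrow> 'e)"

definition chart_inv :: "('m, 'e) chart \<Rightarrow> 'e \<Rightarrow> 'm"
  where "chart_inv c = inv_into (fst c) (snd c)"

text \<open>The atlas need not be maximal.\<close>

record ('m, 'e) manifold =
  mtop :: "'m topology"
  atlas :: "('m, 'e) chart set"

definition smooth_manifold :: "('m, 'e::euclidean_space) manifold \<Rightarrow> bool"
  where "smooth_manifold M \<longleftrightarrow>
    Hausdorff_space (mtop M) \<and> second_countable (mtop M) \<and>
    (\<Union>c\<in>atlas M. fst c) = topspace (mtop M) \<and>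
    (\<forall>c\<in>atlas M. openin (mtop M) (fst c) \<and> open (snd c ` fst c) \<and>
      homeomorphic_map (subtopology (mtop M) (fst c)) (top_of_set (snd c ` fst c)) (snd c)) \<and>
    (\<forall>c\<in>atlas M. \<forall>d\<in>atlas M. smooth_on (snd c ` (fst c \<inter> fst d)) (snd d \<circ> chart_inv c))"

definition charts_at :: "('m, 'e) manifold \<Rightarrow> 'm \<Rightarrow> ('m, 'e) chart set"
  where "charts_at M p = {c \<in> atlas M. p \<in> fst c}"

definition chart_at :: "('m, 'e) manifold \<Rightarrow> 'm \<Rightarrow> ('m, 'e) chart"
  where "chart_at M p = (SOME c. c \<in> charts_at M p)"

definition smooth_fun_at :: "('m, 'e::euclidean_space) manifold \<Rightarrow> 'm \<Rightarrow> ('m \<Rightarrow> real) \<Rightarrow> bool"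
  where "smooth_fun_at M p f \<longleftrightarrow> (\<exists>U. openin (mtop M) U \<and> p \<in> U \<and>
    (\<forall>c\<in>atlas M. smooth_on (snd c ` (U \<inter> fst c)) (f \<circ> chart_inv c)))"

definition smooth_map ::
    "('m, 'e::euclidean_space) manifold \<Rightarrow> ('n, 'f::euclidean_space) manifold \<Rightarrow> ('m \<Rightarrow> 'n) \<Rightarrow> bool"
  where "smooth_map M N F \<longleftrightarrow> continuous_map (mtop M) (mtop N) F \<and>
    (\<forall>c\<in>atlas M. \<forall>d\<in>atlas N.
      smooth_on (snd c ` {p \<in> fst c. F p \<in> fst d}) (snd d \<circ> F \<circ> chart_inv c))"


section \<open>Tangent vectors and vector fields\<close>

text \<open>A tangent vector at \<open>p\<close> assigns to every chart around \<open>p\<close> a coordinate vector, subject to the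
  contravariant transformation law. It is \<open>0\<close> on all other charts, which makes equality of tangent
  vectors at \<open>p\<close> the equality of functions.\<close>

type_synonym ('m, 'e) tangent = "('m, 'e) chart \<Rightarrow> 'e"

definition tangent_space :: "('m, 'e::euclidean_space) manifold \<Rightarrow> 'm \<Rightarrow> ('m, 'e) tangent set"
  where "tangent_space M p = {v.
    (\<forall>c\<in>charts_at M p. \<forall>d\<in>charts_at M p.
      v d = frechet_derivative (snd d \<circ> chart_inv c) (at (snd c p)) (v c)) \<and>
    (\<forall>c. c \<notin> charts_at M p \<longrightarrow> v c = 0)}"

type_synonym ('m, 'e) field = "'m \<Rightarrow> ('m, 'e) tangent"

definition smooth_field_at :: "('m, 'e::euclidean_space) manifold \<Rightarrow> 'm \<Rightarrow> ('m, 'e) field \<Rightarrow> bool"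
  where "smooth_field_at M p X \<longleftrightarrow> (\<exists>U. openin (mtop M) U \<and> p \<in> U \<and>
    (\<forall>q\<in>U. X q \<in> tangent_space M q) \<and>
    (\<forall>c\<in>atlas M. smooth_on (snd c ` (U \<inter> fst c)) (\<lambda>y. X (chart_inv c y) c)))"

definition smooth_vector_field :: "('m, 'e::euclidean_space) manifold \<Rightarrow> ('m, 'e) field \<Rightarrow> bool"
  where "smooth_vector_field M X \<longleftrightarrow> (\<forall>p\<in>topspace (mtop M). smooth_field_at M p X)"

text \<open>The derivative \<open>v(f)\<close> of a function along a tangent vector and the differential of a map.
  By the transformation law the choice of the chart in the source is immaterial.\<close>

definition dir_deriv ::
    "('m, 'e::euclidean_space) manifold \<Rightarrow> 'm \<Rightarrow> ('m, 'e) tangent \<Rightarrow> ('m \<Rightarrow> real) \<Rightarrow> real"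
  where "dir_deriv M p v f = (let c = chart_at M p in
    frechet_derivative (f \<circ> chart_inv c) (at (snd c p)) (v c))"

definition differential ::
    "('m, 'e::euclidean_space) manifold \<Rightarrow> ('n, 'f::euclidean_space) manifold \<Rightarrow> ('m \<Rightarrow> 'n) \<Rightarrow>
      'm \<Rightarrow> ('m, 'e) tangent \<Rightarrow> ('n, 'f) tangent"
  where "differential M N F p v = (\<lambda>d. if d \<in> charts_at N (F p)
    then let c = chart_at M p in
      frechet_derivative (snd d \<circ> F \<circ> chart_inv c) (at (snd c p)) (v c)
    else 0)"

definition lie_bracket ::
    "('m, 'e::euclidean_space) manifold \<Rightarrow> ('m, 'e) field \<Rightarrow> ('m, 'e) field \<Rightarrow> ('m, 'e) field"
  where "lie_bracket M X Y p = (\<lambda>c. if c \<in> charts_at M p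
    then frechet_derivative (\<lambda>y. Y (chart_inv c y) c) (at (snd c p)) (X p c)
       - frechet_derivative (\<lambda>y. X (chart_inv c y) c) (at (snd c p)) (Y p c)
    else 0)"

definition smooth_endomorphism_field ::
    "('m, 'e::euclidean_space) manifold \<Rightarrow> ('m \<Rightarrow> ('m, 'e) tangent \<Rightarrow> ('m, 'e) tangent) \<Rightarrow> bool"
  where "smooth_endomorphism_field M A \<longleftrightarrow> (\<forall>p\<in>topspace (mtop M).
    linear_between (tangent_space M p) (tangent_space M p) (A p) \<and>
    (\<forall>X. smooth_field_at M p X \<longrightarrow> smooth_field_at M p (\<lambda>q. A q (X q))))"

definition smooth_one_form ::
    "('m, 'e::euclidean_space) manifold \<Rightarrow> ('m \<Rightarrow> ('m, 'e) tangent \<Rightarrow> real) \<Rightarrow> bool"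
  where "smooth_one_form M \<omega> \<longleftrightarrow> (\<forall>p\<in>topspace (mtop M).
    linear_between (tangent_space M p) UNIV (\<omega> p) \<and>
    (\<forall>X. smooth_field_at M p X \<longrightarrow> smooth_fun_at M p (\<lambda>q. \<omega> q (X q))))"


section \<open>Riemannian metrics, connections and curvature\<close>

type_synonym ('m, 'e) metric = "'m \<Rightarrow> ('m, 'e) tangent \<Rightarrow> ('m, 'e) tangent \<Rightarrow> real"

definition riemannian_metric :: "('m, 'e::euclidean_space) manifold \<Rightarrow> ('m, 'e) metric \<Rightarrow> bool"
  where "riemannian_metric M g \<longleftrightarrow> (\<forall>p\<in>topspace (mtop M).
    (\<forall>x\<in>tangent_space M p. linear_between (tangent_space M p) UNIV (g p x)) \<and>
    (\<forall>x\<in>tangent_space M p. \<forall>y\<in>tangent_space M p. g p x y = g p y x) \<and>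
    (\<forall>x\<in>tangent_space M p. x \<noteq> 0 \<longrightarrow> g p x x > 0) \<and>
    (\<forall>X Y. smooth_field_at M p X \<longrightarrow> smooth_field_at M p Y \<longrightarrow>
      smooth_fun_at M p (\<lambda>q. g q (X q) (Y q))))"

text \<open>For a connection \<open>nabla\<close>, the term \<open>nabla p v Y\<close> stands for the covariant derivative of \<open>Y\<close> along
  the tangent vector \<open>v\<close> at \<open>p\<close>; it is meaningful if \<open>Y\<close> is smooth on a neighbourhood of \<open>p\<close>.
  Connections thus act on local vector fields. In the Leibniz rule \<open>f\<close> has to be smooth near \<open>p\<close>
  only; taking \<open>f\<close> to be the indicator function of a neighbourhood of \<open>p\<close> shows that
  \<open>nabla p v Y\<close> depends only on the germ of \<open>Y\<close> at \<open>p\<close>.\<close>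

type_synonym ('m, 'e) connection =
  "'m \<Rightarrow> ('m, 'e) tangent \<Rightarrow> ('m, 'e) field \<Rightarrow> ('m, 'e) tangent"

definition affine_connection :: "('m, 'e::euclidean_space) manifold \<Rightarrow> ('m, 'e) connection \<Rightarrow> bool"
  where "affine_connection M nabla \<longleftrightarrow> (\<forall>p\<in>topspace (mtop M).
    (\<forall>Y. smooth_field_at M p Y \<longrightarrow>
      linear_between (tangent_space M p) (tangent_space M p) (\<lambda>v. nabla p v Y)) \<and>
    (\<forall>v\<in>tangent_space M p. \<forall>Y Z. smooth_field_at M p Y \<longrightarrow> smooth_field_at M p Z \<longrightarrow>
      nabla p v (\<lambda>q. Y q + Z q) = nabla p v Y + nabla p v Z) \<and>
    (\<forall>v\<in>tangent_space M p. \<forall>f Y. smooth_fun_at M p f \<longrightarrow> smooth_field_at M p Y \<longrightarrow>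
      nabla p v (\<lambda>q. f q *\<^sub>R Y q) = dir_deriv M p v f *\<^sub>R Y p + f p *\<^sub>R nabla p v Y) \<and>
    (\<forall>X Y. smooth_field_at M p X \<longrightarrow> smooth_field_at M p Y \<longrightarrow>
      smooth_field_at M p (\<lambda>q. nabla q (X q) Y)))"

definition levi_civita_connection ::
    "('m, 'e::euclidean_space) manifold \<Rightarrow> ('m, 'e) metric \<Rightarrow> ('m, 'e) connection \<Rightarrow> bool"
  where "levi_civita_connection M g nabla \<longleftrightarrow> affine_connection M nabla \<and>
    (\<forall>p\<in>topspace (mtop M). \<forall>X Y. smooth_field_at M p X \<longrightarrow> smooth_field_at M p Y \<longrightarrow>
      nabla p (X p) Y - nabla p (Y p) X = lie_bracket M X Y p \<and>
      (\<forall>v\<in>tangent_space M p. dir_deriv M p v (\<lambda>q. g q (X q) (Y q)) =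
        g p (nabla p v X) (Y p) + g p (X p) (nabla p v Y)))"

definition curvature_on_fields ::
    "('m, 'e::euclidean_space) manifold \<Rightarrow> ('m, 'e) connection \<Rightarrow>
      ('m, 'e) field \<Rightarrow> ('m, 'e) field \<Rightarrow> ('m, 'e) field \<Rightarrow> ('m, 'e) field"
  where "curvature_on_fields M nabla X Y Z p =
    nabla p (X p) (\<lambda>q. nabla q (Y q) Z) - nabla p (Y p) (\<lambda>q. nabla q (X q) Z)
      - nabla p (lie_bracket M X Y p) Z"

text \<open>The value of the curvature tensor on tangent vectors, computed with arbitrary local extensions.\<close>

definition curvature ::
    "('m, 'e::euclidean_space) manifold \<Rightarrow> ('m, 'e) connection \<Rightarrow> 'm \<Rightarrow>
      ('m, 'e) tangent \<Rightarrow> ('m, 'e) tangent \<Rightarrow> ('m, 'e) tangent \<Rightarrow> ('m, 'e) tangent"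
  where "curvature M nabla p x y z = (THE w. \<forall>X Y Z.
    smooth_field_at M p X \<and> smooth_field_at M p Y \<and> smooth_field_at M p Z \<and>
    X p = x \<and> Y p = y \<and> Z p = z \<longrightarrow> curvature_on_fields M nabla X Y Z p = w)"

definition tangent_plane :: "('m, 'e::euclidean_space) manifold \<Rightarrow> 'm \<Rightarrow> ('m, 'e) tangent set \<Rightarrow> bool"
  where "tangent_plane M p E \<longleftrightarrow> subspace E \<and> E \<subseteq> tangent_space M p \<and> dim E = 2"

definition sectional_curvature ::
    "('m, 'e::euclidean_space) manifold \<Rightarrow> ('m, 'e) metric \<Rightarrow> ('m, 'e) connection \<Rightarrow>
      'm \<Rightarrow> ('m, 'e) tangent set \<Rightarrow> real"
  where "sectional_curvature M g nabla p E = (THE \<kappa>. \<forall>x y. span {x, y} = E \<longrightarrow>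
    \<kappa> = g p (curvature M nabla p x y y) x / (g p x x * g p y y - (g p x y)\<^sup>2))"

definition orth_complement ::
    "('m, 'e::euclidean_space) manifold \<Rightarrow> ('m, 'e) metric \<Rightarrow> 'm \<Rightarrow>
      ('m, 'e) tangent set \<Rightarrow> ('m, 'e) tangent set"
  where "orth_complement M g p V = {x \<in> tangent_space M p. \<forall>y\<in>V. g p x y = 0}"

text \<open>The (smallest) angle between two subspaces. If both are \<open>J\<close>-invariant planes for a
  \<open>g\<close>-orthogonal complex structure \<open>J\<close>, all principal angles coincide with it.\<close>

definition angle_between ::
    "('m, 'e) metric \<Rightarrow> 'm \<Rightarrow> ('m, 'e) tangent set \<Rightarrow> ('m, 'e) tangent set \<Rightarrow> real"
  where "angle_between g p E F =
    arccos (Sup {g p x y | x y. x \<in> E \<and> y \<in> F \<and> g p x x = 1 \<and> g p y y = 1})"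


section \<open>Kaehler manifolds with a \<open>B\<^sub>0\<close>-distribution\<close>

definition almost_hermitian ::
    "('m, 'e::euclidean_space) manifold \<Rightarrow> ('m, 'e) metric \<Rightarrow>
      ('m \<Rightarrow> ('m, 'e) tangent \<Rightarrow> ('m, 'e) tangent) \<Rightarrow> bool"
  where "almost_hermitian M g J \<longleftrightarrow> smooth_manifold M \<and> riemannian_metric M g \<and>
    smooth_endomorphism_field M J \<and>
    (\<forall>p\<in>topspace (mtop M). \<forall>x\<in>tangent_space M p. J p (J p x) = - x) \<and>
    (\<forall>p\<in>topspace (mtop M). \<forall>x\<in>tangent_space M p. \<forall>y\<in>tangent_space M p.
      g p (J p x) (J p y) = g p x y)"

text \<open>The Kaehler condition is that \<open>J\<close> is parallel for the Levi-Civita connection.\<close>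

definition kaehler_manifold ::
    "('m, 'e::euclidean_space) manifold \<Rightarrow> ('m, 'e) metric \<Rightarrow>
      ('m \<Rightarrow> ('m, 'e) tangent \<Rightarrow> ('m, 'e) tangent) \<Rightarrow> ('m, 'e) connection \<Rightarrow> bool"
  where "kaehler_manifold M g J nabla \<longleftrightarrow> almost_hermitian M g J \<and>
    levi_civita_connection M g nabla \<and>
    (\<forall>p\<in>topspace (mtop M). \<forall>v\<in>tangent_space M p. \<forall>Y. smooth_field_at M p Y \<longrightarrow>
      nabla p v (\<lambda>q. J q (Y q)) = J p (nabla p v Y))"

definition holomorphic_plane ::
    "('m, 'e::euclidean_space) manifold \<Rightarrow> ('m \<Rightarrow> ('m, 'e) tangent \<Rightarrow> ('m, 'e) tangent) \<Rightarrow>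
      'm \<Rightarrow> ('m, 'e) tangent set \<Rightarrow> bool"
  where "holomorphic_plane M J p E \<longleftrightarrow> tangent_plane M p E \<and> J p ` E \<subseteq> E"

text \<open>Smoothness of \<open>D\<close> is a consequence of that of \<open>\<xi>\<close> and \<open>J\<close>.\<close>

definition J_invariant_distribution ::
    "('m, 'e::euclidean_space) manifold \<Rightarrow> ('m, 'e) metric \<Rightarrow>
      ('m \<Rightarrow> ('m, 'e) tangent \<Rightarrow> ('m, 'e) tangent) \<Rightarrow>
      ('m \<Rightarrow> ('m, 'e) tangent set) \<Rightarrow> ('m, 'e) field \<Rightarrow> bool"
  where "J_invariant_distribution M g J D \<xi> \<longleftrightarrow>
    smooth_vector_field M \<xi> \<and>
    (\<forall>p\<in>topspace (mtop M).
      g p (\<xi> p) (\<xi> p) = 1 \<and>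
      subspace (D p) \<and> D p \<subseteq> tangent_space M p \<and> dim (D p) + 2 = DIM('e) \<and>
      J p ` D p \<subseteq> D p \<and>
      orth_complement M g p (D p) = span {\<xi> p, J p (\<xi> p)})"

text \<open>The functions \<open>k\<close> and \<open>ps\<close> (the function \<open>p\<^sup>*\<close>) are smooth by these equations.\<close>

definition B0_distribution ::
    "('m, 'e::euclidean_space) manifold \<Rightarrow> ('m, 'e) metric \<Rightarrow>
      ('m \<Rightarrow> ('m, 'e) tangent \<Rightarrow> ('m, 'e) tangent) \<Rightarrow> ('m, 'e) connection \<Rightarrow>
      ('m \<Rightarrow> ('m, 'e) tangent set) \<Rightarrow> ('m, 'e) field \<Rightarrow> ('m \<Rightarrow> real) \<Rightarrow> bool"
  where "B0_distribution M g J nabla D \<xi> k \<longleftrightarrow>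
    J_invariant_distribution M g J D \<xi> \<and>
    (\<exists>ps :: 'm \<Rightarrow> real. \<forall>p\<in>topspace (mtop M).
      k p \<noteq> 0 \<and>
      (\<forall>x\<in>D p. nabla p x \<xi> = (k p / 2) *\<^sub>R x) \<and>
      nabla p (J p (\<xi> p)) \<xi> = - (ps p *\<^sub>R J p (\<xi> p)) \<and>
      nabla p (\<xi> p) \<xi> = 0)"

definition quasi_constant_holomorphic_curvature ::
    "('m, 'e::euclidean_space) manifold \<Rightarrow> ('m, 'e) metric \<Rightarrow>
      ('m \<Rightarrow> ('m, 'e) tangent \<Rightarrow> ('m, 'e) tangent) \<Rightarrow> ('m, 'e) connection \<Rightarrow>
      ('m \<Rightarrow> ('m, 'e) tangent set) \<Rightarrow> bool"
  where "quasi_constant_holomorphic_curvature M g J nabla D \<longleftrightarrow>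
    (\<exists>K :: 'm \<Rightarrow> real \<Rightarrow> real. \<forall>p\<in>topspace (mtop M). \<forall>E. holomorphic_plane M J p E \<longrightarrow>
      sectional_curvature M g nabla p E = K p (angle_between g p E (orth_complement M g p (D p))))"

definition holomorphic_curvature_on ::
    "('m, 'e::euclidean_space) manifold \<Rightarrow> ('m, 'e) metric \<Rightarrow>
      ('m \<Rightarrow> ('m, 'e) tangent \<Rightarrow> ('m, 'e) tangent) \<Rightarrow> ('m, 'e) connection \<Rightarrow>
      ('m \<Rightarrow> ('m, 'e) tangent set) \<Rightarrow> ('m \<Rightarrow> real) \<Rightarrow> bool"
  where "holomorphic_curvature_on M g J nabla D a \<longleftrightarrow>
    (\<forall>p\<in>topspace (mtop M). \<forall>E. holomorphic_plane M J p E \<and> E \<subseteq> D p \<longrightarrow>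
      sectional_curvature M g nabla p E = a p)"


section \<open>Integral submanifolds and the induced structure\<close>

text \<open>A submanifold is an injectively immersed one: a subset with its own topology and atlas (not
  necessarily the subspace topology) such that the inclusion is an immersion.\<close>

definition immersed_submanifold ::
    "('m, 'f::euclidean_space) manifold \<Rightarrow> ('m, 'e::euclidean_space) manifold \<Rightarrow> bool"
  where "immersed_submanifold Q M \<longleftrightarrow> smooth_manifold Q \<and> smooth_map Q M (\<lambda>p. p) \<and>
    (\<forall>p\<in>topspace (mtop Q). inj_on (differential Q M (\<lambda>p. p) p) (tangent_space Q p))"

definition integral_submanifold ::
    "('m, 'f::euclidean_space) manifold \<Rightarrow> ('m, 'e::euclidean_space) manifold \<Rightarrow>
      ('m \<Rightarrow> ('m, 'e) tangent set) \<Rightarrow> bool"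
  where "integral_submanifold Q M \<Delta> \<longleftrightarrow> immersed_submanifold Q M \<and> connected_space (mtop Q) \<and>
    (\<forall>p\<in>topspace (mtop Q). differential Q M (\<lambda>p. p) p ` tangent_space Q p = \<Delta> p)"

definition orth_distribution ::
    "('m, 'e::euclidean_space) manifold \<Rightarrow> ('m, 'e) metric \<Rightarrow> ('m, 'e) field \<Rightarrow>
      'm \<Rightarrow> ('m, 'e) tangent set"
  where "orth_distribution M g \<xi> p = {x \<in> tangent_space M p. g p (\<xi> p) x = 0}"

text \<open>\<open>as_tangent Q M p x\<close> is the vector of \<open>Q\<close> whose image under the inclusion is \<open>x\<close>.\<close>

definition as_tangent ::
    "('m, 'f::euclidean_space) manifold \<Rightarrow> ('m, 'e::euclidean_space) manifold \<Rightarrow>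
      'm \<Rightarrow> ('m, 'e) tangent \<Rightarrow> ('m, 'f) tangent"
  where "as_tangent Q M p = inv_into (tangent_space Q p) (differential Q M (\<lambda>p. p) p)"

definition induced_metric ::
    "('m, 'f::euclidean_space) manifold \<Rightarrow> ('m, 'e::euclidean_space) manifold \<Rightarrow>
      ('m, 'e) metric \<Rightarrow> ('m, 'f) metric"
  where "induced_metric Q M g p x y =
    g p (differential Q M (\<lambda>p. p) p x) (differential Q M (\<lambda>p. p) p y)"

definition induced_xi ::
    "('m, 'f::euclidean_space) manifold \<Rightarrow> ('m, 'e::euclidean_space) manifold \<Rightarrow>
      ('m \<Rightarrow> ('m, 'e) tangent \<Rightarrow> ('m, 'e) tangent) \<Rightarrow> ('m, 'e) field \<Rightarrow> ('m, 'f) field"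
  where "induced_xi Q M J \<xi> p = as_tangent Q M p (J p (\<xi> p))"

definition induced_eta ::
    "('m, 'f::euclidean_space) manifold \<Rightarrow> ('m, 'e::euclidean_space) manifold \<Rightarrow>
      ('m, 'e) metric \<Rightarrow> ('m \<Rightarrow> ('m, 'e) tangent \<Rightarrow> ('m, 'e) tangent) \<Rightarrow> ('m, 'e) field \<Rightarrow>
      'm \<Rightarrow> ('m, 'f) tangent \<Rightarrow> real"
  where "induced_eta Q M g J \<xi> p x = induced_metric Q M g p x (induced_xi Q M J \<xi> p)"

definition induced_phi ::
    "('m, 'f::euclidean_space) manifold \<Rightarrow> ('m, 'e::euclidean_space) manifold \<Rightarrow>
      ('m, 'e) metric \<Rightarrow> ('m \<Rightarrow> ('m, 'e) tangent \<Rightarrow> ('m, 'e) tangent) \<Rightarrow> ('m, 'e) field \<Rightarrow>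
      'm \<Rightarrow> ('m, 'f) tangent \<Rightarrow> ('m, 'f) tangent"
  where "induced_phi Q M g J \<xi> p x = as_tangent Q M p
    (J p (differential Q M (\<lambda>p. p) p x) + induced_eta Q M g J \<xi> p x *\<^sub>R \<xi> p)"


section \<open>\<open>\<alpha>\<close>-Sasakian space forms\<close>

definition almost_contact_riemannian ::
    "('m, 'e::euclidean_space) manifold \<Rightarrow> ('m, 'e) metric \<Rightarrow>
      ('m \<Rightarrow> ('m, 'e) tangent \<Rightarrow> ('m, 'e) tangent) \<Rightarrow> ('m, 'e) field \<Rightarrow>
      ('m \<Rightarrow> ('m, 'e) tangent \<Rightarrow> real) \<Rightarrow> bool"
  where "almost_contact_riemannian M g \<phi> \<xi> \<eta> \<longleftrightarrow> smooth_manifold M \<and> riemannian_metric M g \<and>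
    smooth_endomorphism_field M \<phi> \<and> smooth_vector_field M \<xi> \<and> smooth_one_form M \<eta> \<and>
    (\<forall>p\<in>topspace (mtop M).
      (\<forall>x\<in>tangent_space M p. \<forall>y\<in>tangent_space M p.
        g p (\<phi> p x) (\<phi> p y) = g p x y - \<eta> p x * \<eta> p y) \<and>
      (\<forall>x\<in>tangent_space M p. \<phi> p (\<phi> p x) = - x + \<eta> p x *\<^sub>R \<xi> p) \<and>
      \<phi> p (\<xi> p) = 0)"

text \<open>The last condition is the formula for \<open>(nabla\<^sub>x \<phi>)(y) = nabla\<^sub>x (\<phi> Y) - \<phi> (nabla\<^sub>x Y)\<close>, where \<open>Y\<close> is any
  local extension of \<open>y\<close>.\<close>

definition sasakian ::
    "('m, 'e::euclidean_space) manifold \<Rightarrow> ('m, 'e) metric \<Rightarrow>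
      ('m \<Rightarrow> ('m, 'e) tangent \<Rightarrow> ('m, 'e) tangent) \<Rightarrow> ('m, 'e) field \<Rightarrow>
      ('m \<Rightarrow> ('m, 'e) tangent \<Rightarrow> real) \<Rightarrow> ('m, 'e) connection \<Rightarrow> real \<Rightarrow> bool"
  where "sasakian M g \<phi> \<xi> \<eta> nabla \<alpha> \<longleftrightarrow> almost_contact_riemannian M g \<phi> \<xi> \<eta> \<and>
    levi_civita_connection M g nabla \<and>
    (\<forall>p\<in>topspace (mtop M). \<forall>x\<in>tangent_space M p.
      nabla p x \<xi> = \<alpha> *\<^sub>R \<phi> p x \<and>
      (\<forall>Y. smooth_field_at M p Y \<longrightarrow>
        nabla p x (\<lambda>q. \<phi> q (Y q)) - \<phi> p (nabla p x Y) =
          \<alpha> *\<^sub>R (\<eta> p (Y p) *\<^sub>R x - g p x (Y p) *\<^sub>R \<xi> p)))"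

definition sasakian_space_form ::
    "('m, 'e::euclidean_space) manifold \<Rightarrow> ('m, 'e) metric \<Rightarrow>
      ('m \<Rightarrow> ('m, 'e) tangent \<Rightarrow> ('m, 'e) tangent) \<Rightarrow> ('m, 'e) field \<Rightarrow>
      ('m \<Rightarrow> ('m, 'e) tangent \<Rightarrow> real) \<Rightarrow> ('m, 'e) connection \<Rightarrow> real \<Rightarrow> real \<Rightarrow> bool"
  where "sasakian_space_form M g \<phi> \<xi> \<eta> nabla \<alpha> c \<longleftrightarrow> sasakian M g \<phi> \<xi> \<eta> nabla \<alpha> \<and>
    (\<forall>p\<in>topspace (mtop M). \<forall>x\<in>tangent_space M p. g p x (\<xi> p) = 0 \<and> x \<noteq> 0 \<longrightarrow>
      sectional_curvature M g nabla p (span {x, \<phi> p x}) = c)"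

text \<open>The type of an \<open>\<alpha>\<close>-Sasakian space form of \<open>\<phi>\<close>-holomorphic sectional curvature \<open>c\<close>.\<close>

definition space_form_type_I :: "real \<Rightarrow> real \<Rightarrow> bool"
  where "space_form_type_I \<alpha> c \<longleftrightarrow> c + 3 * \<alpha>\<^sup>2 > 0"

definition space_form_type_II :: "real \<Rightarrow> real \<Rightarrow> bool"
  where "space_form_type_II \<alpha> c \<longleftrightarrow> c + 3 * \<alpha>\<^sup>2 = 0"

definition space_form_type_III :: "real \<Rightarrow> real \<Rightarrow> bool"
  where "space_form_type_III \<alpha> c \<longleftrightarrow> c + 3 * \<alpha>\<^sup>2 < 0"

end

theory Submission
  imports Defs
begin

text \<open>
  The shape operator of an integral submanifold \<open>Q\<close> of \<open>\<xi>\<^sup>\<bottom>\<close> is \<open>k/2\<close> on \<open>D\<close>, so the tangential part of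
  the parallelism of \<open>J\<close> is the \<open>k/2\<close>-Sasakian condition, and the Gauss equation gives
  \<open>c = a + k\<^sup>2/4\<close>, hence \<open>c + 3(k/2)\<^sup>2 = a + k\<^sup>2\<close>. It remains to see that \<open>k\<close> and \<open>a\<close> are constant along
  \<open>Q\<close>. The identity \<open>R(Jx, Jy) = R(x, y)\<close> applied to \<open>\<xi>\<close> gives \<open>dk = 0\<close> on \<open>D\<close>. On \<open>D\<close> the curvature
  tensor is \<open>a\<close> times that of constant holomorphic curvature, and it has no component with exactly one
  argument in \<open>D\<^sup>\<bottom>\<close>, so the second Bianchi identity gives \<open>da = 0\<close> on \<open>D\<close> as in Schur's lemma. Since
  \<open>[Y, JY]\<close> has the component \<open>-k|Y|\<^sup>2\<close> along \<open>J\<xi>\<close>, both differentials also vanish on \<open>J\<xi>\<close>. All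
  computations are done in charts, with fields along the inclusion of \<open>Q\<close> in place of extensions.
\<close>

section \<open>Smooth functions on open sets\<close>

text \<open>The bound dim M >= 6 leaves, for every x in D, a nonzero y in D orthogonal to x and Jx.
  With it the curvature identity becomes effective: R(x, y)\<xi> has the component dk(x)|y|^2/2
  along y, while R(Jx, Jy)\<xi> has none, so dk(x) = 0. The same y removes the cross terms from the
  Bianchi identity. Vanishing of dk on D makes R(x, y)\<xi> orthogonal to D, which is needed because
  derivatives of fields in D leave D. The function \<open>ps\<close> enters the shape operator only
  through a rank one term along J\<xi>, and this term cancels from both Sasakian identities. The
  summand k^2/4 of c is a product of two entries k/2 of the second fundamental form.

  Tangent vectors are functions on charts, so every notion is first compared with its expression in
  one chart. Moreover \<open>curvature\<close> and \<open>sectional_curvature\<close> are definite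
  descriptions: they have a usable value only after independence of the extensions and of the basis
  is shown, and an explicit Christoffel formula for the curvature tensor settles this.\<close>

abbreviation der :: "('a::real_normed_vector \<Rightarrow> 'b::real_normed_vector) \<Rightarrow> 'a \<Rightarrow> 'a \<Rightarrow> 'b"
  where "der f x \<equiv> frechet_derivative f (at x)"

lemma der_eqI: "(f has_derivative f') (at x) \<Longrightarrow> der f x = f'"
  using frechet_derivative_at by metis

lemma Ck_on_SucI:
  assumes "open S" "\<And>x. x \<in> S \<Longrightarrow> (f has_derivative f' x) (at x)"
    and "\<And>v. Ck_on k S (\<lambda>x. der f x v)"
  shows "Ck_on (Suc k) S f"
  using assms by (auto simp: differentiable_on_eq_differentiable_at differentiable_def)

lemma Ck_on_SucD:
  assumes "open S" "Ck_on (Suc k) S f"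
  shows "\<And>x. x \<in> S \<Longrightarrow> (f has_derivative der f x) (at x)" "Ck_on k S (\<lambda>x. der f x v)"
  using assms by (auto simp: differentiable_on_eq_differentiable_at frechet_derivative_works)

text \<open>No differentiability is assumed: the two functions have the same derivatives at x, and
  \<open>der\<close> is chosen among these, so the choices agree even where no derivative
  exists.\<close>

lemma der_cong_open:
  assumes "open S" "x \<in> S" "\<And>y. y \<in> S \<Longrightarrow> f y = g y"
  shows "der f x = der g x"
proof -
  have "(f has_derivative h) (at x) \<longleftrightarrow> (g has_derivative h) (at x)" for h
    using assms has_derivative_transform_within_open[of f h x UNIV S g]
      has_derivative_transform_within_open[of g h x UNIV S f] by auto
  then show ?thesis
    by (simp add: frechet_derivative_def)
qed

lemma Ck_on_cong:
  assumes "open S" "\<And>x. x \<in> S \<Longrightarrow> f x = g x" "Ck_on k S f"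
  shows "Ck_on k S g"
  using assms(2,3)
proof (induction k arbitrary: f g)
  case 0
  then show ?case by (simp cong: continuous_on_cong)
next
  case (Suc k)
  have "(g has_derivative der f x) (at x)" if "x \<in> S" for x
    using Ck_on_SucD(1)[OF assms(1) Suc.prems(2) that] assms(1) that Suc.prems(1)
    by (auto intro: has_derivative_transform_within_open)
  moreover have "Ck_on k S (\<lambda>x. der g x v)" for v
    using Suc.IH[of "\<lambda>x. der f x v" "\<lambda>x. der g x v"] Ck_on_SucD(2)[OF assms(1) Suc.prems(2)]
      der_cong_open[OF assms(1)] Suc.prems(1) by metis
  ultimately show ?case
    by (rule Ck_on_SucI[OF assms(1)])
qed

text \<open>The form in which the induction step is used: the derivative may be given on S by any
  formula f' obtained from the differentiation rules.\<close>

lemma Ck_on_der_cong: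
  assumes "open S" "\<And>x. x \<in> S \<Longrightarrow> (f has_derivative f' x) (at x)" "\<And>v. Ck_on k S (\<lambda>x. f' x v)"
  shows "Ck_on (Suc k) S f"
proof (rule Ck_on_SucI[OF assms(1,2)])
  show "Ck_on k S (\<lambda>x. der f x v)" for v
    by (rule Ck_on_cong[OF assms(1) _ assms(3)[of v]]) (simp add: der_eqI[OF assms(2)])
qed

lemma Ck_on_Suc_imp: "Ck_on (Suc k) S f \<Longrightarrow> Ck_on k S f"
proof (induction k arbitrary: f)
  case 0
  then show ?case by (simp add: differentiable_imp_continuous_on)
next
  case (Suc k)
  then show ?case by (metis Ck_on.simps(2))
qed

lemma Ck_on_subset: "Ck_on k S f \<Longrightarrow> T \<subseteq> S \<Longrightarrow> Ck_on k T f"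
proof (induction k arbitrary: f)
  case 0
  then show ?case by (auto intro: continuous_on_subset)
next
  case (Suc k)
  then show ?case by (auto intro: differentiable_on_subset)
qed

lemma Ck_on_const: "open S \<Longrightarrow> Ck_on k S (\<lambda>x. c)"
  by (induction k arbitrary: c) auto

lemma Ck_on_linear:
  assumes "open S" "bounded_linear h" "Ck_on k S f"
  shows "Ck_on k S (\<lambda>x. h (f x))"
  using assms(3)
proof (induction k arbitrary: f)
  case 0
  then show ?case by (simp add: bounded_linear.continuous_on[OF assms(2)])
next
  case (Suc k)
  show ?case
    by (rule Ck_on_der_cong[OF assms(1)
          bounded_linear.has_derivative[OF assms(2) Ck_on_SucD(1)[OF assms(1) Suc.prems]]])
      (auto intro!: Suc.IH Ck_on_SucD(2)[OF assms(1) Suc.prems])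
qed

lemma Ck_on_add:
  assumes "open S" "Ck_on k S f" "Ck_on k S g"
  shows "Ck_on k S (\<lambda>x. f x + g x)"
  using assms(2,3)
proof (induction k arbitrary: f g)
  case 0
  then show ?case by (auto intro: continuous_intros)
next
  case (Suc k)
  show ?case
    by (rule Ck_on_der_cong[OF assms(1)
          has_derivative_add[OF Ck_on_SucD(1)[OF assms(1) Suc.prems(1)] Ck_on_SucD(1)[OF assms(1) Suc.prems(2)]]])
      (auto intro!: Suc.IH Ck_on_SucD(2)[OF assms(1) Suc.prems(1)] Ck_on_SucD(2)[OF assms(1) Suc.prems(2)])
qed

lemma Ck_on_sum:
  assumes "open S" "\<And>i. i \<in> I \<Longrightarrow> Ck_on k S (f i)"
  shows "Ck_on k S (\<lambda>x. \<Sum>i\<in>I. f i x)"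
  using assms(2)
  by (induction I rule: infinite_finite_induct) (auto intro!: Ck_on_const Ck_on_add assms(1))

lemma Ck_on_bilinear:
  assumes "open S" "bounded_bilinear pr" "Ck_on k S f" "Ck_on k S g"
  shows "Ck_on k S (\<lambda>x. pr (f x) (g x))"
  using assms(3,4)
proof (induction k arbitrary: f g)
  case 0
  then show ?case by (simp add: bounded_bilinear.continuous_on[OF assms(2)])
next
  case (Suc k)
  show ?case
    by (rule Ck_on_der_cong[OF assms(1) bounded_bilinear.FDERIV[OF assms(2)
            Ck_on_SucD(1)[OF assms(1) Suc.prems(1)] Ck_on_SucD(1)[OF assms(1) Suc.prems(2)]]])
      (auto intro!: Ck_on_add[OF assms(1)] Suc.IH Ck_on_Suc_imp[OF Suc.prems(1)] Ck_on_Suc_imp[OF Suc.prems(2)]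
        Ck_on_SucD(2)[OF assms(1) Suc.prems(1)] Ck_on_SucD(2)[OF assms(1) Suc.prems(2)])
qed

lemma Ck_on_inverse:
  fixes f :: "'a::euclidean_space \<Rightarrow> real"
  assumes "open S" "Ck_on k S f" "\<And>x. x \<in> S \<Longrightarrow> f x \<noteq> 0"
  shows "Ck_on k S (\<lambda>x. inverse (f x))"
  using assms(2)
proof (induction k)
  case 0
  then show ?case using assms(3) by (auto intro: continuous_intros)
next
  case (Suc k)
  have "((\<lambda>x. inverse (f x)) has_derivative (\<lambda>v. - (inverse (f x) * der f x v * inverse (f x)))) (at x)"
    if "x \<in> S" for x
    by (rule Deriv.has_derivative_inverse[OF assms(3)[OF that] Ck_on_SucD(1)[OF assms(1) Suc.prems that]])
  then show ?case
  proof (rule Ck_on_der_cong[OF assms(1)])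
    note inv = Suc.IH[OF Ck_on_Suc_imp[OF Suc.prems(1)]]
    show "Ck_on k S (\<lambda>x. - (inverse (f x) * der f x v * inverse (f x)))" for v
      by (rule Ck_on_linear[OF assms(1) bounded_linear_minus[OF bounded_linear_ident]],
          intro Ck_on_bilinear[OF assms(1) bounded_bilinear_mult] inv Ck_on_SucD(2)[OF assms(1) Suc.prems(1)])
  qed
qed

text \<open>\<open>Ck_on\<close> differentiates in fixed directions only. The expansion turns a
  linear map evaluated at a moving vector into a finite sum over fixed vectors with scalar
  coefficients. The codomain is an arbitrary real vector space, so that it also covers maps into
  tangent vectors.\<close>

lemma linear_expand_Basis:
  fixes A :: "'a::euclidean_space \<Rightarrow> 'b::real_vector"
  assumes "linear A"
  shows "A w = (\<Sum>b\<in>Basis. (w \<bullet> b) *\<^sub>R A b)"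
proof -
  have "A w = A (\<Sum>b\<in>Basis. (w \<bullet> b) *\<^sub>R b)"
    by (simp only: euclidean_representation)
  also have "\<dots> = (\<Sum>b\<in>Basis. A ((w \<bullet> b) *\<^sub>R b))"
    by (rule linear_sum[OF assms])
  finally show ?thesis
    by (simp only: linear_scale[OF assms])
qed

lemma Ck_on_compose:
  fixes f :: "'a::euclidean_space \<Rightarrow> 'b::euclidean_space" and g :: "'b \<Rightarrow> 'c::real_normed_vector"
  assumes "open S" "open T" "f ` S \<subseteq> T" "Ck_on k S f" "Ck_on k T g"
  shows "Ck_on k S (\<lambda>x. g (f x))"
  using assms(4,5)
proof (induction k arbitrary: g)
  case 0
  then show ?case
    using assms(3) by (auto intro: continuous_on_compose2[where f = f and g = g])
next
  case (Suc k)
  note df = Ck_on_SucD[OF assms(1) Suc.prems(1)] and dg = Ck_on_SucD[OF assms(2) Suc.prems(2)]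
  \<comment> \<open>By the chain rule the derivative is \<open>der g (f x) (der f x v)\<close>,
    whose inner vector moves with x; the expansion leaves only products of functions covered by the
    induction.\<close>
  have "((\<lambda>x. g (f x)) has_derivative (\<lambda>v. \<Sum>b\<in>Basis. (der f x v \<bullet> b) *\<^sub>R der g (f x) b)) (at x)"
    if "x \<in> S" for x
  proof -
    have fx: "f x \<in> T" using that assms(3) by auto
    have "((\<lambda>x. g (f x)) has_derivative (\<lambda>v. der g (f x) (der f x v))) (at x)"
      by (rule has_derivative_compose[OF df(1)[OF that] dg(1)[OF fx]])
    then show ?thesis
      by (subst (asm) linear_expand_Basis[OF has_derivative_linear[OF dg(1)[OF fx]]])
  qed
  then show ?case
  proof (rule Ck_on_der_cong[OF assms(1)])
    fix v
    have "Ck_on k S (\<lambda>x. der f x v \<bullet> b)" "Ck_on k S (\<lambda>x. der g (f x) b)" for b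
      by (rule Ck_on_linear[OF assms(1) bounded_linear_inner_left df(2)],
          rule Suc.IH[OF Ck_on_Suc_imp[OF Suc.prems(1)] dg(2)])
    then show "Ck_on k S (\<lambda>x. \<Sum>b\<in>Basis. (der f x v \<bullet> b) *\<^sub>R der g (f x) b)"
      by (intro Ck_on_sum[OF assms(1)] Ck_on_bilinear[OF assms(1) bounded_bilinear_scaleR])
  qed
qed

lemma smooth_on_imp_has_derivative:
  "open S \<Longrightarrow> smooth_on S f \<Longrightarrow> x \<in> S \<Longrightarrow> (f has_derivative der f x) (at x)"
  unfolding smooth_on_def using Ck_on_SucD(1) by metis

lemma smooth_on_imp_differentiable:
  "open S \<Longrightarrow> smooth_on S f \<Longrightarrow> x \<in> S \<Longrightarrow> f differentiable at x"
  using smooth_on_imp_has_derivative differentiable_def by blast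

lemma smooth_on_der: "smooth_on S f \<Longrightarrow> smooth_on S (\<lambda>x. der f x v)"
  unfolding smooth_on_def by (metis Ck_on.simps(2))

lemma smooth_on_imp_continuous_on: "smooth_on S f \<Longrightarrow> continuous_on S f"
  unfolding smooth_on_def by (metis Ck_on.simps(1))

lemma smooth_on_cong:
  "open S \<Longrightarrow> smooth_on S f \<Longrightarrow> (\<And>x. x \<in> S \<Longrightarrow> f x = g x) \<Longrightarrow> smooth_on S g"
  unfolding smooth_on_def by (auto intro: Ck_on_cong[where f = f and g = g])

lemma smooth_on_subset: "smooth_on S f \<Longrightarrow> T \<subseteq> S \<Longrightarrow> smooth_on T f"
  unfolding smooth_on_def using Ck_on_subset by blast

lemma smooth_on_const [simp]: "open S \<Longrightarrow> smooth_on S (\<lambda>x. c)"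
  unfolding smooth_on_def by (simp add: Ck_on_const)

lemma smooth_on_linear: "open S \<Longrightarrow> bounded_linear h \<Longrightarrow> smooth_on S f \<Longrightarrow> smooth_on S (\<lambda>x. h (f x))"
  unfolding smooth_on_def by (simp add: Ck_on_linear)

lemma smooth_on_add: "open S \<Longrightarrow> smooth_on S f \<Longrightarrow> smooth_on S g \<Longrightarrow> smooth_on S (\<lambda>x. f x + g x)"
  unfolding smooth_on_def by (simp add: Ck_on_add)

lemma smooth_on_minus: "open S \<Longrightarrow> smooth_on S f \<Longrightarrow> smooth_on S (\<lambda>x. - f x)"
  by (rule smooth_on_linear[OF _ bounded_linear_minus[OF bounded_linear_ident]])

lemma smooth_on_diff: "open S \<Longrightarrow> smooth_on S f \<Longrightarrow> smooth_on S g \<Longrightarrow> smooth_on S (\<lambda>x. f x - g x)"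
  using smooth_on_add[of S f "\<lambda>x. - g x"] smooth_on_minus[of S g] by simp

lemma smooth_on_sum: "open S \<Longrightarrow> (\<And>i. i \<in> I \<Longrightarrow> smooth_on S (f i)) \<Longrightarrow> smooth_on S (\<lambda>x. \<Sum>i\<in>I. f i x)"
  unfolding smooth_on_def by (simp add: Ck_on_sum)

lemma smooth_on_scaleR:
  "open S \<Longrightarrow> smooth_on S f \<Longrightarrow> smooth_on S g \<Longrightarrow> smooth_on S (\<lambda>x. f x *\<^sub>R g x)"
  unfolding smooth_on_def by (simp add: Ck_on_bilinear[OF _ bounded_bilinear_scaleR])

lemma smooth_on_mult:
  fixes f g :: "'a::euclidean_space \<Rightarrow> real"
  shows "open S \<Longrightarrow> smooth_on S f \<Longrightarrow> smooth_on S g \<Longrightarrow> smooth_on S (\<lambda>x. f x * g x)"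
  unfolding smooth_on_def by (simp add: Ck_on_bilinear[OF _ bounded_bilinear_mult])

lemma smooth_on_inner_const: "open S \<Longrightarrow> smooth_on S f \<Longrightarrow> smooth_on S (\<lambda>x. f x \<bullet> b)"
  by (rule smooth_on_linear[OF _ bounded_linear_inner_left])

lemma smooth_on_divide:
  fixes f g :: "'a::euclidean_space \<Rightarrow> real"
  shows "open S \<Longrightarrow> smooth_on S f \<Longrightarrow> smooth_on S g \<Longrightarrow> (\<And>x. x \<in> S \<Longrightarrow> g x \<noteq> 0)
    \<Longrightarrow> smooth_on S (\<lambda>x. f x / g x)"
  unfolding smooth_on_def divide_inverse
  by (intro allI Ck_on_bilinear[OF _ bounded_bilinear_mult] Ck_on_inverse) auto

lemma smooth_on_compose:
  fixes f :: "'a::euclidean_space \<Rightarrow> 'b::euclidean_space" and g :: "'b \<Rightarrow> 'c::real_normed_vector"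
  shows "open S \<Longrightarrow> open T \<Longrightarrow> f ` S \<subseteq> T \<Longrightarrow> smooth_on S f \<Longrightarrow> smooth_on T g \<Longrightarrow> smooth_on S (\<lambda>x. g (f x))"
  unfolding smooth_on_def by (auto intro: Ck_on_compose[where f = f and g = g])

lemma Ck_on_local:
  assumes "open S" "\<And>x. x \<in> S \<Longrightarrow> \<exists>T. open T \<and> x \<in> T \<and> Ck_on k T f"
  shows "Ck_on k S f"
  using assms(2)
proof (induction k arbitrary: f)
  case 0
  then have "continuous (at x) f" if "x \<in> S" for x
    using that by (metis Ck_on.simps(1) continuous_on_eq_continuous_at)
  then show ?case by (simp add: continuous_at_imp_continuous_on)
next
  case (Suc k)
  show ?case
  proof (rule Ck_on_der_cong[OF assms(1)])
    fix x assume "x \<in> S"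
    then obtain T where T: "open T" "x \<in> T" "Ck_on (Suc k) T f"
      using Suc.prems by blast
    then show "(f has_derivative der f x) (at x)"
      by (intro Ck_on_SucD(1))
  next
    fix v
    show "Ck_on k S (\<lambda>x. der f x v)"
    proof (rule Suc.IH)
      fix x assume "x \<in> S"
      then obtain T where T: "open T" "x \<in> T" "Ck_on (Suc k) T f"
        using Suc.prems by blast
      then show "\<exists>T. open T \<and> x \<in> T \<and> Ck_on k T (\<lambda>x. der f x v)"
        by (intro exI[of _ T] conjI Ck_on_SucD(2))
    qed
  qed
qed

lemma smooth_on_local:
  assumes "open S" "\<And>x. x \<in> S \<Longrightarrow> \<exists>T. open T \<and> x \<in> T \<and> smooth_on T f"
  shows "smooth_on S f"
  unfolding smooth_on_def
proof (intro allI Ck_on_local[OF assms(1)])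
  show "\<exists>T. open T \<and> x \<in> T \<and> Ck_on k T f" if "x \<in> S" for x k
    using assms(2)[OF that] unfolding smooth_on_def by blast
qed

section \<open>Linear maps depending smoothly on a point\<close>

lemma linear_der: "open S \<Longrightarrow> smooth_on S f \<Longrightarrow> x \<in> S \<Longrightarrow> linear (der f x)"
  by (rule has_derivative_linear[OF smooth_on_imp_has_derivative])

lemma smooth_on_family:
  fixes A :: "'a::euclidean_space \<Rightarrow> 'b::euclidean_space \<Rightarrow> 'c::real_normed_vector"
  assumes "open S" "\<And>x. x \<in> S \<Longrightarrow> linear (A x)" "\<And>b. smooth_on S (\<lambda>x. A x b)" "smooth_on S Y"
  shows "smooth_on S (\<lambda>x. A x (Y x))"
proof (rule smooth_on_cong[OF assms(1)])
  show "smooth_on S (\<lambda>x. \<Sum>b\<in>Basis. (Y x \<bullet> b) *\<^sub>R A x b)"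
    by (intro smooth_on_sum smooth_on_scaleR smooth_on_inner_const assms)
  show "(\<Sum>b\<in>Basis. (Y x \<bullet> b) *\<^sub>R A x b) = A x (Y x)" if "x \<in> S" for x
    by (rule linear_expand_Basis[OF assms(2)[OF that], symmetric])
qed

text \<open>A product rule: in the first summand the vector is frozen at \<open>Y x\<close>, so that
  only the family is differentiated. For metrics, Christoffel maps and J this summand is the
  derivative on constant fields, the one which the patch axioms speak about.\<close>

lemma has_derivative_family:
  fixes A :: "'a::euclidean_space \<Rightarrow> 'b::euclidean_space \<Rightarrow> 'c::real_normed_vector"
  assumes "open S" "\<And>x. x \<in> S \<Longrightarrow> linear (A x)" "x \<in> S"
    and "\<And>b. (\<lambda>z. A z b) differentiable at x" "(Y has_derivative Y') (at x)"
  shows "((\<lambda>z. A z (Y z)) has_derivative (\<lambda>v. der (\<lambda>z. A z (Y x)) x v + A x (Y' v))) (at x)"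
proof -
  have dA: "((\<lambda>z. A z b) has_derivative der (\<lambda>z. A z b) x) (at x)" for b
    using assms(4) frechet_derivative_works by blast
  have "((\<lambda>z. \<Sum>b\<in>Basis. (Y x \<bullet> b) *\<^sub>R A z b) has_derivative
      (\<lambda>v. \<Sum>b\<in>Basis. (Y x \<bullet> b) *\<^sub>R der (\<lambda>z. A z b) x v)) (at x)"
    by (intro has_derivative_sum has_derivative_scaleR_right dA)
  then have "((\<lambda>z. A z (Y x)) has_derivative
      (\<lambda>v. \<Sum>b\<in>Basis. (Y x \<bullet> b) *\<^sub>R der (\<lambda>z. A z b) x v)) (at x)"
    by (rule has_derivative_transform_within_open[OF _ assms(1,3)])
      (rule linear_expand_Basis[OF assms(2), symmetric])
  then have eq: "der (\<lambda>z. A z (Y x)) x = (\<lambda>v. \<Sum>b\<in>Basis. (Y x \<bullet> b) *\<^sub>R der (\<lambda>z. A z b) x v)"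
    by (rule der_eqI)
  have "((\<lambda>z. \<Sum>b\<in>Basis. (Y z \<bullet> b) *\<^sub>R A z b) has_derivative
      (\<lambda>v. \<Sum>b\<in>Basis. (Y x \<bullet> b) *\<^sub>R der (\<lambda>z. A z b) x v + (Y' v \<bullet> b) *\<^sub>R A x b)) (at x)"
    by (intro has_derivative_sum has_derivative_scaleR has_derivative_inner_left dA assms(5))
  then have "((\<lambda>z. A z (Y z)) has_derivative
      (\<lambda>v. \<Sum>b\<in>Basis. (Y x \<bullet> b) *\<^sub>R der (\<lambda>z. A z b) x v + (Y' v \<bullet> b) *\<^sub>R A x b)) (at x)"
    by (rule has_derivative_transform_within_open[OF _ assms(1,3)])
      (rule linear_expand_Basis[OF assms(2), symmetric])
  then show ?thesis
    unfolding eq linear_expand_Basis[OF assms(2)[OF assms(3)], of "Y' _"] by (simp add: sum.distrib)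
qed

section \<open>Symmetry of second derivatives\<close>

text \<open>The mean value theorem is applied twice. The second difference is symmetric in u and v,
  while the right-hand side is a mixed derivative in one fixed order; comparing both orders gives
  the symmetry of second derivatives.\<close>

lemma second_difference_mvt:
  fixes f :: "'a::euclidean_space \<Rightarrow> real"
  assumes S: "open S" "smooth_on S f" and ball: "ball x \<delta> \<subseteq> S" and t: "t > 0" "t * (norm u + norm v) < \<delta>"
  shows "\<exists>p\<in>ball x \<delta>. f (x + t *\<^sub>R u + t *\<^sub>R v) - f (x + t *\<^sub>R u) - f (x + t *\<^sub>R v) + f x
    = t * t * der (\<lambda>z. der f z u) p v"
proof -
  have inb: "x + s *\<^sub>R u + r *\<^sub>R v \<in> ball x \<delta>" if "0 \<le> s" "s \<le> t" "0 \<le> r" "r \<le> t" for s r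
  proof -
    have "norm (s *\<^sub>R u + r *\<^sub>R v) \<le> s * norm u + r * norm v"
      using that norm_triangle_ineq[of "s *\<^sub>R u" "r *\<^sub>R v"] by simp
    also have "\<dots> \<le> t * norm u + t * norm v"
      using that by (intro add_mono mult_right_mono) auto
    finally have "norm (s *\<^sub>R u + r *\<^sub>R v) < \<delta>"
      using t(2) by (simp add: algebra_simps)
    moreover have "dist x (x + s *\<^sub>R u + r *\<^sub>R v) = norm (s *\<^sub>R u + r *\<^sub>R v)"
      by (metis ab_semigroup_add_class.add_ac(1) add_diff_cancel_left' dist_commute dist_norm)
    ultimately show ?thesis by simp
  qed
  have line: "((\<lambda>s. h (w + s *\<^sub>R e)) has_real_derivative der h (w + s *\<^sub>R e) e) (at s)"
    if h: "smooth_on S h" and w: "w + s *\<^sub>R e \<in> S" for h :: "'a \<Rightarrow> real" and w s e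
  proof -
    have hd: "(h has_derivative der h (w + s *\<^sub>R e)) (at (w + s *\<^sub>R e))"
      by (rule smooth_on_imp_has_derivative[OF S(1) h w])
    have "((\<lambda>s. h (w + s *\<^sub>R e)) has_derivative (\<lambda>r. der h (w + s *\<^sub>R e) (r *\<^sub>R e))) (at s)"
      by (rule has_derivative_compose[of "\<lambda>s. w + s *\<^sub>R e" "\<lambda>r. r *\<^sub>R e" s UNIV h, OF _ hd])
        (auto intro!: derivative_eq_intros)
    then show ?thesis
      using linear_cmul[OF has_derivative_linear[OF hd]]
      by (simp add: has_field_derivative_def mult.commute[of "der h (w + s *\<^sub>R e) e"] mult_commute_abs)
  qed
  \<comment> \<open>First in the direction u, for the increment of f by
    \<open>t *\<^sub>R v\<close>; the resulting increment of the derivative is then treated in the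
    direction v.\<close>
  have "\<exists>s>0. s < t \<and> (\<lambda>s. f (x + t *\<^sub>R v + s *\<^sub>R u) - f (x + s *\<^sub>R u)) t
      - (\<lambda>s. f (x + t *\<^sub>R v + s *\<^sub>R u) - f (x + s *\<^sub>R u)) 0
      = (t - 0) * (der f (x + t *\<^sub>R v + s *\<^sub>R u) u - der f (x + s *\<^sub>R u) u)"
  proof (rule MVT2[OF t(1)])
    fix s assume s: "0 \<le> s" "s \<le> t"
    have 1: "x + t *\<^sub>R v + s *\<^sub>R u \<in> S" "x + s *\<^sub>R u \<in> S"
      using inb[OF s, of t] inb[OF s, of 0] t(1) ball by (auto simp: algebra_simps)
    show "((\<lambda>s. f (x + t *\<^sub>R v + s *\<^sub>R u) - f (x + s *\<^sub>R u)) has_real_derivative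
        der f (x + t *\<^sub>R v + s *\<^sub>R u) u - der f (x + s *\<^sub>R u) u) (at s)"
      by (intro DERIV_diff line S(2) 1)
  qed
  then obtain s where s: "0 < s" "s < t"
    and e1: "f (x + t *\<^sub>R v + t *\<^sub>R u) - f (x + t *\<^sub>R u) - (f (x + t *\<^sub>R v) - f x)
      = t * (der f (x + t *\<^sub>R v + s *\<^sub>R u) u - der f (x + s *\<^sub>R u) u)"
    by auto
  have "\<exists>r>0. r < t \<and> der f (x + s *\<^sub>R u + t *\<^sub>R v) u - der f (x + s *\<^sub>R u + 0 *\<^sub>R v) u
      = (t - 0) * der (\<lambda>z. der f z u) (x + s *\<^sub>R u + r *\<^sub>R v) v"
  proof (rule MVT2[OF t(1)])
    fix r assume r: "0 \<le> r" "r \<le> t"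
    show "((\<lambda>r. der f (x + s *\<^sub>R u + r *\<^sub>R v) u) has_real_derivative
        der (\<lambda>z. der f z u) (x + s *\<^sub>R u + r *\<^sub>R v) v) (at r)"
      using inb[of s r] s r ball by (intro line smooth_on_der S(2)) auto
  qed
  then obtain r where r: "0 < r" "r < t"
    and e2: "der f (x + s *\<^sub>R u + t *\<^sub>R v) u - der f (x + s *\<^sub>R u) u
      = t * der (\<lambda>z. der f z u) (x + s *\<^sub>R u + r *\<^sub>R v) v"
    by auto
  show ?thesis
  proof (rule bexI)
    show "x + s *\<^sub>R u + r *\<^sub>R v \<in> ball x \<delta>" using inb s r by auto
    have "der f (x + t *\<^sub>R v + s *\<^sub>R u) u - der f (x + s *\<^sub>R u) u
      = t * der (\<lambda>z. der f z u) (x + s *\<^sub>R u + r *\<^sub>R v) v"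
      using e2 by (simp add: algebra_simps)
    then show "f (x + t *\<^sub>R u + t *\<^sub>R v) - f (x + t *\<^sub>R u) - f (x + t *\<^sub>R v) + f x
      = t * t * der (\<lambda>z. der f z u) (x + s *\<^sub>R u + r *\<^sub>R v) v"
      using e1 by (simp add: algebra_simps)
  qed
qed

lemma symmetric_der_real:
  fixes f :: "'a::euclidean_space \<Rightarrow> real"
  assumes S: "open S" "smooth_on S f" "x \<in> S"
  shows "der (\<lambda>z. der f z u) x v = der (\<lambda>z. der f z v) x u"
proof (rule ccontr)
  let ?A = "\<lambda>z. der (\<lambda>z. der f z u) z v" and ?B = "\<lambda>z. der (\<lambda>z. der f z v) z u"
  assume ne: "?A x \<noteq> ?B x"
  \<comment> \<open>Half the gap: two values closer than e to the two limits cannot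
    coincide.\<close>
  define e where "e = \<bar>?A x - ?B x\<bar> / 2"
  have e: "e > 0" using ne by (simp add: e_def)
  have c: "continuous (at x) ?A" "continuous (at x) ?B"
    using smooth_on_imp_continuous_on[OF smooth_on_der[OF smooth_on_der[OF S(2)]]] S(1,3)
    by (auto simp: continuous_on_eq_continuous_at)
  obtain d1 where d1: "d1 > 0" "\<And>y. dist y x < d1 \<Longrightarrow> dist (?A y) (?A x) < e"
    using c(1) e unfolding continuous_at_eps_delta by (metis dist_commute)
  obtain d2 where d2: "d2 > 0" "\<And>y. dist y x < d2 \<Longrightarrow> dist (?B y) (?B x) < e"
    using c(2) e unfolding continuous_at_eps_delta by (metis dist_commute)
  obtain d3 where d3: "d3 > 0" "ball x d3 \<subseteq> S"
    using S openE by blast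
  define d where "d = min d1 (min d2 d3)"
  have d: "d > 0" "ball x d \<subseteq> S" using d1 d2 d3 by (auto simp: d_def)
  \<comment> \<open>The summand 1 keeps the denominator positive when u = v = 0.\<close>
  define t where "t = d / (norm u + norm v + 1)"
  have pos: "norm u + norm v + 1 > 0"
    by (simp add: add_nonneg_pos)
  have t: "t > 0" "t * (norm u + norm v) < d" "t * (norm v + norm u) < d"
    using d(1) pos by (auto simp: t_def field_simps)
  obtain p where p: "p \<in> ball x d"
    "f (x + t *\<^sub>R u + t *\<^sub>R v) - f (x + t *\<^sub>R u) - f (x + t *\<^sub>R v) + f x = t * t * ?A p"
    using second_difference_mvt[OF S(1,2) d(2) t(1,2)] by blast
  obtain q where q: "q \<in> ball x d"
    "f (x + t *\<^sub>R v + t *\<^sub>R u) - f (x + t *\<^sub>R v) - f (x + t *\<^sub>R u) + f x = t * t * ?B q"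
    using second_difference_mvt[OF S(1,2) d(2) t(1,3)] by blast
  have "t * t * ?A p = t * t * ?B q"
    using p(2) q(2) by (simp add: algebra_simps)
  then have "?A p = ?B q" using t(1) by simp
  moreover have "dist (?A p) (?A x) < e" "dist (?B q) (?B x) < e"
    using p(1) q(1) d1(2) d2(2) by (auto simp: d_def dist_commute)
  ultimately show False
    unfolding e_def dist_real_def by argo
qed

lemma symmetric_der:
  fixes f :: "'a::euclidean_space \<Rightarrow> 'b::euclidean_space"
  assumes S: "open S" "smooth_on S f" "x \<in> S"
  shows "der (\<lambda>z. der f z u) x v = der (\<lambda>z. der f z v) x u"
proof (rule euclidean_eqI)
  fix b :: 'b assume "b \<in> Basis"
  have 1: "der (\<lambda>z. h z \<bullet> b) z w = der h z w \<bullet> b" if "smooth_on S h" "z \<in> S" for h :: "'a \<Rightarrow> 'b" and z w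
    using der_eqI[OF has_derivative_inner_left[OF smooth_on_imp_has_derivative[OF S(1) that], of b]] by simp
  have 2: "der (\<lambda>z. der f z w) x w' \<bullet> b = der (\<lambda>z. der (\<lambda>z. f z \<bullet> b) z w) x w'" for w w'
    using der_cong_open[OF S(1,3), of "\<lambda>z. der (\<lambda>z. f z \<bullet> b) z w" "\<lambda>z. der f z w \<bullet> b"]
    by (simp add: 1 S smooth_on_der)
  show "der (\<lambda>z. der f z u) x v \<bullet> b = der (\<lambda>z. der f z v) x u \<bullet> b"
    unfolding 2 by (rule symmetric_der_real[OF S(1) smooth_on_inner_const[OF S(1,2)] S(3)])
qed

section \<open>Bilinear and trilinear maps depending smoothly on a point\<close>

lemma smooth_on_family2:
  fixes A :: "'a::euclidean_space \<Rightarrow> 'b::euclidean_space \<Rightarrow> 'c::euclidean_space \<Rightarrow> 'd::real_normed_vector"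
  assumes "open S" "\<And>x c. x \<in> S \<Longrightarrow> linear (\<lambda>b. A x b c)" "\<And>x b. x \<in> S \<Longrightarrow> linear (A x b)"
    and "\<And>b c. smooth_on S (\<lambda>x. A x b c)" "smooth_on S X" "smooth_on S Y"
  shows "smooth_on S (\<lambda>x. A x (X x) (Y x))"
  by (rule smooth_on_family[OF assms(1) assms(3)
        smooth_on_family[OF assms(1) assms(2) assms(4) assms(5)] assms(6)])

lemma smooth_on_family3:
  fixes A :: "'a::euclidean_space \<Rightarrow> 'b::euclidean_space \<Rightarrow> 'c::euclidean_space \<Rightarrow> 'd::euclidean_space \<Rightarrow> 'f::real_normed_vector"
  assumes "open S" "\<And>x c d. x \<in> S \<Longrightarrow> linear (\<lambda>b. A x b c d)" "\<And>x b d. x \<in> S \<Longrightarrow> linear (\<lambda>c. A x b c d)"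
    and "\<And>x b c. x \<in> S \<Longrightarrow> linear (A x b c)"
    and "\<And>b c d. smooth_on S (\<lambda>x. A x b c d)" "smooth_on S X" "smooth_on S Y" "smooth_on S Z"
  shows "smooth_on S (\<lambda>x. A x (X x) (Y x) (Z x))"
  by (rule smooth_on_family[OF assms(1) assms(4)
        smooth_on_family2[OF assms(1) assms(2) assms(3) assms(5) assms(6,7)] assms(8)])

lemma has_derivative_family2:
  fixes A :: "'a::euclidean_space \<Rightarrow> 'b::euclidean_space \<Rightarrow> 'c::euclidean_space \<Rightarrow> 'd::real_normed_vector"
  assumes "open S" "\<And>x c. x \<in> S \<Longrightarrow> linear (\<lambda>b. A x b c)" "\<And>x b. x \<in> S \<Longrightarrow> linear (A x b)"
    and "x \<in> S" "\<And>b c. (\<lambda>z. A z b c) differentiable at x"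
    and "(X has_derivative X') (at x)" "(Y has_derivative Y') (at x)"
  shows "((\<lambda>z. A z (X z) (Y z)) has_derivative
    (\<lambda>v. der (\<lambda>z. A z (X x) (Y x)) x v + A x (X' v) (Y x) + A x (X x) (Y' v))) (at x)"
proof -
  have 1: "((\<lambda>z. A z (X z) c) has_derivative (\<lambda>v. der (\<lambda>z. A z (X x) c) x v + A x (X' v) c)) (at x)" for c
    by (rule has_derivative_family[OF assms(1) assms(2) assms(4) assms(5) assms(6)])
  have "((\<lambda>z. A z (X z) (Y z)) has_derivative
      (\<lambda>v. der (\<lambda>z. A z (X z) (Y x)) x v + A x (X x) (Y' v))) (at x)"
    by (rule has_derivative_family[OF assms(1) assms(3) assms(4) _ assms(7)], assumption)
      (rule differentiableI[OF 1])
  then show ?thesis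
    unfolding der_eqI[OF 1] .
qed

lemma has_derivative_family3:
  fixes A :: "'a::euclidean_space \<Rightarrow> 'b::euclidean_space \<Rightarrow> 'c::euclidean_space \<Rightarrow> 'd::euclidean_space \<Rightarrow> 'f::real_normed_vector"
  assumes "open S" "\<And>x c d. x \<in> S \<Longrightarrow> linear (\<lambda>b. A x b c d)" "\<And>x b d. x \<in> S \<Longrightarrow> linear (\<lambda>c. A x b c d)"
    and "\<And>x b c. x \<in> S \<Longrightarrow> linear (A x b c)"
    and "x \<in> S" "\<And>b c d. (\<lambda>z. A z b c d) differentiable at x"
    and "(X has_derivative X') (at x)" "(Y has_derivative Y') (at x)" "(Z has_derivative Z') (at x)"
  shows "((\<lambda>z. A z (X z) (Y z) (Z z)) has_derivative
    (\<lambda>v. der (\<lambda>z. A z (X x) (Y x) (Z x)) x v + A x (X' v) (Y x) (Z x) + A x (X x) (Y' v) (Z x)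
      + A x (X x) (Y x) (Z' v))) (at x)"
proof -
  have 1: "((\<lambda>z. A z (X z) (Y z) d) has_derivative
      (\<lambda>v. der (\<lambda>z. A z (X x) (Y x) d) x v + A x (X' v) (Y x) d + A x (X x) (Y' v) d)) (at x)" for d
    by (rule has_derivative_family2[OF assms(1) assms(2) assms(3) assms(5) assms(6) assms(7,8)])
  have "((\<lambda>z. A z (X z) (Y z) (Z z)) has_derivative
      (\<lambda>v. der (\<lambda>z. A z (X z) (Y z) (Z x)) x v + A x (X x) (Y x) (Z' v))) (at x)"
    by (rule has_derivative_family[OF assms(1) assms(4) assms(5) _ assms(9)], assumption)
      (rule differentiableI[OF 1])
  then show ?thesis
    unfolding der_eqI[OF 1] .
qed


section \<open>Riemannian metrics in coordinates\<close>

text \<open>The Christoffel map \<open>\<Gamma>\<close> is a parameter and not computed from G,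
  because the connection of a manifold is given. Symmetry and compatibility are required for
  constant fields only; the product rules extend them to all fields.\<close>

locale riem_patch =
  fixes S :: "'e::euclidean_space set" and G :: "'e \<Rightarrow> 'e \<Rightarrow> 'e \<Rightarrow> real" and \<Gamma> :: "'e \<Rightarrow> 'e \<Rightarrow> 'e \<Rightarrow> 'e"
  assumes open_S: "open S"
    and G_smooth: "\<And>u v. smooth_on S (\<lambda>z. G z u v)"
    and G_linear: "\<And>z u. z \<in> S \<Longrightarrow> linear (G z u)"
    and G_sym: "\<And>z u v. z \<in> S \<Longrightarrow> G z u v = G z v u"
    and G_pos: "\<And>z u. z \<in> S \<Longrightarrow> u \<noteq> 0 \<Longrightarrow> G z u u > 0"
    and \<Gamma>_smooth: "\<And>u v. smooth_on S (\<lambda>z. \<Gamma> z u v)"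
    and \<Gamma>_linear: "\<And>z u. z \<in> S \<Longrightarrow> linear (\<Gamma> z u)"
    and \<Gamma>_sym: "\<And>z u v. z \<in> S \<Longrightarrow> \<Gamma> z u v = \<Gamma> z v u"
    and G_parallel: "\<And>z u v x. z \<in> S \<Longrightarrow>
      der (\<lambda>z. G z u v) z x = G z (\<Gamma> z x u) v + G z u (\<Gamma> z x v)"
begin

lemma G_linear_left: "z \<in> S \<Longrightarrow> linear (\<lambda>u. G z u v)"
  using G_linear[of z v] by (simp add: G_sym[of z _ v] eta_contract_eq)

lemma G_simps:
  assumes "z \<in> S"
  shows "G z u (v + w) = G z u v + G z u w" "G z (v + w) u = G z v u + G z w u"
    "G z u (v - w) = G z u v - G z u w" "G z (v - w) u = G z v u - G z w u"
    "G z u (r *\<^sub>R v) = r * G z u v" "G z (r *\<^sub>R v) u = r * G z v u"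
    "G z u (- v) = - G z u v" "G z (- v) u = - G z v u" "G z u 0 = 0" "G z 0 u = 0"
  using linear_add[OF G_linear[OF assms]] linear_add[OF G_linear_left[OF assms]]
    linear_diff[OF G_linear[OF assms]] linear_diff[OF G_linear_left[OF assms]]
    linear_scale[OF G_linear[OF assms]] linear_scale[OF G_linear_left[OF assms]]
    linear_neg[OF G_linear[OF assms]] linear_neg[OF G_linear_left[OF assms]]
    linear_0[OF G_linear[OF assms]] linear_0[OF G_linear_left[OF assms]]
  by auto

lemma \<Gamma>_linear_left: "z \<in> S \<Longrightarrow> linear (\<lambda>u. \<Gamma> z u v)"
  by (simp add: \<Gamma>_sym[of z _ v] \<Gamma>_linear eta_contract_eq)

lemma \<Gamma>_simps:
  assumes "z \<in> S"
  shows "\<Gamma> z u (v + w) = \<Gamma> z u v + \<Gamma> z u w" "\<Gamma> z (v + w) u = \<Gamma> z v u + \<Gamma> z w u"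
    "\<Gamma> z u (v - w) = \<Gamma> z u v - \<Gamma> z u w" "\<Gamma> z (v - w) u = \<Gamma> z v u - \<Gamma> z w u"
    "\<Gamma> z u (r *\<^sub>R v) = r *\<^sub>R \<Gamma> z u v" "\<Gamma> z (r *\<^sub>R v) u = r *\<^sub>R \<Gamma> z v u"
    "\<Gamma> z u (- v) = - \<Gamma> z u v" "\<Gamma> z (- v) u = - \<Gamma> z v u" "\<Gamma> z u 0 = 0" "\<Gamma> z 0 u = 0"
  using linear_add[OF \<Gamma>_linear[OF assms]] linear_add[OF \<Gamma>_linear_left[OF assms]]
    linear_diff[OF \<Gamma>_linear[OF assms]] linear_diff[OF \<Gamma>_linear_left[OF assms]]
    linear_scale[OF \<Gamma>_linear[OF assms]] linear_scale[OF \<Gamma>_linear_left[OF assms]]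
    linear_neg[OF \<Gamma>_linear[OF assms]] linear_neg[OF \<Gamma>_linear_left[OF assms]]
    linear_0[OF \<Gamma>_linear[OF assms]] linear_0[OF \<Gamma>_linear_left[OF assms]]
  by auto

lemma G_zero_iff: "z \<in> S \<Longrightarrow> G z u u = 0 \<longleftrightarrow> u = 0"
  using G_pos[of z u] G_simps(9)[of z u] by (cases "u = 0") auto

lemma smooth_on_G:
  assumes "open T" "T \<subseteq> S" "smooth_on T X" "smooth_on T Y"
  shows "smooth_on T (\<lambda>z. G z (X z) (Y z))"
  by (rule smooth_on_family2[OF assms(1) _ _ _ assms(3,4)])
    (use assms(2) in \<open>auto simp: subset_iff intro: G_linear_left G_linear smooth_on_subset[OF G_smooth]\<close>)

lemma smooth_on_\<Gamma>:
  assumes "open T" "T \<subseteq> S" "smooth_on T X" "smooth_on T Y"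
  shows "smooth_on T (\<lambda>z. \<Gamma> z (X z) (Y z))"
  by (rule smooth_on_family2[OF assms(1) _ _ _ assms(3,4)])
    (use assms(2) in \<open>auto simp: subset_iff intro: \<Gamma>_linear_left \<Gamma>_linear smooth_on_subset[OF \<Gamma>_smooth]\<close>)

section \<open>The covariant derivative in a chart\<close>

definition cov :: "'e \<Rightarrow> ('e \<Rightarrow> 'e) \<Rightarrow> 'e \<Rightarrow> 'e"
  where "cov v Y z = der Y z v + \<Gamma> z v (Y z)"

lemma cov_const: "cov v (\<lambda>z. w) z = \<Gamma> z v w"
  by (simp add: cov_def)

lemma cov_cong:
  assumes "open T" "z \<in> T" "\<And>y. y \<in> T \<Longrightarrow> X y = Y y"
  shows "cov v X z = cov v Y z"
  using der_cong_open[OF assms] assms(2,3) by (simp add: cov_def)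

lemma linear_cov:
  assumes "z \<in> S" "Y differentiable at z"
  shows "linear (\<lambda>v. cov v Y z)"
  unfolding cov_def
  by (intro linear_compose_add linear_frechet_derivative assms \<Gamma>_linear_left)

lemma cov_diff:
  assumes "z \<in> S" "X differentiable at z" "Y differentiable at z"
  shows "cov v (\<lambda>z. X z - Y z) z = cov v X z - cov v Y z"
  using der_eqI[OF has_derivative_diff[OF assms(2,3)[unfolded frechet_derivative_works]]] assms(1)
  by (simp add: cov_def \<Gamma>_simps)

lemma cov_scaleR:
  assumes "z \<in> S" "f differentiable at z" "Y differentiable at z"
  shows "cov v (\<lambda>z. f z *\<^sub>R Y z) z = der f z v *\<^sub>R Y z + f z *\<^sub>R cov v Y z"
  using der_eqI[OF has_derivative_scaleR[OF assms(2,3)[unfolded frechet_derivative_works]]] assms(1)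
  by (simp add: cov_def \<Gamma>_simps algebra_simps)

lemma smooth_on_cov:
  assumes T: "open T" "T \<subseteq> S" and "smooth_on T X" "smooth_on T Y"
  shows "smooth_on T (\<lambda>z. cov (X z) Y z)"
  unfolding cov_def
  by (rule smooth_on_add[OF T(1) smooth_on_family[OF T(1) linear_der[OF T(1) assms(4)]
          smooth_on_der[OF assms(4)] assms(3)] smooth_on_\<Gamma>[OF T assms(3,4)]])

lemma G_differentiable: "z \<in> S \<Longrightarrow> (\<lambda>z. G z u v) differentiable at z"
  by (rule smooth_on_imp_differentiable[OF open_S G_smooth])

lemma \<Gamma>_differentiable: "z \<in> S \<Longrightarrow> (\<lambda>z. \<Gamma> z u v) differentiable at z"
  by (rule smooth_on_imp_differentiable[OF open_S \<Gamma>_smooth])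

lemma has_derivative_G:
  assumes "z \<in> S" "X differentiable at z" "Y differentiable at z"
  shows "((\<lambda>z. G z (X z) (Y z)) has_derivative
    (\<lambda>v. G z (cov v X z) (Y z) + G z (X z) (cov v Y z))) (at z)"
  using has_derivative_family2[OF open_S G_linear_left G_linear assms(1) G_differentiable[OF assms(1)]
      assms(2,3)[unfolded frechet_derivative_works]] assms(1)
  by (simp add: cov_def G_simps G_parallel algebra_simps)

lemmas der_G = fun_cong[OF der_eqI[OF has_derivative_G]]

section \<open>The curvature tensor and its symmetries\<close>

definition d\<Gamma> :: "'e \<Rightarrow> 'e \<Rightarrow> 'e \<Rightarrow> 'e \<Rightarrow> 'e"
  where "d\<Gamma> z x u w = der (\<lambda>z. \<Gamma> z u w) z x"

lemma has_derivative_\<Gamma>: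
  assumes "z \<in> S" "(X has_derivative X') (at z)" "(Y has_derivative Y') (at z)"
  shows "((\<lambda>z. \<Gamma> z (X z) (Y z)) has_derivative
    (\<lambda>v. d\<Gamma> z v (X z) (Y z) + \<Gamma> z (X' v) (Y z) + \<Gamma> z (X z) (Y' v))) (at z)"
  using has_derivative_family2[OF open_S \<Gamma>_linear_left \<Gamma>_linear assms(1) \<Gamma>_differentiable[OF assms(1)]
      assms(2,3)] by (simp add: d\<Gamma>_def)

lemma d\<Gamma>_sym: "z \<in> S \<Longrightarrow> d\<Gamma> z x u w = d\<Gamma> z x w u"
  unfolding d\<Gamma>_def by (rule fun_cong[OF der_cong_open[OF open_S]]) (auto intro: \<Gamma>_sym)

lemma linear_d\<Gamma>_1: "z \<in> S \<Longrightarrow> linear (\<lambda>x. d\<Gamma> z x u w)"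
  unfolding d\<Gamma>_def by (rule linear_der[OF open_S \<Gamma>_smooth])

lemma linear_d\<Gamma>_3:
  assumes z: "z \<in> S"
  shows "linear (d\<Gamma> z x u)"
proof (rule linearI)
  note d = \<Gamma>_differentiable[OF z, unfolded frechet_derivative_works]
  have "der (\<lambda>z. \<Gamma> z u (v + w)) z = der (\<lambda>z. \<Gamma> z u v + \<Gamma> z u w) z" for v w
    by (rule der_cong_open[OF open_S z]) (simp add: \<Gamma>_simps)
  then show "d\<Gamma> z x u (v + w) = d\<Gamma> z x u v + d\<Gamma> z x u w" for v w
    unfolding d\<Gamma>_def der_eqI[OF has_derivative_add[OF d d]] by simp
  have "der (\<lambda>z. \<Gamma> z u (r *\<^sub>R w)) z = der (\<lambda>z. r *\<^sub>R \<Gamma> z u w) z" for r w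
    by (rule der_cong_open[OF open_S z]) (simp add: \<Gamma>_simps)
  then show "d\<Gamma> z x u (r *\<^sub>R w) = r *\<^sub>R d\<Gamma> z x u w" for r w
    unfolding d\<Gamma>_def der_eqI[OF has_derivative_scaleR_right[OF d]] by simp
qed

lemma linear_d\<Gamma>_2: "z \<in> S \<Longrightarrow> linear (\<lambda>u. d\<Gamma> z x u w)"
  using linear_d\<Gamma>_3[of z x w] by (simp add: d\<Gamma>_sym[of z x _ w])

text \<open>The Christoffel formula instead of a commutator of derivatives: no fields occur, so that
  R is tensorial by construction, and \<open>ricci\<close> links it to covariant
  derivatives.\<close>

definition R :: "'e \<Rightarrow> 'e \<Rightarrow> 'e \<Rightarrow> 'e \<Rightarrow> 'e"
  where "R z u v w = d\<Gamma> z u v w - d\<Gamma> z v u w + \<Gamma> z u (\<Gamma> z v w) - \<Gamma> z v (\<Gamma> z u w)"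

lemma linear_R_3: "z \<in> S \<Longrightarrow> linear (R z u v)"
  unfolding R_def
  by (intro linear_compose_add linear_compose_sub linear_d\<Gamma>_3
      linear_compose[OF \<Gamma>_linear \<Gamma>_linear, unfolded comp_def])

lemma linear_R_1: "z \<in> S \<Longrightarrow> linear (\<lambda>u. R z u v w)"
  unfolding R_def
  by (intro linear_compose_add linear_compose_sub linear_d\<Gamma>_1 linear_d\<Gamma>_2 \<Gamma>_linear_left
      linear_compose[OF \<Gamma>_linear_left \<Gamma>_linear, unfolded comp_def])

lemma R_antisym: "R z u v w = - R z v u w"
  by (simp add: R_def)

lemma linear_R_2: "z \<in> S \<Longrightarrow> linear (\<lambda>v. R z u v w)"
  by (subst R_antisym) (intro linear_compose_neg linear_R_1)

lemma R_simps:
  assumes "z \<in> S"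
  shows "R z u v (r *\<^sub>R w) = r *\<^sub>R R z u v w" "R z u (r *\<^sub>R v) w = r *\<^sub>R R z u v w"
    "R z (r *\<^sub>R u) v w = r *\<^sub>R R z u v w"
    "R z u v (w + w') = R z u v w + R z u v w'" "R z u (v + v') w = R z u v w + R z u v' w"
    "R z (u + u') v w = R z u v w + R z u' v w"
    "R z u v (- w) = - R z u v w" "R z u (- v) w = - R z u v w" "R z (- u) v w = - R z u v w"
  using linear_scale[OF linear_R_1[OF assms]] linear_scale[OF linear_R_2[OF assms]]
    linear_scale[OF linear_R_3[OF assms]] linear_add[OF linear_R_1[OF assms]]
    linear_add[OF linear_R_2[OF assms]] linear_add[OF linear_R_3[OF assms]]
    linear_neg[OF linear_R_1[OF assms]] linear_neg[OF linear_R_2[OF assms]]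
    linear_neg[OF linear_R_3[OF assms]]
  by auto

lemma R_smooth: "smooth_on S (\<lambda>z. R z u v w)"
  unfolding R_def d\<Gamma>_def
  by (intro smooth_on_add smooth_on_diff smooth_on_der smooth_on_\<Gamma> \<Gamma>_smooth open_S smooth_on_const order_refl)

lemma smooth_on_R:
  assumes "open T" "T \<subseteq> S" "smooth_on T X" "smooth_on T Y" "smooth_on T Z"
  shows "smooth_on T (\<lambda>z. R z (X z) (Y z) (Z z))"
  by (rule smooth_on_family3[OF assms(1) _ _ _ _ assms(3,4,5)])
    (use assms(2) in \<open>auto simp: subset_iff intro: linear_R_1 linear_R_2 linear_R_3 smooth_on_subset[OF R_smooth]\<close>)

lemma has_derivative_cov:
  assumes T: "open T" "T \<subseteq> S" "z \<in> T" and "smooth_on T Y" "smooth_on T Z"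
  shows "((\<lambda>z. cov (Y z) Z z) has_derivative
    (\<lambda>v. der (\<lambda>q. der Z q (Y z)) z v + der Z z (der Y z v)
      + (d\<Gamma> z v (Y z) (Z z) + \<Gamma> z (der Y z v) (Z z) + \<Gamma> z (Y z) (der Z z v)))) (at z)"
  unfolding cov_def
proof (rule has_derivative_add)
  show "((\<lambda>q. der Z q (Y q)) has_derivative (\<lambda>v. der (\<lambda>q. der Z q (Y z)) z v + der Z z (der Y z v))) (at z)"
    by (rule has_derivative_family[OF T(1) linear_der[OF T(1) assms(5)] T(3) 
          smooth_on_imp_differentiable[OF T(1) smooth_on_der[OF assms(5)] T(3)]
          smooth_on_imp_has_derivative[OF T(1) assms(4) T(3)]])
  show "((\<lambda>z. \<Gamma> z (Y z) (Z z)) has_derivative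
      (\<lambda>v. d\<Gamma> z v (Y z) (Z z) + \<Gamma> z (der Y z v) (Z z) + \<Gamma> z (Y z) (der Z z v))) (at z)"
    by (rule has_derivative_\<Gamma>) (use T assms smooth_on_imp_has_derivative in auto)
qed

text \<open>Second derivatives of Z cancel by symmetry, the terms with \<open>\<Gamma>\<close> and
  one derivative of Z are symmetric in X and Y, and the derivatives of X and Y are absorbed by the
  bracket term. An open subset T is allowed because fields on a manifold are smooth only near the
  point.\<close>

lemma ricci:
  assumes T: "open T" "T \<subseteq> S" "z \<in> T" and "smooth_on T X" "smooth_on T Y" "smooth_on T Z"
  shows "cov (X z) (\<lambda>q. cov (Y q) Z q) z - cov (Y z) (\<lambda>q. cov (X q) Z q) z
    - cov (der Y z (X z) - der X z (Y z)) Z z = R z (X z) (Y z) (Z z)"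
proof -
  have z: "z \<in> S" using T by auto
  have lin: "linear (der Z z)" by (rule linear_der[OF T(1) assms(6) T(3)])
  have 1: "cov v (\<lambda>q. cov (W q) Z q) z = der (\<lambda>q. der Z q (W z)) z v + der Z z (der W z v)
      + (d\<Gamma> z v (W z) (Z z) + \<Gamma> z (der W z v) (Z z) + \<Gamma> z (W z) (der Z z v))
      + \<Gamma> z v (der Z z (W z)) + \<Gamma> z v (\<Gamma> z (W z) (Z z))" if "smooth_on T W" for W v
    unfolding cov_def[of v] der_eqI[OF has_derivative_cov[OF T that assms(6)]]
    by (simp add: cov_def \<Gamma>_simps[OF z])
  have 2: "der (\<lambda>q. der Z q (Y z)) z (X z) = der (\<lambda>q. der Z q (X z)) z (Y z)"
    by (rule symmetric_der[OF T(1) assms(6) T(3)])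
  show ?thesis
    unfolding 1[OF assms(4)] 1[OF assms(5)] 2 R_def
    by (simp add: cov_def \<Gamma>_simps[OF z] linear_diff[OF lin])
qed

lemma ricci_const:
  assumes "z \<in> S" "smooth_on S Z"
  shows "cov u (cov v Z) z - cov v (cov u Z) z = R z u v (Z z)"
proof -
  have "cov 0 Z z = 0"
    using linear_0[OF linear_der[OF open_S assms(2,1)]] assms(1) by (simp add: cov_def \<Gamma>_simps)
  then show ?thesis
    using ricci[OF open_S order_refl assms(1) smooth_on_const[OF open_S, of u] smooth_on_const[OF open_S, of v] assms(2)]
    by simp
qed

lemma smooth_cov: "smooth_on S Z \<Longrightarrow> smooth_on S (cov v Z)"
  using smooth_on_cov[OF open_S order_refl smooth_on_const[OF open_S]] by simp

lemma smooth_differentiable: "smooth_on S Z \<Longrightarrow> z \<in> S \<Longrightarrow> Z differentiable at z"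
  by (rule smooth_on_imp_differentiable[OF open_S])

lemma R_bianchi1: "z \<in> S \<Longrightarrow> R z u v w + R z v w u + R z w u v = 0"
  unfolding R_def using d\<Gamma>_sym[of z u v w] d\<Gamma>_sym[of z v u w] d\<Gamma>_sym[of z w u v]
    \<Gamma>_sym[of z u v] \<Gamma>_sym[of z v w] \<Gamma>_sym[of z w u] by simp

text \<open>Antisymmetrize the second derivative of \<open>G z w w\<close> for constant w. The
  products of two first covariant derivatives are symmetric and drop out, and the commutator of
  second ones is the curvature.\<close>

lemma R_skew_diag:
  assumes z: "z \<in> S"
  shows "G z (R z u v w) w = 0"
proof -
  let ?W = "\<lambda>z::'e. w"
  have W: "smooth_on S ?W" using open_S by simp
  have c: "cov v ?W = (\<lambda>z. \<Gamma> z v w)" for v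
    by (simp add: cov_const fun_eq_iff)
  have 1: "der (\<lambda>z. G z w w) q v = 2 * G q (cov v ?W q) (?W q)" if "q \<in> S" for q v
    using that by (simp add: G_parallel cov_const G_sym[of q w])
  have 2: "der (\<lambda>q. der (\<lambda>z. G z w w) q v) z u
      = 2 * (G z (cov u (cov v ?W) z) w + G z (cov v ?W z) (cov u ?W z))" for u v
  proof -
    have "((\<lambda>q. 2 * G q (cov v ?W q) (?W q)) has_derivative
       (\<lambda>u. 2 * (G z (cov u (cov v ?W) z) (?W z) + G z (cov v ?W z) (cov u ?W z)))) (at z)"
      by (intro has_derivative_mult_right has_derivative_G z smooth_differentiable smooth_cov W)
    then show ?thesis
      using der_cong_open[OF open_S z, of "\<lambda>q. der (\<lambda>z. G z w w) q v" "\<lambda>q. 2 * G q (cov v ?W q) (?W q)"] 1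
      by (simp add: der_eqI)
  qed
  have "G z (cov u (cov v ?W) z) w + G z (cov v ?W z) (cov u ?W z)
      = G z (cov v (cov u ?W) z) w + G z (cov u ?W z) (cov v ?W z)"
    using symmetric_der[OF open_S G_smooth z, of w w v u] unfolding 2 by simp
  then have "G z (cov u (cov v ?W) z - cov v (cov u ?W) z) w = 0"
    using G_sym[OF z, of "cov v ?W z"] by (simp add: G_simps[OF z])
  then show ?thesis using ricci_const[OF z W, of u v] by simp
qed

text \<open>In this order of the arguments the sectional curvature of an orthonormal pair is
  \<open>K z u v v u\<close>.\<close>

definition K :: "'e \<Rightarrow> 'e \<Rightarrow> 'e \<Rightarrow> 'e \<Rightarrow> 'e \<Rightarrow> real"
  where "K z u v w t = G z (R z u v w) t"

lemma K_antisym12: "z \<in> S \<Longrightarrow> K z u v w t = - K z v u w t"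
  unfolding K_def by (subst R_antisym) (simp add: G_simps)

lemma K_antisym34: "z \<in> S \<Longrightarrow> K z u v w t = - K z u v t w"
  using R_skew_diag[of z u v "w + t"] R_skew_diag[of z u v w] R_skew_diag[of z u v t]
  by (simp add: K_def R_simps G_simps)

lemma K_bianchi1: "z \<in> S \<Longrightarrow> K z u v w t + K z v w u t + K z w u v t = 0"
  using arg_cong[OF R_bianchi1[of z u v w], of "\<lambda>x. G z x t"] by (simp add: K_def G_simps)

lemma linear_K_1: "z \<in> S \<Longrightarrow> linear (\<lambda>u. K z u v w t)"
  unfolding K_def by (rule linear_compose[OF linear_R_1 G_linear_left, unfolded comp_def])

section \<open>The second Bianchi identity\<close>

definition nabR :: "'e \<Rightarrow> 'e \<Rightarrow> 'e \<Rightarrow> 'e \<Rightarrow> 'e \<Rightarrow> 'e"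
  where "nabR z x u v w = cov x (\<lambda>z. R z u v w) z - R z (\<Gamma> z x u) v w - R z u (\<Gamma> z x v) w - R z u v (\<Gamma> z x w)"

text \<open>By the Ricci identity, the derivative of R(b, c) along a, applied to a constant field,
  is a double commutator of covariant derivatives. The cyclic sum is then the Jacobi identity, and
  the corrections in the first two slots cancel by the symmetry of \<open>\<Gamma>\<close>.\<close>

lemma bianchi2:
  assumes z: "z \<in> S"
  shows "nabR z u v x w + nabR z v x u w + nabR z x u v w = 0"
proof -
  let ?W = "\<lambda>z::'e. w"
  have W: "smooth_on S ?W" using open_S by simp
  have 1: "cov a (\<lambda>z. R z b c w) z - R z b c (\<Gamma> z a w)
    = cov a (cov b (cov c ?W)) z - cov a (cov c (cov b ?W)) z
      - (cov b (cov c (cov a ?W)) z - cov c (cov b (cov a ?W)) z)" for a b c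
  proof -
    have "cov a (\<lambda>z. R z b c w) z = cov a (\<lambda>z. cov b (cov c ?W) z - cov c (cov b ?W) z) z"
      by (rule cov_cong[OF open_S z]) (simp add: ricci_const W)
    also have "\<dots> = cov a (cov b (cov c ?W)) z - cov a (cov c (cov b ?W)) z"
      by (intro cov_diff z smooth_differentiable smooth_cov W)
    finally show ?thesis
      using ricci_const[OF z smooth_cov[OF W, of a], of b c] by (simp add: cov_const)
  qed
  have 2: "R z (\<Gamma> z u v) x w = - R z x (\<Gamma> z v u) w" "R z (\<Gamma> z v x) u w = - R z u (\<Gamma> z x v) w"
     "R z (\<Gamma> z x u) v w = - R z v (\<Gamma> z u x) w"
    by (subst R_antisym, simp add: \<Gamma>_sym z)+
  have 3: "(cov u (\<lambda>z. R z v x w) z - R z v x (\<Gamma> z u w)) + (cov v (\<lambda>z. R z x u w) z - R z x u (\<Gamma> z v w))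
      + (cov x (\<lambda>z. R z u v w) z - R z u v (\<Gamma> z x w)) = 0"
    unfolding 1 by simp
  show ?thesis
    unfolding nabR_def 2 using 3 by (simp add: algebra_simps)
qed

lemma cov_R:
  assumes T: "open T" "T \<subseteq> S" "z \<in> T" and "smooth_on T X" "smooth_on T Y" "smooth_on T Z"
  shows "cov v (\<lambda>z. R z (X z) (Y z) (Z z)) z = nabR z v (X z) (Y z) (Z z)
    + R z (cov v X z) (Y z) (Z z) + R z (X z) (cov v Y z) (Z z) + R z (X z) (Y z) (cov v Z z)"
proof -
  have z: "z \<in> S" using T by auto
  note d = smooth_on_imp_has_derivative[OF T(1) _ T(3)]
  have "((\<lambda>z. R z (X z) (Y z) (Z z)) has_derivative
    (\<lambda>v. der (\<lambda>q. R q (X z) (Y z) (Z z)) z v + R z (der X z v) (Y z) (Z z)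
      + R z (X z) (der Y z v) (Z z) + R z (X z) (Y z) (der Z z v))) (at z)"
    by (rule has_derivative_family3[OF open_S linear_R_1 linear_R_2 linear_R_3 z])
      (use smooth_differentiable[OF R_smooth z] d assms(4-6) in auto)
  from der_eqI[OF this] show ?thesis
    by (simp add: nabR_def cov_def R_simps[OF z] algebra_simps)
qed

end

text \<open>The classical octahedron argument: four instances of the cyclic identity, combined
  linearly with the two skew symmetries. Stated for a bare function because it is applied to
  curvature and to comparison tensors alike.\<close>

lemma pair_symmetry:
  fixes A :: "'a \<Rightarrow> 'a \<Rightarrow> 'a \<Rightarrow> 'a \<Rightarrow> real"
  assumes "\<And>x y z w. A x y z w = - A y x z w" "\<And>x y z w. A x y z w = - A x y w z"
    and "\<And>x y z w. A x y z w + A y z x w + A z x y w = 0"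
  shows "A x y z w = A z w x y"
  using assms(3)[of x y z w] assms(3)[of y z w x] assms(3)[of z w x y] assms(3)[of w x y z]
    assms(1)[of x y z w] assms(1)[of y z x w] assms(1)[of z x y w] assms(1)[of y z w x] assms(1)[of z w y x]
    assms(1)[of w y z x] assms(1)[of z w x y] assms(1)[of w x z y] assms(1)[of x z w y]
    assms(1)[of w x y z] assms(1)[of x y w z] assms(1)[of y w x z]
    assms(2)[of x y z w] assms(2)[of y z x w] assms(2)[of z x y w] assms(2)[of y z w x] assms(2)[of z w y x]
    assms(2)[of w y z x] assms(2)[of z w x y] assms(2)[of w x z y] assms(2)[of x z w y]
    assms(2)[of w x y z] assms(2)[of x y w z] assms(2)[of y w x z]
  by linarith

section \<open>Kaehler metrics in coordinates\<close>

text \<open>A Kaehler curvature tensor is determined by its holomorphic sectional curvatures. The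
  conclusion is confined to a J-invariant subspace V because \<open>a\<close> controls D only.
  Polarization first kills the sectional curvatures and then all components.\<close>

lemma kaehler_curvature_like_zero:
  fixes A :: "'a::real_vector \<Rightarrow> 'a \<Rightarrow> 'a \<Rightarrow> 'a \<Rightarrow> real"
  assumes lin: "\<And>y z w. linear (\<lambda>x. A x y z w)"
    and a12: "\<And>x y z w. A x y z w = - A y x z w" and a34: "\<And>x y z w. A x y z w = - A x y w z"
    and bianchi: "\<And>x y z w. A x y z w + A y z x w + A z x y w = 0"
    and J: "linear J" "\<And>x. J (J x) = - x" and AJ: "\<And>x y z w. A x y (J z) (J w) = A x y z w"
    and V: "subspace V" "\<And>x. x \<in> V \<Longrightarrow> J x \<in> V"
    and hol: "\<And>x. x \<in> V \<Longrightarrow> A x (J x) (J x) x = 0"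
    and mem: "x \<in> V" "y \<in> V" "z \<in> V" "w \<in> V"
  shows "A x y z w = 0"
proof -
  have pair: "A x y z w = A z w x y" for x y z w
    by (rule pair_symmetry) (rule a12, rule a34, rule bianchi)
  have add1: "A (x + x') y z w = A x y z w + A x' y z w" for x x' y z w
    by (rule linear_add[OF lin])
  have neg1: "A (- x) y z w = - A x y z w" for x y z w
    by (rule linear_neg[OF lin])
  have add2: "A x (y + y') z w = A x y z w + A x y' z w" for x y y' z w
    using add1[of y y' x z w] a12[of x "y + y'" z w] a12[of x y z w] a12[of x y' z w] by simp
  have neg2: "A x (- y) z w = - A x y z w" for x y z w
    using neg1[of y x z w] a12[of x "- y" z w] a12[of x y z w] by simp
  have add3: "A x y (z + z') w = A x y z w + A x y z' w" for x y z z' w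
    using add1[of z z' w x y] pair[of x y _ w] by simp
  have neg3: "A x y (- z) w = - A x y z w" for x y z w
    using neg1[of z w x y] pair[of x y _ w] by simp
  have add4: "A x y z (w + w') = A x y z w + A x y z w'" for x y z w w'
    using add3[of x y w w' z] a34[of x y z "w + w'"] a34[of x y z w] a34[of x y z w'] by simp
  have neg4: "A x y z (- w) = - A x y z w" for x y z w
    using neg3[of x y w z] a34[of x y z "- w"] a34[of x y z w] by simp
  note lins = add1 add2 add3 add4 neg1 neg2 neg3 neg4
  have JA: "A (J x) (J y) z w = A x y z w" for x y z w
    using AJ[of z w x y] pair by metis
  have flip: "A y (J x) (J y) x = A y (J x) (J x) y" for x y
    using AJ[of y "J x" "J y" x] a34[of y "J x" y "J x"] by (simp add: J lins)
  have swap: "A y (J x) (J x) y = A x (J y) (J y) x" for x y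
    using JA[of y "J x" "J x" y] AJ[of "J y" x "J x" y] a12[of "J y" x x "J y"] a34[of x "J y" x "J y"]
    by (simp add: J lins)
  \<comment> \<open>Adding the hypothesis at x + y and at x - y cancels the terms odd in y and
    leaves the six terms of \<open>q\<close>. The symmetries under J and the Bianchi identity reduce
    them to two quantities.\<close>
  have rel: "A x y y x + 3 * A x (J y) (J y) x = 0" if "x \<in> V" "y \<in> V" for x y
  proof -
    have "x + y \<in> V" "x + - y \<in> V"
      using that V(1) subspace_add subspace_neg by blast+
    note h = hol[OF this(1)] hol[OF this(2)] hol[OF that(1)] hol[OF that(2)]
    have q: "A y (J y) (J x) x + A y (J x) (J y) x + A y (J x) (J x) y + A x (J y) (J y) x
        + A x (J y) (J x) y + A x (J x) (J y) y = 0"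
      using h by (simp add: lins linear_add[OF J(1)] linear_neg[OF J(1)] del: add_uminus_conv_diff)
    have e1: "A y (J y) (J x) x = A x (J x) (J y) y"
      using pair[of y "J y" "J x" x] a12[of "J x" x y "J y"] a34[of x "J x" y "J y"] by simp
    have e4: "A x (J y) (J x) y = A x (J y) (J y) x" by (rule flip)
    have "A x (J x) (J y) y = A x y y x + A x (J y) (J y) x"
      using bianchi[of x "J x" "J y" y] JA[of x y x y] a34[of x y x y] a12[of "J y" x "J x" y] e4 by simp
    then show ?thesis
      using q e1 e4 flip[of y x] swap[of y x] by simp
  qed
  \<comment> \<open>Replacing y by Jy exchanges the two quantities in \<open>rel\<close>; the
    resulting linear system has determinant 1 - 9.\<close>
  have sec: "A x y y x = 0" if "x \<in> V" "y \<in> V" for x y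
    using rel[OF that] rel[OF that(1) V(2)[OF that(2)]] by (simp add: J lins)
  have sec': "A x y z x = 0" if "x \<in> V" "y \<in> V" "z \<in> V" for x y z
  proof -
    have "y + z \<in> V" using that V(1) subspace_add by blast
    then have "A x y z x + A x z y x = 0"
      using sec[OF that(1) \<open>y + z \<in> V\<close>] sec[OF that(1,2)] sec[OF that(1,3)] by (simp add: lins)
    moreover have "A x z y x = A x y z x"
      using pair[of x z y x] a12[of y x x z] a34[of x y x z] by simp
    ultimately show ?thesis by simp
  qed
  have alt: "A x y z w = - A w y z x" if "x \<in> V" "y \<in> V" "z \<in> V" "w \<in> V" for x y z w
  proof -
    have "x + w \<in> V" using that V(1) subspace_add by blast
    then show ?thesis
      using sec'[OF \<open>x + w \<in> V\<close> that(2,3)] sec'[OF that(1,2,3)] sec'[OF that(4,2,3)] by (simp add: lins)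
  qed
  \<comment> \<open>With the extra skew symmetry \<open>alt\<close>, cyclic permutations of the
    first three arguments change nothing, and the Bianchi sum is three times A.\<close>
  have cyc: "A y z x w = A x y z w" if "x \<in> V" "y \<in> V" "z \<in> V" "w \<in> V" for x y z w
    using alt[OF that(2,3,1,4)] pair[of w z x y] a34[of x y w z] by simp
  show ?thesis
    using bianchi[of x y z w] cyc[OF mem] cyc[OF mem(2,3,1,4)] by simp
qed

locale kaehler_patch = riem_patch S G \<Gamma>
  for S :: "'e::euclidean_space set" and G and \<Gamma> +
  fixes J :: "'e \<Rightarrow> 'e \<Rightarrow> 'e"
  assumes J_smooth: "\<And>u. smooth_on S (\<lambda>z. J z u)"
    and J_linear: "\<And>z. z \<in> S \<Longrightarrow> linear (J z)"
    and J_J: "\<And>z u. z \<in> S \<Longrightarrow> J z (J z u) = - u"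
    and G_J_J: "\<And>z u v. z \<in> S \<Longrightarrow> G z (J z u) (J z v) = G z u v"
    and J_parallel: "\<And>z w x. z \<in> S \<Longrightarrow> der (\<lambda>z. J z w) z x + \<Gamma> z x (J z w) = J z (\<Gamma> z x w)"
begin

lemma J_simps:
  assumes "z \<in> S"
  shows "J z (u + v) = J z u + J z v" "J z (u - v) = J z u - J z v" "J z (r *\<^sub>R u) = r *\<^sub>R J z u"
    "J z (- u) = - J z u" "J z 0 = 0"
  using linear_add[OF J_linear[OF assms]] linear_diff[OF J_linear[OF assms]]
    linear_scale[OF J_linear[OF assms]] linear_neg[OF J_linear[OF assms]] linear_0[OF J_linear[OF assms]]
  by auto

lemma G_J_left: "z \<in> S \<Longrightarrow> G z (J z u) v = - G z u (J z v)"
  using G_J_J[of z u "J z v"] by (simp add: J_J G_simps)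

lemma G_J_self: "z \<in> S \<Longrightarrow> G z u (J z u) = 0"
  using G_J_left[of z u u] G_sym[of z u "J z u"] by simp

lemma G_J_skew: "z \<in> S \<Longrightarrow> G z u (J z v) = - G z v (J z u)"
  using G_J_left[of z u v] G_sym[of z "J z u" v] by simp

lemma smooth_on_J: "open T \<Longrightarrow> T \<subseteq> S \<Longrightarrow> smooth_on T X \<Longrightarrow> smooth_on T (\<lambda>z. J z (X z))"
  by (rule smooth_on_family[OF _ J_linear smooth_on_subset[OF J_smooth]]) auto

lemma cov_J:
  assumes z: "z \<in> S" and Y: "Y differentiable at z"
  shows "cov v (\<lambda>z. J z (Y z)) z = J z (cov v Y z)"
  using has_derivative_family[OF open_S J_linear z smooth_differentiable[OF J_smooth z]
      Y[unfolded frechet_derivative_works]] J_parallel[OF z, of "Y z" v]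
  by (simp add: der_eqI cov_def J_simps[OF z] algebra_simps)

lemma R_J:
  assumes z: "z \<in> S"
  shows "R z u v (J z w) = J z (R z u v w)"
proof -
  let ?W = "\<lambda>z::'e. w"
  have W: "smooth_on S ?W" using open_S by simp
  have 1: "cov v (\<lambda>z. J z (?W z)) q = J q (cov v ?W q)" if "q \<in> S" for q v
    by (rule cov_J[OF that]) simp
  have 2: "cov u (cov v (\<lambda>z. J z w)) z = J z (cov u (cov v ?W) z)" for u v
    using cov_cong[OF open_S z, of "cov v (\<lambda>z. J z w)" "\<lambda>q. J q (cov v ?W q)"] 1
      cov_J[OF z smooth_differentiable[OF smooth_cov[OF W] z]] by simp
  show ?thesis
    using ricci_const[OF z J_smooth, of u v w] ricci_const[OF z W, of u v]
    by (simp add: 2 J_simps[OF z, symmetric])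
qed

lemma K_J: "z \<in> S \<Longrightarrow> K z u v (J z w) (J z t) = K z u v w t"
  by (simp add: K_def R_J G_J_J)

lemma K_pair: "z \<in> S \<Longrightarrow> K z u v w t = K z w t u v"
  by (rule pair_symmetry) (erule K_antisym12 K_antisym34 K_bianchi1)+

lemma K_J_left: "z \<in> S \<Longrightarrow> K z (J z u) (J z v) w t = K z u v w t"
  using K_pair[of z "J z u" "J z v" w t] K_pair[of z u v w t] by (simp add: K_J)

section \<open>The model tensor of constant holomorphic curvature\<close>

text \<open>The curvature tensor of a complex space form of holomorphic sectional curvature 1; the
  factor 1/4 is the normalization behind \<open>Pi_holomorphic\<close>.\<close>

definition Pi :: "'e \<Rightarrow> 'e \<Rightarrow> 'e \<Rightarrow> 'e \<Rightarrow> 'e \<Rightarrow> real"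
  where "Pi z u v w t = 1 / 4 * (G z v w * G z u t - G z u w * G z v t + G z (J z v) w * G z (J z u) t
    - G z (J z u) w * G z (J z v) t + 2 * G z u (J z v) * G z (J z w) t)"

lemma linear_Pi_1: "z \<in> S \<Longrightarrow> linear (\<lambda>u. Pi z u v w t)"
  by (rule linearI) (simp_all add: Pi_def G_simps J_simps algebra_simps add_divide_distrib diff_divide_distrib)

lemma Pi_antisym12: "z \<in> S \<Longrightarrow> Pi z u v w t = - Pi z v u w t"
  using G_J_skew[of z u v] by (simp add: Pi_def field_simps)

lemma Pi_antisym34: "z \<in> S \<Longrightarrow> Pi z u v w t = - Pi z u v t w"
  using G_J_skew[of z w t] by (simp add: Pi_def G_J_left field_simps)

lemma Pi_bianchi: "z \<in> S \<Longrightarrow> Pi z u v w t + Pi z v w u t + Pi z w u v t = 0"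
  using G_J_skew[of z u v] G_J_skew[of z v w] G_J_skew[of z w u] G_sym[of z u v] G_sym[of z v w] G_sym[of z w u]
  by (simp add: Pi_def G_J_left field_simps)

lemma Pi_J: "z \<in> S \<Longrightarrow> Pi z u v (J z w) (J z t) = Pi z u v w t"
  by (simp add: Pi_def G_J_left J_J G_simps field_simps)

lemma Pi_holomorphic: "z \<in> S \<Longrightarrow> Pi z u (J z u) (J z u) u = (G z u u)\<^sup>2"
  using G_sym[of z u "J z u"] by (simp add: Pi_def G_J_self G_J_J J_J G_simps power2_eq_square)

lemma Pi_pair: "z \<in> S \<Longrightarrow> Pi z u v w t = Pi z w t u v"
  by (rule pair_symmetry) (erule Pi_antisym12 Pi_antisym34 Pi_bianchi)+

text \<open>\<open>Pi\<close> is built from the parallel tensors G and J and is therefore parallel: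
  the derivative falls on the arguments only.\<close>

lemma has_derivative_Pi:
  assumes z: "z \<in> S" and d: "X differentiable at z" "Y differentiable at z" "Z differentiable at z" "W differentiable at z"
  shows "((\<lambda>z. Pi z (X z) (Y z) (Z z) (W z)) has_derivative
    (\<lambda>v. Pi z (cov v X z) (Y z) (Z z) (W z) + Pi z (X z) (cov v Y z) (Z z) (W z)
      + Pi z (X z) (Y z) (cov v Z z) (W z) + Pi z (X z) (Y z) (Z z) (cov v W z))) (at z)"
proof -
  have dJ: "(\<lambda>z. J z (F z)) differentiable at z" if "F differentiable at z" for F
    using has_derivative_family[OF open_S J_linear z smooth_differentiable[OF J_smooth z]
      that[unfolded frechet_derivative_works]] by (rule differentiableI)
  note g = has_derivative_G[OF z]
  show ?thesis
    unfolding Pi_def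
    by (rule has_derivative_eq_rhs, (rule g d dJ has_derivative_add has_derivative_diff
        has_derivative_mult_right has_derivative_mult)+)
      (simp add: fun_eq_iff cov_J[OF z] d field_simps)
qed

end

context riem_patch
begin

text \<open>\<open>A b\<close> represents pairing with b in the Euclidean inner product, so that
  orthogonality for G becomes Euclidean orthogonality to a proper subspace.\<close>

lemma exists_orthogonal:
  assumes z: "z \<in> S" and B: "finite B" "card B < DIM('e)"
  obtains u where "u \<noteq> 0" "\<And>b. b \<in> B \<Longrightarrow> G z u b = 0"
proof -
  define A where "A b = (\<Sum>i\<in>Basis. G z i b *\<^sub>R i)" for b
  have A: "G z u b = A b \<bullet> u" for u b
  proof -
    have "G z u b = (\<Sum>i\<in>Basis. (u \<bullet> i) * G z i b)"
      using linear_expand_Basis[OF G_linear_left[OF z], of u b] by simp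
    then show ?thesis
      by (simp add: A_def inner_sum_left inner_sum_right inner_commute mult.commute)
  qed
  have "dim (A ` B) < DIM('e)"
    using dim_le_card'[of "A ` B"] card_image_le[OF B(1), of A] B by simp
  then obtain u where u: "u \<noteq> 0" "\<And>y. y \<in> span (A ` B) \<Longrightarrow> orthogonal u y"
    using orthogonal_to_subspace_exists by blast
  show ?thesis
  proof (rule that[OF u(1)])
    fix b assume "b \<in> B"
    then have "orthogonal u (A b)" by (intro u(2) span_base) simp
    then show "G z u b = 0" by (simp add: A orthogonal_def inner_commute[of u])
  qed
qed

end

section \<open>A \<open>B0\<close>-distribution in coordinates\<close>

text \<open>The distribution enters through its two defining equations. No smoothness of
  \<open>k\<close> and \<open>a\<close> is assumed, since it follows from the equations. The
  curvature condition is written homogeneously in u and includes u = 0.\<close>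

locale B0_patch = kaehler_patch S G \<Gamma> J
  for S :: "'e::euclidean_space set" and G \<Gamma> J +
  fixes \<xi> :: "'e \<Rightarrow> 'e" and k ps a :: "'e \<Rightarrow> real"
  assumes dim_ge: "6 \<le> DIM('e)"
    and \<xi>_smooth: "smooth_on S \<xi>"
    and \<xi>_unit: "\<And>z. z \<in> S \<Longrightarrow> G z (\<xi> z) (\<xi> z) = 1"
    and k_nz: "\<And>z. z \<in> S \<Longrightarrow> k z \<noteq> 0"
    and cov_\<xi>_D: "\<And>z u. z \<in> S \<Longrightarrow> G z u (\<xi> z) = 0 \<Longrightarrow> G z u (J z (\<xi> z)) = 0 \<Longrightarrow> cov u \<xi> z = (k z / 2) *\<^sub>R u"
    and cov_\<xi>_J\<xi>: "\<And>z. z \<in> S \<Longrightarrow> cov (J z (\<xi> z)) \<xi> z = - (ps z *\<^sub>R J z (\<xi> z))"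
    and cov_\<xi>_\<xi>: "\<And>z. z \<in> S \<Longrightarrow> cov (\<xi> z) \<xi> z = 0"
    and K_D: "\<And>z u. z \<in> S \<Longrightarrow> G z u (\<xi> z) = 0 \<Longrightarrow> G z u (J z (\<xi> z)) = 0 \<Longrightarrow>
      K z u (J z u) (J z u) u = a z * (G z u u)\<^sup>2"
begin

definition D :: "'e \<Rightarrow> 'e set"
  where "D z = {u. G z u (\<xi> z) = 0 \<and> G z u (J z (\<xi> z)) = 0}"

text \<open>The orthogonal projection onto D. For a fixed u in \<open>D z\<close> the field
  \<open>\<lambda>q. pr q u\<close> is smooth, takes values in D and equals u at z; it is the
  standard extension below.\<close>

definition pr :: "'e \<Rightarrow> 'e \<Rightarrow> 'e"
  where "pr z u = u - G z u (\<xi> z) *\<^sub>R \<xi> z - G z u (J z (\<xi> z)) *\<^sub>R J z (\<xi> z)"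

lemma \<xi>_J\<xi>:
  assumes "z \<in> S"
  shows "G z (\<xi> z) (J z (\<xi> z)) = 0" "G z (J z (\<xi> z)) (\<xi> z) = 0" "G z (J z (\<xi> z)) (J z (\<xi> z)) = 1"
  using G_J_self[OF assms, of "\<xi> z"] G_sym[OF assms, of "\<xi> z" "J z (\<xi> z)"] G_J_J[OF assms] \<xi>_unit[OF assms]
  by auto

lemma pr_D: "z \<in> S \<Longrightarrow> pr z u \<in> D z"
  by (simp add: D_def pr_def G_simps \<xi>_J\<xi> \<xi>_unit)

lemma pr_id: "u \<in> D z \<Longrightarrow> pr z u = u"
  by (simp add: D_def pr_def)

lemma pr_decomp: "u = pr z u + G z u (\<xi> z) *\<^sub>R \<xi> z + G z u (J z (\<xi> z)) *\<^sub>R J z (\<xi> z)"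
  by (simp add: pr_def)

lemma subspace_D: "z \<in> S \<Longrightarrow> subspace (D z)"
  by (rule subspaceI) (auto simp: D_def G_simps)

lemma J_D: "z \<in> S \<Longrightarrow> u \<in> D z \<Longrightarrow> J z u \<in> D z"
  by (simp add: D_def G_J_left J_J G_simps)

lemma D_orth:
  assumes "z \<in> S" "u \<in> D z"
  shows "G z u (\<xi> z) = 0" "G z u (J z (\<xi> z)) = 0" "G z (\<xi> z) u = 0" "G z (J z (\<xi> z)) u = 0"
  using assms G_sym[OF assms(1)] by (auto simp: D_def)

lemma smooth_J\<xi>: "smooth_on S (\<lambda>z. J z (\<xi> z))"
  by (rule smooth_on_J[OF open_S order_refl \<xi>_smooth])

lemma smooth_pr: "smooth_on S (\<lambda>z. pr z u)"
  unfolding pr_def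
  by (intro smooth_on_diff smooth_on_scaleR smooth_on_G open_S order_refl smooth_on_const \<xi>_smooth smooth_J\<xi>)

lemma \<xi>_differentiable: "z \<in> S \<Longrightarrow> \<xi> differentiable at z"
  by (rule smooth_differentiable[OF \<xi>_smooth])

lemma cov_\<xi>: "z \<in> S \<Longrightarrow> u \<in> D z \<Longrightarrow> cov u \<xi> z = (k z / 2) *\<^sub>R u"
  using cov_\<xi>_D by (simp add: D_def)

text \<open>Needed for vectors u outside D, such as brackets of fields in D: the rest of the
  derivative of \<xi> lies along J\<xi> and disappears against w.\<close>

lemma G_cov_\<xi>:
  assumes z: "z \<in> S" and w: "w \<in> D z"
  shows "G z (cov u \<xi> z) w = k z / 2 * G z u w"
proof -
  note lin = linear_cov[OF z \<xi>_differentiable[OF z]]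
  have "cov u \<xi> z = (k z / 2) *\<^sub>R pr z u - (G z u (J z (\<xi> z)) * ps z) *\<^sub>R J z (\<xi> z)"
    by (subst pr_decomp[of u z])
      (simp add: linear_add[OF lin] linear_scale[OF lin] cov_\<xi>[OF z pr_D[OF z]] cov_\<xi>_J\<xi>[OF z] cov_\<xi>_\<xi>[OF z])
  moreover have "G z (pr z u) w = G z u w"
    using D_orth[OF z w] by (simp add: pr_def G_simps[OF z])
  ultimately show ?thesis
    using D_orth[OF z w] by (simp add: G_simps[OF z])
qed

text \<open>Here the dimension bound enters: four linear conditions leave a nonzero
  solution.\<close>

lemma obtain_D:
  assumes z: "z \<in> S"
  obtains y where "y \<noteq> 0" "y \<in> D z" "G z y u = 0" "G z y (J z u) = 0"
proof -
  have c: "card {\<xi> z, J z (\<xi> z), u, J z u} \<le> 4"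
    by (simp add: card_insert_if)
  have "card {\<xi> z, J z (\<xi> z), u, J z u} < DIM('e)"
    using c dim_ge by linarith
  then obtain y where "y \<noteq> 0" "\<And>b. b \<in> {\<xi> z, J z (\<xi> z), u, J z u} \<Longrightarrow> G z y b = 0"
    using exists_orthogonal[OF z, of "{\<xi> z, J z (\<xi> z), u, J z u}"] by auto
  then show ?thesis
    using that[of y] by (simp add: D_def)
qed

text \<open>Yields the smoothness of k and a, which are known only through equations h = F d. The
  denominator is nonzero at the chosen z, hence near z by continuity.\<close>

lemma smooth_local_quotient:
  assumes "\<And>z. z \<in> S \<Longrightarrow> \<exists>h d. smooth_on S h \<and> smooth_on S d \<and> d z \<noteq> 0 \<and> (\<forall>q\<in>S. h q = F q * d q)"
  shows "smooth_on S (F::'e \<Rightarrow> real)"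
proof (rule smooth_on_local[OF open_S])
  fix z assume z: "z \<in> S"
  obtain h d where hd: "smooth_on S h" "smooth_on S d" "d z \<noteq> 0" "\<And>q. q \<in> S \<Longrightarrow> h q = F q * d q"
    using assms[OF z] by blast
  define T where "T = S \<inter> d -` (- {0})"
  have T: "open T" unfolding T_def
    by (rule continuous_open_preimage[OF smooth_on_imp_continuous_on[OF hd(2)] open_S]) auto
  have "smooth_on T (\<lambda>q. h q / d q)"
    by (rule smooth_on_divide[OF T smooth_on_subset[OF hd(1)] smooth_on_subset[OF hd(2)]]) (auto simp: T_def)
  then have "smooth_on T F"
    by (rule smooth_on_cong[OF T]) (auto simp: T_def hd(4))
  then show "\<exists>T. open T \<and> z \<in> T \<and> smooth_on T F"
    using T z hd(3) by (intro exI[of _ T]) (auto simp: T_def)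
qed

section \<open>Constancy of k along the hyperplanes orthogonal to \<xi>\<close>

lemma k_smooth: "smooth_on S k"
proof (rule smooth_local_quotient)
  fix z assume z: "z \<in> S"
  obtain y where y: "y \<noteq> 0" "y \<in> D z"
    using obtain_D[OF z] by metis
  note sm = smooth_on_G[OF open_S order_refl _ smooth_pr[of y]]
  show "\<exists>h d. smooth_on S h \<and> smooth_on S d \<and> d z \<noteq> 0 \<and> (\<forall>q\<in>S. h q = k q * d q)"
  proof (intro exI conjI ballI)
    show "smooth_on S (\<lambda>q. 2 * G q (cov (pr q y) \<xi> q) (pr q y))"
      by (intro smooth_on_mult smooth_on_const open_S sm smooth_on_cov order_refl smooth_pr \<xi>_smooth)
    show "smooth_on S (\<lambda>q. G q (pr q y) (pr q y))"
      by (intro sm smooth_pr)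
    show "G z (pr z y) (pr z y) \<noteq> 0"
      using y z by (simp add: pr_id G_zero_iff)
    show "2 * G q (cov (pr q y) \<xi> q) (pr q y) = k q * G q (pr q y) (pr q y)" if "q \<in> S" for q
      using cov_\<xi>[OF that pr_D[OF that]] by (simp add: G_simps[OF that])
  qed
qed

text \<open>Along fields X, Y in D the derivative of \<xi> is k/2 times the field. The terms with
  derivatives of X and Y cancel against the bracket term, but only after pairing with w in D,
  because the bracket may leave D.\<close>

lemma R_\<xi>:
  assumes z: "z \<in> S" and D: "x \<in> D z" "y \<in> D z" "w \<in> D z"
  shows "G z (R z x y (\<xi> z)) w = (der k z x * G z y w - der k z y * G z x w) / 2"
proof -
  define X Y where "X = (\<lambda>q. pr q x)" and "Y = (\<lambda>q. pr q y)"
  have XY: "X z = x" "Y z = y" using D by (simp_all add: X_def Y_def pr_id)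
  have sm: "smooth_on S X" "smooth_on S Y" by (auto simp: X_def Y_def smooth_pr)
  have inD: "X q \<in> D q" "Y q \<in> D q" if "q \<in> S" for q
    using that by (simp_all add: X_def Y_def pr_D)
  have k2: "(\<lambda>q. k q / 2) differentiable at z" "der (\<lambda>q. k q / 2) z v = der k z v / 2" for v
  proof -
    have "((\<lambda>q. k q / 2) has_derivative (\<lambda>v. der k z v / 2)) (at z)"
      using has_derivative_mult_right[OF smooth_on_imp_has_derivative[OF open_S k_smooth z], of "1/2"] by simp
    then show "(\<lambda>q. k q / 2) differentiable at z" "der (\<lambda>q. k q / 2) z v = der k z v / 2"
      by (auto intro: differentiableI simp: der_eqI)
  qed
  have c: "cov v (\<lambda>q. cov (W q) \<xi> q) z = (der k z v / 2) *\<^sub>R W z + (k z / 2) *\<^sub>R cov v W z"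
    if W: "smooth_on S W" "\<And>q. q \<in> S \<Longrightarrow> W q \<in> D q" for W v
  proof -
    have "cov v (\<lambda>q. cov (W q) \<xi> q) z = cov v (\<lambda>q. (k q / 2) *\<^sub>R W q) z"
      by (rule cov_cong[OF open_S z]) (simp add: cov_\<xi> W)
    also have "\<dots> = (der k z v / 2) *\<^sub>R W z + (k z / 2) *\<^sub>R cov v W z"
      by (simp add: cov_scaleR[OF z k2(1) smooth_differentiable[OF W(1) z]] k2(2))
    finally show ?thesis .
  qed
  have cX: "cov v (\<lambda>q. cov (X q) \<xi> q) z = (der k z v / 2) *\<^sub>R x + (k z / 2) *\<^sub>R cov v X z"
    and cY: "cov v (\<lambda>q. cov (Y q) \<xi> q) z = (der k z v / 2) *\<^sub>R y + (k z / 2) *\<^sub>R cov v Y z" for v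
    using c[OF sm(1) inD(1), of v] c[OF sm(2) inD(2), of v] unfolding XY by blast+
  have B: "der Y z x - der X z y = cov x Y z - cov y X z"
    by (simp add: cov_def XY \<Gamma>_sym[OF z])
  have eq: "R z x y (\<xi> z) = (der k z x / 2) *\<^sub>R y + (k z / 2) *\<^sub>R cov x Y z
      - ((der k z y / 2) *\<^sub>R x + (k z / 2) *\<^sub>R cov y X z) - cov (cov x Y z - cov y X z) \<xi> z"
    using ricci[OF open_S order_refl z sm \<xi>_smooth]
    unfolding XY B cX cY by simp
  show ?thesis
    unfolding eq by (simp add: G_simps[OF z] G_cov_\<xi>[OF z D(3)] algebra_simps diff_divide_distrib)
qed

text \<open>For y orthogonal to x and Jx, \<open>R_\<xi>\<close> gives dk(x)|y|^2/2 for the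
  arguments x, y and 0 for Jx, Jy, whereas J-invariance makes both values equal.\<close>

lemma der_k_D:
  assumes z: "z \<in> S" and x: "x \<in> D z"
  shows "der k z x = 0"
proof -
  obtain y where y: "y \<noteq> 0" "y \<in> D z" "G z y x = 0" "G z y (J z x) = 0"
    using obtain_D[OF z] by metis
  have o: "G z x y = 0" "G z (J z x) y = 0" "G z (J z y) y = 0"
    using y G_sym[OF z] G_J_self[OF z, of y] by metis+
  have "K z (J z x) (J z y) (\<xi> z) y = 0"
    unfolding K_def by (subst R_\<xi>[OF z J_D[OF z x] J_D[OF z y(2)] y(2)]) (simp add: o)
  then have "der k z x * G z y y = 0"
    using R_\<xi>[OF z x y(2) y(2)] o by (simp add: K_J_left[OF z]) (simp add: K_def)
  then show ?thesis using y(1) G_zero_iff[OF z] by simp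
qed

text \<open>\<open>D\<close> is bracket generating inside \<open>\<xi>\<^sup>\<bottom>\<close>: the bracket of \<open>Y\<close> and \<open>JY\<close> has the component
  \<open>-k|Y|\<^sup>2\<close> along \<open>J\<xi>\<close> and none along \<open>\<xi>\<close>.\<close>

lemma der_perp_zero:
  fixes F :: "'e \<Rightarrow> real"
  assumes F: "smooth_on S F" "\<And>z x. z \<in> S \<Longrightarrow> x \<in> D z \<Longrightarrow> der F z x = 0"
    and z: "z \<in> S" and v: "G z v (\<xi> z) = 0"
  shows "der F z v = 0"
proof -
  obtain y where y: "y \<noteq> 0" "y \<in> D z"
    using obtain_D[OF z] by metis
  define Y Z where "Y = (\<lambda>q. pr q y)" and "Z = (\<lambda>q. J q (pr q y))"
  have smY: "smooth_on S Y" by (simp add: Y_def smooth_pr)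
  have smZ: "smooth_on S Z" unfolding Z_def by (rule smooth_on_J[OF open_S order_refl smooth_pr])
  have YZ: "Y z = y" "Z z = J z y" using y by (simp_all add: Y_def Z_def pr_id)
  have inD: "Y q \<in> D q" "Z q \<in> D q" if "q \<in> S" for q
    using that by (simp_all add: Y_def Z_def pr_D J_D)
  have dY: "Y differentiable at z" and dZ: "Z differentiable at z"
    using smY smZ z smooth_differentiable by blast+
  note dxi = \<xi>_differentiable[OF z] smooth_differentiable[OF smooth_J\<xi> z]
  \<comment> \<open>Differentiates dF(W) = 0 along v. The first summand is the Hessian of F, so by
    its symmetry the difference of the instances for Y and Z leaves dF of their bracket.\<close>
  have 1: "der (\<lambda>q. der F q (W z)) z v + der F z (der W z v) = 0"
    if W: "smooth_on S W" "\<And>q. q \<in> S \<Longrightarrow> W q \<in> D q" for W v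
  proof -
    have A: "((\<lambda>q. der F q (W q)) has_derivative (\<lambda>v. der (\<lambda>q. der F q (W z)) z v + der F z (der W z v))) (at z)"
      by (rule has_derivative_family[OF open_S linear_der[OF open_S F(1)] z
            smooth_differentiable[OF smooth_on_der[OF F(1)] z]
            smooth_on_imp_has_derivative[OF open_S W(1) z]])
    have B: "((\<lambda>q. der F q (W q)) has_derivative (\<lambda>v. 0)) (at z)"
      by (rule has_derivative_transform_within_open[OF has_derivative_const[of 0] open_S z])
        (simp add: F(2) W)
    show ?thesis
      using fun_cong[OF has_derivative_unique[OF A B], of v] by simp
  qed
  have lin: "linear (der F z)" by (rule linear_der[OF open_S F(1) z])
  define B where "B = cov y Z z - cov (J z y) Y z"
  have "der F z B = 0"
  proof -
    have "B = der Z z y - der Y z (J z y)"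
      by (simp add: B_def cov_def YZ \<Gamma>_sym[OF z])
    then show ?thesis
      using 1[OF smY inD(1), of "J z y"] 1[OF smZ inD(2), of y]
        symmetric_der[OF open_S F(1) z, of y "J z y"] linear_diff[OF lin] by (simp add: YZ)
  qed
  \<comment> \<open>Moves the derivative from W to V when these are orthogonal; V will be \<xi> or
    J\<xi>, whose derivatives along D are known.\<close>
  have orth: "G z (cov v W z) (V z) = - G z (W z) (cov v V z)"
    if "smooth_on S W" "smooth_on S V" "\<And>q. q \<in> S \<Longrightarrow> G q (W q) (V q) = 0" for W V v
  proof -
    have "der (\<lambda>q. G q (W q) (V q)) z = der (\<lambda>q. 0) z"
      by (rule der_cong_open[OF open_S z]) (rule that(3))
    then show ?thesis
      using der_G[OF z smooth_differentiable[OF that(1) z] smooth_differentiable[OF that(2) z], of v] by simp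
  qed
  have cZ: "cov y Z z = J z (cov y Y z)"
    unfolding Z_def using cov_J[OF z dY] by (simp add: Y_def)
  have cJ: "cov v (\<lambda>q. J q (\<xi> q)) z = J z (cov v \<xi> z)" for v
    by (rule cov_J[OF z dxi(1)])
  have B\<xi>: "G z B (\<xi> z) = 0"
    using orth[OF smZ \<xi>_smooth D_orth(1)[OF _ inD(2)], of y] orth[OF smY \<xi>_smooth D_orth(1)[OF _ inD(1)], of "J z y"]
      cov_\<xi>[OF z y(2)] cov_\<xi>[OF z J_D[OF z y(2)]] G_J_self[OF z, of y] G_sym[OF z, of y "J z y"]
    by (simp add: B_def YZ G_simps[OF z])
  \<comment> \<open>Each of the two derivatives in B contributes -k|y|^2/2. Since k is nowhere zero,
    B has a nonzero component outside D.\<close>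
  have BJ\<xi>: "G z B (J z (\<xi> z)) = - k z * G z y y"
    using orth[OF smY \<xi>_smooth D_orth(1)[OF _ inD(1)], of y] orth[OF smY smooth_J\<xi> D_orth(2)[OF _ inD(1)], of "J z y"]
      cov_\<xi>[OF z y(2)] cov_\<xi>[OF z J_D[OF z y(2)]]
    by (simp add: B_def YZ G_simps[OF z] cZ G_J_J[OF z] cJ J_simps[OF z] J_J[OF z])
  have "der F z (J z (\<xi> z)) = 0"
  proof -
    have "der F z B = der F z (pr z B) + G z B (\<xi> z) * der F z (\<xi> z) + G z B (J z (\<xi> z)) * der F z (J z (\<xi> z))"
      by (subst pr_decomp[of B z]) (simp add: linear_add[OF lin] linear_scale[OF lin])
    then have "k z * G z y y * der F z (J z (\<xi> z)) = 0"
      using \<open>der F z B = 0\<close> F(2)[OF z pr_D[OF z]] by (simp add: B\<xi> BJ\<xi>)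
    then show ?thesis
      using k_nz[OF z] y(1) G_zero_iff[OF z] by simp
  qed
  then show ?thesis
    using F(2)[OF z pr_D[OF z, of v]]
    by (subst pr_decomp[of v z]) (simp add: linear_add[OF lin] linear_scale[OF lin] v)
qed

lemma der_k_perp: "z \<in> S \<Longrightarrow> G z v (\<xi> z) = 0 \<Longrightarrow> der k z v = 0"
  by (rule der_perp_zero[OF k_smooth der_k_D])

section \<open>Curvature on D and Schur's lemma for a\<close>

lemma K_Pi_D:
  assumes z: "z \<in> S" and D: "x \<in> D z" "y \<in> D z" "w \<in> D z" "t \<in> D z"
  shows "K z x y w t = a z * Pi z x y w t"
proof -
  have "K z x y w t - a z * Pi z x y w t = 0"
  proof (rule kaehler_curvature_like_zero[of "\<lambda>x y w t. K z x y w t - a z * Pi z x y w t" "J z" "D z"])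
    show "linear (\<lambda>x. K z x y w t - a z * Pi z x y w t)" for y w t
      by (intro linear_compose_sub linear_K_1[OF z])
        (use linear_compose_scale_right[OF linear_Pi_1[OF z], of "a z"] in simp)
    show "K z u (J z u) (J z u) u - a z * Pi z u (J z u) (J z u) u = 0" if "u \<in> D z" for u
      using that K_D[OF z] by (simp add: D_def Pi_holomorphic[OF z])
    show "K z x y w t - a z * Pi z x y w t = - (K z y x w t - a z * Pi z y x w t)" for x y w t
      using K_antisym12[OF z, of x y w t] Pi_antisym12[OF z, of x y w t] by simp
    show "K z x y w t - a z * Pi z x y w t = - (K z x y t w - a z * Pi z x y t w)" for x y w t
      using K_antisym34[OF z, of x y w t] Pi_antisym34[OF z, of x y w t] by simp
    show "K z x y w t - a z * Pi z x y w t + (K z y w x t - a z * Pi z y w x t)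
        + (K z w x y t - a z * Pi z w x y t) = 0" for x y w t
      using K_bianchi1[OF z, of x y w t] arg_cong[OF Pi_bianchi[OF z, of x y w t], of "\<lambda>s. a z * s"]
      by (simp add: algebra_simps)
  qed (use z D in \<open>simp_all add: J_linear J_J K_J Pi_J subspace_D J_D\<close>)
  then show ?thesis by simp
qed

text \<open>The vanishing of dk on D kills the component along \<xi>, J-invariance carries this over
  to J\<xi>, and \<open>Pi\<close> vanishes there because D is J-invariant. A free last slot is
  needed because covariant derivatives of fields in D may leave D.\<close>

lemma K_Pi_D3:
  assumes z: "z \<in> S" and D: "x \<in> D z" "y \<in> D z" "w \<in> D z"
  shows "K z x y w t = a z * Pi z x y w t"
proof -
  have 1: "K z x y w (\<xi> z) = 0" if "w \<in> D z" for w
    using R_\<xi>[OF z D(1,2) that] der_k_D[OF z] D K_antisym34[OF z, of x y w "\<xi> z"] by (simp add: K_def)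
  have 2: "K z x y w (J z (\<xi> z)) = 0"
    using K_J[OF z, of x y w "J z (\<xi> z)"] 1[OF J_D[OF z D(3)]]
    by (simp add: J_J[OF z] K_def G_simps[OF z])
  have "Pi z x y w (\<xi> z) = 0" "Pi z x y w (J z (\<xi> z)) = 0"
    using D_orth[OF z] D J_D[OF z] by (simp_all add: Pi_def)
  moreover have "K z x y w t = K z x y w (pr z t) + G z t (\<xi> z) * K z x y w (\<xi> z)
      + G z t (J z (\<xi> z)) * K z x y w (J z (\<xi> z))"
    unfolding K_def by (subst pr_decomp[of t z]) (simp add: G_simps[OF z])
  moreover have "Pi z x y w t = Pi z x y w (pr z t) + G z t (\<xi> z) * Pi z x y w (\<xi> z)
      + G z t (J z (\<xi> z)) * Pi z x y w (J z (\<xi> z))"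
    unfolding Pi_def by (subst (1 2 3 4 5) pr_decomp[of t z]) (simp add: G_simps[OF z] algebra_simps)
  ultimately show ?thesis
    using K_Pi_D[OF z D pr_D[OF z, of t]] 1[OF D(3)] 2 by simp
qed

lemma smooth_on_K:
  "open T \<Longrightarrow> T \<subseteq> S \<Longrightarrow> smooth_on T X \<Longrightarrow> smooth_on T Y \<Longrightarrow> smooth_on T Z \<Longrightarrow> smooth_on T W \<Longrightarrow>
    smooth_on T (\<lambda>z. K z (X z) (Y z) (Z z) (W z))"
  unfolding K_def by (intro smooth_on_G smooth_on_R)

lemma a_smooth: "smooth_on S a"
proof (rule smooth_local_quotient)
  fix z assume z: "z \<in> S"
  obtain y where y: "y \<noteq> 0" "y \<in> D z"
    using obtain_D[OF z] by metis
  have smJ: "smooth_on S (\<lambda>q. J q (pr q y))"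
    by (rule smooth_on_J[OF open_S order_refl smooth_pr])
  show "\<exists>h d. smooth_on S h \<and> smooth_on S d \<and> d z \<noteq> 0 \<and> (\<forall>q\<in>S. h q = a q * d q)"
  proof (intro exI conjI ballI)
    show "smooth_on S (\<lambda>q. K q (pr q y) (J q (pr q y)) (J q (pr q y)) (pr q y))"
      by (intro smooth_on_K smooth_pr smJ open_S order_refl)
    show "smooth_on S (\<lambda>q. (G q (pr q y) (pr q y))\<^sup>2)"
      unfolding power2_eq_square by (intro smooth_on_mult smooth_on_G smooth_pr open_S order_refl)
    show "(G z (pr z y) (pr z y))\<^sup>2 \<noteq> 0"
      using y z by (simp add: pr_id G_zero_iff)
    show "K q (pr q y) (J q (pr q y)) (J q (pr q y)) (pr q y) = a q * (G q (pr q y) (pr q y))\<^sup>2" if "q \<in> S" for q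
      using K_D[OF that] pr_D[OF that, of y] by (simp add: D_def)
  qed
qed

text \<open>Differentiate K = a Pi along fields in D. A term in which an argument is differentiated
  has at most one vector outside D, hence it agrees on both sides and cancels; as \<open>Pi\<close>
  is parallel, only da times Pi is left.\<close>

lemma nabR_D:
  assumes z: "z \<in> S" and D: "y1 \<in> D z" "y2 \<in> D z" "y3 \<in> D z" "y4 \<in> D z"
  shows "G z (nabR z v y1 y2 y3) y4 = der a z v * Pi z y1 y2 y3 y4"
proof -
  define Y where "Y = (\<lambda>y q. pr q y)"
  have sm: "smooth_on S (Y y)" for y by (simp add: Y_def smooth_pr)
  have Yz: "Y y z = y" if "y \<in> D z" for y using that by (simp add: Y_def pr_id)
  note Yd = Yz[OF D(1)] Yz[OF D(2)] Yz[OF D(3)] Yz[OF D(4)]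
  have YD: "Y y q \<in> D q" if "q \<in> S" for y q using that by (simp add: Y_def pr_D)
  note d = smooth_differentiable[OF sm z]
  let ?R = "\<lambda>q. R q (Y y1 q) (Y y2 q) (Y y3 q)"
  have smR: "smooth_on S ?R" by (intro smooth_on_R open_S order_refl sm)
  have HP: "((\<lambda>q. Pi q (Y y1 q) (Y y2 q) (Y y3 q) (Y y4 q)) has_derivative
    (\<lambda>v. Pi z (cov v (Y y1) z) y2 y3 y4 + Pi z y1 (cov v (Y y2) z) y3 y4
      + Pi z y1 y2 (cov v (Y y3) z) y4 + Pi z y1 y2 y3 (cov v (Y y4) z))) (at z)"
    using has_derivative_Pi[OF z d[of y1] d[of y2] d[of y3] d[of y4]] unfolding Yd .
  have "der (\<lambda>q. G q (?R q) (Y y4 q)) z = der (\<lambda>q. a q * Pi q (Y y1 q) (Y y2 q) (Y y3 q) (Y y4 q)) z"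
    by (rule der_cong_open[OF open_S z]) (use K_Pi_D YD in \<open>simp add: K_def\<close>)
  from fun_cong[OF this, of v]
  have *: "G z (cov v ?R z) y4 + K z y1 y2 y3 (cov v (Y y4) z)
    = a z * (Pi z (cov v (Y y1) z) y2 y3 y4 + Pi z y1 (cov v (Y y2) z) y3 y4
      + Pi z y1 y2 (cov v (Y y3) z) y4 + Pi z y1 y2 y3 (cov v (Y y4) z))
      + der a z v * Pi z y1 y2 y3 y4"
    using der_G[OF z smooth_differentiable[OF smR z] d[of y4], of v]
      der_eqI[OF has_derivative_mult[OF smooth_on_imp_has_derivative[OF open_S a_smooth z] HP]]
    by (simp add: Yd K_def)
  \<comment> \<open>Pair symmetry and skew symmetry bring the free slot to the last place, the one
    covered by \<open>K_Pi_D3\<close>.\<close>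
  have K1: "K z u y2 y3 y4 = a z * Pi z u y2 y3 y4" for u
    using K_Pi_D3[OF z D(3,4,2), of u] K_pair[OF z, of u y2 y3 y4] Pi_pair[OF z, of u y2 y3 y4]
      K_antisym34[OF z, of y3 y4 u y2] Pi_antisym34[OF z, of y3 y4 u y2] by simp
  have K2: "K z y1 u y3 y4 = a z * Pi z y1 u y3 y4" for u
    using K_Pi_D3[OF z D(3,4,1), of u] K_pair[OF z, of y1 u y3 y4] Pi_pair[OF z, of y1 u y3 y4] by simp
  have K3: "K z y1 y2 u y4 = a z * Pi z y1 y2 u y4" for u
    using K_Pi_D3[OF z D(1,2,4), of u] K_antisym34[OF z, of y1 y2 u y4] Pi_antisym34[OF z, of y1 y2 u y4] by simp
  have "G z (cov v ?R z) y4 = G z (nabR z v y1 y2 y3) y4 + a z * Pi z (cov v (Y y1) z) y2 y3 y4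
      + a z * Pi z y1 (cov v (Y y2) z) y3 y4 + a z * Pi z y1 y2 (cov v (Y y3) z) y4"
    unfolding cov_R[OF open_S order_refl z sm sm sm] Yd K1[symmetric] K2[symmetric] K3[symmetric]
    by (simp add: K_def G_simps[OF z])
  then show ?thesis
    using * K_Pi_D3[OF z D(1,2,3), of "cov v (Y y4) z"] by (simp add: algebra_simps)
qed

text \<open>In the Bianchi identity for x, y, Jy the coefficients of da(y) and da(Jy) are values of
  \<open>Pi\<close> that vanish because y is orthogonal to x and Jx.\<close>

lemma der_a_D:
  assumes z: "z \<in> S" and x: "x \<in> D z"
  shows "der a z x = 0"
proof -
  obtain y where y: "y \<noteq> 0" "y \<in> D z" "G z y x = 0" "G z y (J z x) = 0"
    using obtain_D[OF z] by metis
  have o: "G z x y = 0" "G z (J z x) y = 0" "G z x (J z y) = 0" "G z (J z y) x = 0"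
    using y G_sym[OF z] G_J_left[OF z] by (metis neg_0_equal_iff_equal)+
  note Jy = J_D[OF z y(2)]
  have "G z (nabR z x y (J z y) (J z y) + nabR z y (J z y) x (J z y) + nabR z (J z y) x y (J z y)) y = 0"
    by (simp add: bianchi2[OF z] G_simps[OF z])
  then have "der a z x * Pi z y (J z y) (J z y) y + der a z y * Pi z (J z y) x (J z y) y
      + der a z (J z y) * Pi z x y (J z y) y = 0"
    by (simp add: G_simps[OF z] nabR_D[OF z] x y(2) Jy)
  moreover have "Pi z (J z y) x (J z y) y = 0" "Pi z x y (J z y) y = 0"
    using o y by (simp_all add: Pi_def G_J_J[OF z] J_J[OF z] G_simps[OF z])
  ultimately have "der a z x * (G z y y)\<^sup>2 = 0"
    by (simp add: Pi_holomorphic[OF z])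
  then show ?thesis using y(1) G_zero_iff[OF z] by simp
qed

lemma der_a_perp: "z \<in> S \<Longrightarrow> G z v (\<xi> z) = 0 \<Longrightarrow> der a z v = 0"
  by (rule der_perp_zero[OF a_smooth der_a_D])

end

section \<open>Smooth fields from smooth inner products\<close>

context riem_patch
begin

text \<open>Gram-Schmidt: the orthogonal projections onto the spans of sets of basis vectors are smooth, by
  induction on the set; for the full basis the projection is the identity.\<close>

lemma orthogonal_projection_smooth:
  assumes T: "open T" "T \<subseteq> S" and B: "finite B" "independent B"
  shows "\<exists>P. (\<forall>y\<in>T. \<forall>u. P y u \<in> span B \<and> (\<forall>v\<in>span B. G y (u - P y u) v = 0)) \<and>
    (\<forall>w. (\<forall>b\<in>B. smooth_on T (\<lambda>y. G y (w y) b)) \<longrightarrow> smooth_on T (\<lambda>y. P y (w y)))"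
  using B
proof (induction B rule: finite_induct)
  case empty
  then show ?case
    by (intro exI[of _ "\<lambda>y u. 0"]) (auto simp: G_simps(9) smooth_on_const[OF T(1)] subsetD[OF T(2)])
next
  case (insert b B)
  have b: "b \<notin> span B" and ind: "independent B"
    using insert.prems insert.hyps by (auto simp: independent_insert)
  obtain P where P: "\<And>y u. y \<in> T \<Longrightarrow> P y u \<in> span B" "\<And>y u v. y \<in> T \<Longrightarrow> v \<in> span B \<Longrightarrow> G y (u - P y u) v = 0"
    and sm: "\<And>w. (\<And>b. b \<in> B \<Longrightarrow> smooth_on T (\<lambda>y. G y (w y) b)) \<Longrightarrow> smooth_on T (\<lambda>y. P y (w y))"
    using insert.IH[OF ind] by metis
  define e where "e = (\<lambda>y. b - P y b)"
  have e_nz: "e y \<noteq> 0" if "y \<in> T" for y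
    using P(1)[OF that, of b] b by (auto simp: e_def)
  have e_orth: "G y (e y) v = 0" "G y v (e y) = 0" if "y \<in> T" "v \<in> span B" for y v
    using P(2)[OF that, of b] G_sym[of y v "e y"] that(1) T(2) by (auto simp: e_def)
  define P' where "P' = (\<lambda>y u. P y u + (G y u (e y) / G y (e y) (e y)) *\<^sub>R e y)"
  have smPb: "smooth_on T (\<lambda>y. P y b)"
    by (rule sm) (intro smooth_on_G T smooth_on_const)
  have smE: "smooth_on T e" unfolding e_def by (intro smooth_on_diff smooth_on_const T smPb)
  have memb: "e y \<in> span (insert b B)" if "y \<in> T" for y
    using P(1)[OF that, of b] span_mono[of B "insert b B"] unfolding e_def
    by (intro span_diff) (auto simp: span_base)
  show ?case
  proof (rule exI[of _ P'], intro conjI ballI allI impI)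
    fix y u assume y: "y \<in> T"
    then have yS: "y \<in> S" using T(2) by auto
    show "P' y u \<in> span (insert b B)"
      using P(1)[OF y, of u] span_mono[of B "insert b B"] memb[OF y] unfolding P'_def
      by (intro span_add span_scale) auto
    fix v assume "v \<in> span (insert b B)"
    then obtain r where r: "v - r *\<^sub>R b \<in> span B"
      by (auto simp: span_insert)
    define v' where "v' = v - r *\<^sub>R b + r *\<^sub>R P y b"
    have v': "v' \<in> span B" unfolding v'_def by (intro span_add span_scale r P(1)[OF y])
    have v: "v = v' + r *\<^sub>R e y" by (simp add: v'_def e_def algebra_simps)
    have "G y (e y) (e y) \<noteq> 0" using e_nz[OF y] G_zero_iff[OF yS] by simp
    then show "G y (u - P' y u) v = 0"
      using P(2)[OF y v', of u] e_orth[OF y v'] e_orth[OF y P(1)[OF y, of u]]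
      unfolding v P'_def by (simp add: G_simps[OF yS])
  next
    fix w assume w: "\<forall>b'\<in>insert b B. smooth_on T (\<lambda>y. G y (w y) b')"
    have smPw: "smooth_on T (\<lambda>y. P y (w y))" by (rule sm) (use w in auto)
    \<comment> \<open>Only the pairings of w with the given vectors are known to be smooth, not w
      itself. As P is self-adjoint, the pairing of w with P b equals that of P w with b, and P w is
      smooth by induction.\<close>
    have "smooth_on T (\<lambda>y. G y (w y) b - G y (P y (w y)) b)"
      by (rule smooth_on_diff[OF T(1) _ smooth_on_G[OF T smPw smooth_on_const[OF T(1)]]]) (use w in auto)
    then have smwe: "smooth_on T (\<lambda>y. G y (w y) (e y))"
    proof (rule smooth_on_cong[OF T(1)])
      fix y assume y: "y \<in> T"
      then have yS: "y \<in> S" using T(2) by auto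
      show "G y (w y) b - G y (P y (w y)) b = G y (w y) (e y)"
        using P(2)[OF y P(1)[OF y, of b], of "w y"] e_orth(2)[OF y P(1)[OF y, of "w y"]]
        by (simp add: e_def G_simps[OF yS])
    qed
    show "smooth_on T (\<lambda>y. P' y (w y))"
      unfolding P'_def
    proof (intro smooth_on_add[OF T(1) smPw] smooth_on_scaleR[OF T(1) _ smE] smooth_on_divide[OF T(1) smwe])
      show "smooth_on T (\<lambda>y. G y (e y) (e y))" by (rule smooth_on_G[OF T smE smE])
      show "G y (e y) (e y) \<noteq> 0" if "y \<in> T" for y
        using e_nz[OF that] G_zero_iff[of y "e y"] that T(2) by auto
    qed
  qed
qed

text \<open>Raises an index without inverting the Gram matrix: for the full basis the projection
  reproduces w, and its smoothness depends on the pairings alone.\<close>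

lemma smooth_on_dual:
  assumes T: "open T" "T \<subseteq> S" and w: "\<And>b. smooth_on T (\<lambda>y. G y (w y) b)"
  shows "smooth_on T w"
proof -
  obtain P where P: "\<And>y u v. y \<in> T \<Longrightarrow> G y (u - P y u) v = 0"
    and "\<And>w. (\<And>b. b \<in> Basis \<Longrightarrow> smooth_on T (\<lambda>y. G y (w y) b)) \<Longrightarrow> smooth_on T (\<lambda>y. P y (w y))"
    using orthogonal_projection_smooth[OF T finite_Basis independent_Basis] unfolding span_Basis by blast
  then have sm: "smooth_on T (\<lambda>y. P y (w y))" using w by blast
  show ?thesis
  proof (rule smooth_on_cong[OF T(1) sm])
    fix y assume y: "y \<in> T"
    then have "w y - P y (w y) = 0"
      using P[OF y, of "w y" "w y - P y (w y)"] G_zero_iff T(2) by blast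
    then show "P y (w y) = w y" by simp
  qed
qed

end

section \<open>Integral hypersurfaces in coordinates\<close>

text \<open>\<open>f\<close> is the inclusion read in two charts. By the range condition \<xi> along
  \<open>f\<close> is the unit normal. \<open>\<Gamma>Q\<close> is known only as the Levi-Civita
  connection of \<open>GQ\<close>; its relation to \<open>\<Gamma>\<close> is the Gauss formula
  below.\<close>

locale hypersurface_patch = B0_patch S G \<Gamma> J \<xi> k ps a + Q: riem_patch U GQ \<Gamma>Q
  for S :: "'e::euclidean_space set" and G \<Gamma> J \<xi> k ps a
    and U :: "'f::euclidean_space set" and GQ \<Gamma>Q +
  fixes f :: "'f \<Rightarrow> 'e"
  assumes f_smooth: "smooth_on U f"
    and f_in: "\<And>y. y \<in> U \<Longrightarrow> f y \<in> S"
    and f_range: "\<And>y. y \<in> U \<Longrightarrow> range (der f y) = {v. G (f y) v (\<xi> (f y)) = 0}"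
    and GQ: "\<And>y u v. y \<in> U \<Longrightarrow> GQ y u v = G (f y) (der f y u) (der f y v)"
begin

lemma f_image: "f ` U \<subseteq> S"
  using f_in by auto

lemma linear_der_f: "y \<in> U \<Longrightarrow> linear (der f y)"
  by (rule linear_der[OF Q.open_S f_smooth])

lemma der_f_perp: "y \<in> U \<Longrightarrow> G (f y) (der f y u) (\<xi> (f y)) = 0"
  using f_range[of y] by blast

lemma smooth_der_f: "smooth_on U (\<lambda>y. der f y w)"
  by (rule smooth_on_der[OF f_smooth])

lemma has_derivative_f: "y \<in> U \<Longrightarrow> (f has_derivative der f y) (at y)"
  by (rule smooth_on_imp_has_derivative[OF Q.open_S f_smooth])

lemma has_derivative_compose_f:
  assumes "smooth_on S F" "y \<in> U"
  shows "((\<lambda>y. F (f y)) has_derivative (\<lambda>u. der F (f y) (der f y u))) (at y)"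
  by (rule has_derivative_compose[OF has_derivative_f[OF assms(2)]
        smooth_on_imp_has_derivative[OF open_S assms(1) f_in[OF assms(2)]]])

lemma smooth_compose_f: "smooth_on S F \<Longrightarrow> smooth_on U (\<lambda>y. F (f y))"
  by (rule smooth_on_compose[OF Q.open_S open_S f_image f_smooth])

text \<open>The pull-back connection on vector fields along \<open>f\<close>.\<close>

definition cova :: "'f \<Rightarrow> ('f \<Rightarrow> 'e) \<Rightarrow> 'f \<Rightarrow> 'e"
  where "cova u W y = der W y u + \<Gamma> (f y) (der f y u) (W y)"

lemma cova_cong:
  assumes "open T" "y \<in> T" "\<And>y. y \<in> T \<Longrightarrow> X y = Y y"
  shows "cova u X y = cova u Y y"
  using der_cong_open[OF assms] assms(2,3) by (simp add: cova_def)

lemma cova_add: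
  assumes "y \<in> U" "X differentiable at y" "Y differentiable at y"
  shows "cova u (\<lambda>z. X z + Y z) y = cova u X y + cova u Y y"
  using der_eqI[OF has_derivative_add[OF assms(2,3)[unfolded frechet_derivative_works]]]
  by (simp add: cova_def \<Gamma>_simps[OF f_in[OF assms(1)]])

lemma cova_diff:
  assumes "y \<in> U" "X differentiable at y" "Y differentiable at y"
  shows "cova u (\<lambda>z. X z - Y z) y = cova u X y - cova u Y y"
  using der_eqI[OF has_derivative_diff[OF assms(2,3)[unfolded frechet_derivative_works]]]
  by (simp add: cova_def \<Gamma>_simps[OF f_in[OF assms(1)]])

lemma cova_scaleR:
  assumes "y \<in> U" "F differentiable at y" "Y differentiable at y"
  shows "cova u (\<lambda>z. F z *\<^sub>R Y z) y = der F y u *\<^sub>R Y y + F y *\<^sub>R cova u Y y"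
  using der_eqI[OF has_derivative_scaleR[OF assms(2,3)[unfolded frechet_derivative_works]]]
  by (simp add: cova_def \<Gamma>_simps[OF f_in[OF assms(1)]] algebra_simps)

lemma has_derivative_G_f:
  assumes y: "y \<in> U" and "X differentiable at y" "Y differentiable at y"
  shows "((\<lambda>z. G (f z) (X z) (Y z)) has_derivative
    (\<lambda>u. G (f y) (cova u X y) (Y y) + G (f y) (X y) (cova u Y y))) (at y)"
  using has_derivative_family2[OF Q.open_S G_linear_left[OF f_in] G_linear[OF f_in] y
      differentiableI[OF has_derivative_compose_f[OF G_smooth y]]
      assms(2,3)[unfolded frechet_derivative_works]]
  by (simp add: cova_def der_eqI[OF has_derivative_compose_f[OF G_smooth y]]
      G_simps[OF f_in[OF y]] G_parallel[OF f_in[OF y]] algebra_simps)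

lemmas der_G_f = fun_cong[OF der_eqI[OF has_derivative_G_f]]

lemma has_derivative_\<Gamma>_f:
  assumes y: "y \<in> U" and "(X has_derivative X') (at y)" "(Y has_derivative Y') (at y)"
  shows "((\<lambda>z. \<Gamma> (f z) (X z) (Y z)) has_derivative
    (\<lambda>u. d\<Gamma> (f y) (der f y u) (X y) (Y y) + \<Gamma> (f y) (X' u) (Y y) + \<Gamma> (f y) (X y) (Y' u))) (at y)"
  using has_derivative_family2[OF Q.open_S \<Gamma>_linear_left[OF f_in] \<Gamma>_linear[OF f_in] y
      differentiableI[OF has_derivative_compose_f[OF \<Gamma>_smooth y]] assms(2,3)]
  by (simp add: d\<Gamma>_def der_eqI[OF has_derivative_compose_f[OF \<Gamma>_smooth y]])

lemma smooth_on_G_f: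
  "open T \<Longrightarrow> T \<subseteq> U \<Longrightarrow> smooth_on T X \<Longrightarrow> smooth_on T Y \<Longrightarrow> smooth_on T (\<lambda>y. G (f y) (X y) (Y y))"
  by (rule smooth_on_family2[OF _ G_linear_left[OF f_in] G_linear[OF f_in]
        smooth_on_subset[OF smooth_compose_f[OF G_smooth]]]) auto

lemma smooth_on_\<Gamma>_f:
  "open T \<Longrightarrow> T \<subseteq> U \<Longrightarrow> smooth_on T X \<Longrightarrow> smooth_on T Y \<Longrightarrow> smooth_on T (\<lambda>y. \<Gamma> (f y) (X y) (Y y))"
  by (rule smooth_on_family2[OF _ \<Gamma>_linear_left[OF f_in] \<Gamma>_linear[OF f_in]
        smooth_on_subset[OF smooth_compose_f[OF \<Gamma>_smooth]]]) auto

lemma smooth_on_J_f: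
  "open T \<Longrightarrow> T \<subseteq> U \<Longrightarrow> smooth_on T X \<Longrightarrow> smooth_on T (\<lambda>y. J (f y) (X y))"
  by (rule smooth_on_family[OF _ J_linear[OF f_in] smooth_on_subset[OF smooth_compose_f[OF J_smooth]]]) auto

lemma smooth_on_der_f:
  "open T \<Longrightarrow> T \<subseteq> U \<Longrightarrow> smooth_on T X \<Longrightarrow> smooth_on T (\<lambda>y. der f y (X y))"
  by (rule smooth_on_family[OF _ linear_der_f smooth_on_subset[OF smooth_der_f]]) auto

lemma smooth_cova: "smooth_on U W \<Longrightarrow> smooth_on U (cova u W)"
  unfolding cova_def[abs_def]
  by (intro smooth_on_add smooth_on_\<Gamma>_f smooth_on_der f_smooth Q.open_S order_refl)

text \<open>The pairings of w with constant vectors for \<open>GQ\<close> are pairings of the smooth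
  W with \<open>der f y b\<close>; \<open>smooth_on_dual\<close> then replaces a smooth left inverse
  of \<open>der f\<close>.\<close>

lemma smooth_on_pullback:
  assumes T: "open T" "T \<subseteq> U" and W: "smooth_on T W" "\<And>y. y \<in> T \<Longrightarrow> der f y (w y) = W y"
  shows "smooth_on T w"
proof (rule Q.smooth_on_dual[OF T])
  fix b
  have "smooth_on T (\<lambda>y. G (f y) (W y) (der f y b))"
    by (rule smooth_on_G_f[OF T W(1) smooth_on_subset[OF smooth_der_f T(2)]])
  then show "smooth_on T (\<lambda>y. GQ y (w y) b)"
    by (rule smooth_on_cong[OF T(1)]) (use T(2) W(2) GQ in auto)
qed

lemma cova_J:
  assumes y: "y \<in> U" and W: "W differentiable at y"
  shows "cova u (\<lambda>y. J (f y) (W y)) y = J (f y) (cova u W y)"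
  using has_derivative_family[OF Q.open_S J_linear[OF f_in] y
      differentiableI[OF has_derivative_compose_f[OF J_smooth y]] W[unfolded frechet_derivative_works]]
    J_parallel[OF f_in[OF y], of "W y" "der f y u"]
  by (simp add: der_eqI cova_def der_eqI[OF has_derivative_compose_f[OF J_smooth y]]
      J_simps[OF f_in[OF y]] algebra_simps)

lemma cova_compose: "smooth_on S X \<Longrightarrow> y \<in> U \<Longrightarrow> cova u (\<lambda>y. X (f y)) y = cov (der f y u) X (f y)"
  by (simp add: cova_def cov_def der_eqI[OF has_derivative_compose_f])

section \<open>Gauss formula and shape operator\<close>

text \<open>The second fundamental form, with the sign given by the derivative of the normal \<xi>;
  hence the minus sign in the Gauss formula.\<close>

definition h :: "'f \<Rightarrow> 'f \<Rightarrow> 'f \<Rightarrow> real"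
  where "h y u w = G (f y) (cov (der f y u) \<xi> (f y)) (der f y w)"

lemma differentiable_U: "smooth_on U W \<Longrightarrow> y \<in> U \<Longrightarrow> W differentiable at y"
  by (rule smooth_on_imp_differentiable[OF Q.open_S])

text \<open>The uniqueness argument for Levi-Civita connections shows that the tangential defect
  vanishes. The normal component comes from differentiating the orthogonality of
  \<open>der f y w\<close> and \<xi>.\<close>

lemma gauss_formula_const:
  assumes y: "y \<in> U"
  shows "cova u (\<lambda>y. der f y w) y = der f y (\<Gamma>Q y u w) - h y u w *\<^sub>R \<xi> (f y)"
proof -
  note fy = f_in[OF y] and d = differentiable_U[OF smooth_der_f y]
  have d\<xi>: "(\<lambda>y. \<xi> (f y)) differentiable at y"
    by (rule differentiable_U[OF smooth_compose_f[OF \<xi>_smooth] y])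
  define B where "B u w = cova u (\<lambda>y. der f y w) y - der f y (\<Gamma>Q y u w)" for u w
  define b where "b u w t = G (f y) (B u w) (der f y t)" for u w t
  have s: "b u w t = b w u t" for u w t
    unfolding b_def B_def cova_def using symmetric_der[OF Q.open_S f_smooth y, of u w]
    by (simp add: \<Gamma>_sym[OF fy, of "der f y u" "der f y w"] Q.\<Gamma>_sym[OF y, of u w])
  have m: "b u w t + b u t w = 0" for u w t
  proof -
    have "der (\<lambda>y. GQ y w t) y = der (\<lambda>y. G (f y) (der f y w) (der f y t)) y"
      by (rule der_cong_open[OF Q.open_S y]) (rule GQ)
    then have "GQ y (\<Gamma>Q y u w) t + GQ y w (\<Gamma>Q y u t)
        = G (f y) (cova u (\<lambda>y. der f y w) y) (der f y t) + G (f y) (der f y w) (cova u (\<lambda>y. der f y t) y)"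
      using Q.G_parallel[OF y, of w t u] der_G_f[OF y d d, of w t u] by simp
    then show ?thesis
      unfolding b_def B_def GQ[OF y] by (simp add: G_simps[OF fy] G_sym[OF fy, of "der f y w"])
  qed
  \<comment> \<open>A trilinear form that is symmetric in the first two and skew in the last two
    arguments is zero.\<close>
  have b0: "b u w t = 0" for t
    using m[of u w t] s[of u t w] m[of t u w] s[of t w u] m[of w t u] s[of w u t] by linarith
  have n: "G (f y) (B u w) (\<xi> (f y)) = - h y u w"
  proof -
    have "der (\<lambda>y. G (f y) (der f y w) (\<xi> (f y))) y = der (\<lambda>y. 0) y"
      by (rule der_cong_open[OF Q.open_S y]) (rule der_f_perp)
    then have "G (f y) (cova u (\<lambda>y. der f y w) y) (\<xi> (f y)) = - h y u w"
      using der_G_f[OF y d d\<xi>, of w u]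
      by (simp add: cova_compose[OF \<xi>_smooth y] h_def G_sym[OF fy, of "der f y w"])
    then show ?thesis by (simp add: B_def G_simps[OF fy] der_f_perp[OF y])
  qed
  \<comment> \<open>With the normal part compensated, what remains is tangent and orthogonal to
    every tangent vector.\<close>
  define N where "N = B u w + h y u w *\<^sub>R \<xi> (f y)"
  have "G (f y) N (\<xi> (f y)) = 0"
    by (simp add: N_def G_simps[OF fy] n \<xi>_unit[OF fy])
  then obtain t where t: "N = der f y t" using f_range[OF y] by blast
  have "G (f y) N N = 0"
    unfolding t[symmetric] using b0[of t] der_f_perp[OF y, of t] \<open>G (f y) N (\<xi> (f y)) = 0\<close> G_sym[OF fy, of N "\<xi> (f y)"]
    unfolding b_def t[symmetric] by (subst (1) N_def) (simp add: G_simps[OF fy])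
  then have "N = 0" using G_zero_iff[OF fy] by simp
  then show ?thesis by (simp add: N_def B_def algebra_simps add_eq_0_iff)
qed

lemma gauss_formula:
  assumes y: "y \<in> U" and X: "X differentiable at y"
  shows "cova u (\<lambda>y. der f y (X y)) y = der f y (Q.cov u X y) - h y u (X y) *\<^sub>R \<xi> (f y)"
  using has_derivative_family[OF Q.open_S linear_der_f y differentiable_U[OF smooth_der_f y]
      X[unfolded frechet_derivative_works]] gauss_formula_const[OF y, of u "X y"]
  by (simp add: der_eqI cova_def Q.cov_def linear_add[OF linear_der_f[OF y]] algebra_simps)

text \<open>The shape operator has the value k/2 on D and -\<open>ps\<close> on J\<xi>. Writing it
  as k/2 times the identity minus a rank one term isolates \<open>ps\<close>, which cancels in the
  Sasakian identities.\<close>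

lemma cov_\<xi>_perp:
  assumes z: "z \<in> S" and v: "G z v (\<xi> z) = 0"
  shows "cov v \<xi> z = (k z / 2) *\<^sub>R v - ((k z / 2 + ps z) * G z v (J z (\<xi> z))) *\<^sub>R J z (\<xi> z)"
proof -
  note lin = linear_cov[OF z \<xi>_differentiable[OF z]]
  have "cov v \<xi> z = (k z / 2) *\<^sub>R pr z v - (G z v (J z (\<xi> z)) * ps z) *\<^sub>R J z (\<xi> z)"
    by (subst pr_decomp[of v z])
      (simp add: linear_add[OF lin] linear_scale[OF lin] cov_\<xi>[OF z pr_D[OF z]] cov_\<xi>_J\<xi>[OF z] v)
  then show ?thesis by (simp add: pr_def v algebra_simps)
qed

section \<open>The Sasakian identities in coordinates\<close>

text \<open>The Gauss formula for the tangent field J\<xi>, with J parallel. The explicit multiples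
  of \<xi>, (k/2 + \<open>ps\<close>)\<eta>(u) from J and -\<open>ps\<close> \<eta>(u) from h, add
  up to k/2 \<eta>(u).\<close>

lemma sasaki_xi:
  assumes T: "open T" "T \<subseteq> U" "y \<in> T" and X: "smooth_on T X" "\<And>y. y \<in> T \<Longrightarrow> der f y (X y) = J (f y) (\<xi> (f y))"
  shows "der f y (Q.cov u X y) = (k (f y) / 2) *\<^sub>R
    (J (f y) (der f y u) + G (f y) (der f y u) (J (f y) (\<xi> (f y))) *\<^sub>R \<xi> (f y))"
proof -
  have y: "y \<in> U" using T by auto
  note fy = f_in[OF y]
  let ?v = "der f y u"
  have "cova u (\<lambda>y. der f y (X y)) y = cova u (\<lambda>y. J (f y) (\<xi> (f y))) y"
    by (rule cova_cong[OF T(1,3) X(2)])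
  also have "\<dots> = J (f y) (cov ?v \<xi> (f y))"
    by (simp add: cova_J[OF y differentiable_U[OF smooth_compose_f[OF \<xi>_smooth] y]] cova_compose[OF \<xi>_smooth y])
  finally have "der f y (Q.cov u X y) = J (f y) (cov ?v \<xi> (f y)) + h y u (X y) *\<^sub>R \<xi> (f y)"
    using gauss_formula[OF y smooth_on_imp_differentiable[OF T(1) X(1) T(3)], of u] by (simp add: diff_eq_eq)
  then show ?thesis
    by (simp add: h_def X(2)[OF T(3)] cov_\<xi>_perp[OF fy der_f_perp[OF y]] J_simps[OF fy] J_J[OF fy]
        G_simps[OF fy] \<xi>_J\<xi>[OF fy] algebra_simps)
qed

text \<open>Differentiate the formula for \<phi>X along \<open>f\<close> and apply the Gauss formula
  to X and to \<phi>X. What survives is \<eta>(X) times the derivative of \<xi>, minus h(u, X)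
  J\<xi>; the rank one part of the shape operator occurs twice with opposite signs.\<close>

lemma sasaki_phi:
  assumes T: "open T" "T \<subseteq> U" "y \<in> T" and X: "smooth_on T X" and Y: "smooth_on T Y"
    "\<And>y. y \<in> T \<Longrightarrow> der f y (Y y) = J (f y) (der f y (X y))
      + G (f y) (der f y (X y)) (J (f y) (\<xi> (f y))) *\<^sub>R \<xi> (f y)"
  shows "der f y (Q.cov u Y y) - (J (f y) (der f y (Q.cov u X y))
      + G (f y) (der f y (Q.cov u X y)) (J (f y) (\<xi> (f y))) *\<^sub>R \<xi> (f y))
    = (k (f y) / 2) *\<^sub>R (G (f y) (der f y (X y)) (J (f y) (\<xi> (f y))) *\<^sub>R der f y u
      - G (f y) (der f y u) (der f y (X y)) *\<^sub>R J (f y) (\<xi> (f y)))"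
proof -
  have y: "y \<in> U" using T by auto
  note fy = f_in[OF y]
  let ?v = "der f y u" and ?W = "\<lambda>y. der f y (X y)" and ?\<xi> = "\<lambda>y. \<xi> (f y)" and ?J\<xi> = "\<lambda>y. J (f y) (\<xi> (f y))"
  let ?e = "\<lambda>y. G (f y) (?W y) (?J\<xi> y)" and ?c = "cov ?v \<xi> (f y)"
  have dd: "F differentiable at y" if "smooth_on T F" for F :: "'f \<Rightarrow> 'x::real_normed_vector"
    by (rule smooth_on_imp_differentiable[OF T(1) that T(3)])
  have smW: "smooth_on T ?W" by (rule smooth_on_der_f[OF T(1,2) X])
  have sm\<xi>: "smooth_on T ?\<xi>" by (rule smooth_on_subset[OF smooth_compose_f[OF \<xi>_smooth] T(2)])
  have smJ\<xi>: "smooth_on T ?J\<xi>" by (rule smooth_on_J_f[OF T(1,2) sm\<xi>])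
  have smJW: "smooth_on T (\<lambda>y. J (f y) (?W y))" by (rule smooth_on_J_f[OF T(1,2) smW])
  have sme: "smooth_on T ?e" by (rule smooth_on_G_f[OF T(1,2) smW smJ\<xi>])
  have sme\<xi>: "smooth_on T (\<lambda>y. ?e y *\<^sub>R ?\<xi> y)" by (rule smooth_on_scaleR[OF T(1) sme sm\<xi>])
  have cJ\<xi>: "cova u ?J\<xi> y = J (f y) ?c"
    by (simp add: cova_J[OF y dd[OF sm\<xi>]] cova_compose[OF \<xi>_smooth y])
  define A where "A = der f y (Q.cov u X y)"
  have cW: "cova u ?W y = A - h y u (X y) *\<^sub>R \<xi> (f y)"
    unfolding A_def by (rule gauss_formula[OF y dd[OF X]])
  have "cova u (\<lambda>y. der f y (Y y)) y = cova u (\<lambda>y. J (f y) (?W y) + ?e y *\<^sub>R ?\<xi> y) y"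
    by (rule cova_cong[OF T(1,3) Y(2)])
  also have "\<dots> = J (f y) (cova u ?W y) + (der ?e y u *\<^sub>R \<xi> (f y) + ?e y *\<^sub>R ?c)"
    by (simp add: cova_add[OF y dd[OF smJW] dd[OF sme\<xi>]] cova_J[OF y dd[OF smW]]
        cova_scaleR[OF y dd[OF sme] dd[OF sm\<xi>]] cova_compose[OF \<xi>_smooth y])
  also have "der ?e y u = G (f y) (cova u ?W y) (?J\<xi> y) + G (f y) (?W y) (J (f y) ?c)"
    by (simp add: der_G_f[OF y dd[OF smW] dd[OF smJ\<xi>]] cJ\<xi>)
  finally have 1: "der f y (Q.cov u Y y) = J (f y) (cova u ?W y)
      + ((G (f y) (cova u ?W y) (?J\<xi> y) + G (f y) (?W y) (J (f y) ?c)) *\<^sub>R \<xi> (f y) + ?e y *\<^sub>R ?c)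
      + h y u (Y y) *\<^sub>R \<xi> (f y)"
    using gauss_formula[OF y dd[OF Y(1)], of u] by (simp add: diff_eq_eq)
  have c\<xi>: "G (f y) ?c (\<xi> (f y)) = 0"
    by (simp add: cov_\<xi>_perp[OF fy der_f_perp[OF y]] G_simps[OF fy] \<xi>_J\<xi>[OF fy] der_f_perp[OF y])
  \<comment> \<open>\<phi>X and JX differ by a multiple of \<xi>, to which the derivative of \<xi>
    is orthogonal. Thus h(u, \<phi>X) cancels the contribution of the derivative of J\<xi> to the
    normal component.\<close>
  have hY: "h y u (Y y) = - G (f y) (?W y) (J (f y) ?c)"
    by (simp add: h_def Y(2)[OF T(3)] G_simps[OF fy] c\<xi> G_J_skew[OF fy, of ?c])
  have hX: "h y u (X y) = k (f y) / 2 * G (f y) ?v (?W y)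
      - (k (f y) / 2 + ps (f y)) * G (f y) ?v (?J\<xi> y) * ?e y"
    by (simp add: h_def cov_\<xi>_perp[OF fy der_f_perp[OF y]] G_simps[OF fy] G_sym[OF fy, of "?J\<xi> y" "?W y"])
  have "der f y (Q.cov u Y y) - (J (f y) A + G (f y) A (?J\<xi> y) *\<^sub>R \<xi> (f y))
      = ?e y *\<^sub>R ?c - h y u (X y) *\<^sub>R ?J\<xi> y"
    unfolding 1 cW hY by (simp add: J_simps[OF fy] G_simps[OF fy] \<xi>_J\<xi>[OF fy] algebra_simps)
  also have "\<dots> = (k (f y) / 2) *\<^sub>R (?e y *\<^sub>R ?v - G (f y) ?v (?W y) *\<^sub>R ?J\<xi> y)"
    unfolding hX cov_\<xi>_perp[OF fy der_f_perp[OF y]] by (simp add: algebra_simps)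
  finally show ?thesis unfolding A_def .
qed

section \<open>Gauss equation and \<phi>-holomorphic curvature\<close>

text \<open>u and v are constant fields, so there is no bracket term; the remaining derivatives
  cancel by the symmetry of the second derivatives of \<open>f\<close> and of
  \<open>der f y w\<close>.\<close>

lemma R_f:
  assumes y: "y \<in> U"
  shows "cova u (cova v (\<lambda>y. der f y w)) y - cova v (cova u (\<lambda>y. der f y w)) y
    = R (f y) (der f y u) (der f y v) (der f y w)"
proof -
  note fy = f_in[OF y]
  let ?D2 = "\<lambda>w v. der (\<lambda>y. der f y w) y v"
  have hd: "((\<lambda>y. der f y w) has_derivative ?D2 w) (at y)" for w
    by (rule smooth_on_imp_has_derivative[OF Q.open_S smooth_der_f y])
  have 1: "cova u (cova v (\<lambda>y. der f y w)) y = der (\<lambda>q. der (\<lambda>y. der f y w) q v) y u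
    + (d\<Gamma> (f y) (der f y u) (der f y v) (der f y w) + \<Gamma> (f y) (?D2 v u) (der f y w)
      + \<Gamma> (f y) (der f y v) (?D2 w u))
    + (\<Gamma> (f y) (der f y u) (?D2 w v) + \<Gamma> (f y) (der f y u) (\<Gamma> (f y) (der f y v) (der f y w)))" for u v
  proof -
    have "(cova v (\<lambda>y. der f y w) has_derivative (\<lambda>u. der (\<lambda>q. der (\<lambda>y. der f y w) q v) y u
      + (d\<Gamma> (f y) (der f y u) (der f y v) (der f y w) + \<Gamma> (f y) (?D2 v u) (der f y w)
      + \<Gamma> (f y) (der f y v) (?D2 w u)))) (at y)"
      unfolding cova_def[abs_def]
      by (intro has_derivative_add has_derivative_\<Gamma>_f[OF y hd hd]
          smooth_on_imp_has_derivative[OF Q.open_S smooth_on_der[OF smooth_der_f] y])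
    from der_eqI[OF this] show ?thesis
      unfolding cova_def[of u] by (simp add: cova_def \<Gamma>_simps[OF fy])
  qed
  show ?thesis
    unfolding 1 R_def using symmetric_der[OF Q.open_S smooth_der_f y, of w v u]
      symmetric_der[OF Q.open_S f_smooth y, of u v] by simp
qed

lemma gauss_equation:
  assumes y: "y \<in> U"
  shows "Q.K y u v w t = K (f y) (der f y u) (der f y v) (der f y w) (der f y t)
    + h y v w * h y u t - h y u w * h y v t"
proof -
  note fy = f_in[OF y]
  have sm\<xi>: "smooth_on U (\<lambda>y. \<xi> (f y))" by (rule smooth_compose_f[OF \<xi>_smooth])
  have smh: "smooth_on U (\<lambda>y. h y v w)" for v w
  proof (rule smooth_on_cong[OF Q.open_S])
    show "smooth_on U (\<lambda>y. G (f y) (cova v (\<lambda>y. \<xi> (f y)) y) (der f y w))"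
      by (intro smooth_on_G_f smooth_cova sm\<xi> smooth_der_f Q.open_S order_refl)
    show "G (f y) (cova v (\<lambda>y. \<xi> (f y)) y) (der f y w) = h y v w" if "y \<in> U" for y
      by (simp add: h_def cova_compose[OF \<xi>_smooth that])
  qed
  have sm\<Gamma>: "smooth_on U (\<lambda>y. \<Gamma>Q y v w)" for v w
    by (rule Q.\<Gamma>_smooth)
  \<comment> \<open>Pairing with the tangent vector \<open>der f y t\<close> removes the derivative
    of the coefficient \<open>h y v w\<close>, which multiplies \<xi>; the derivative of \<xi>
    itself produces the product of two values of h.\<close>
  have 1: "G (f y) (cova u (cova v (\<lambda>y. der f y w)) y) (der f y t)
      = GQ y (Q.cov u (\<lambda>y. \<Gamma>Q y v w) y) t - h y v w * h y u t" for u v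
  proof -
    have sm1: "smooth_on U (\<lambda>y. der f y (\<Gamma>Q y v w))"
      by (rule smooth_on_der_f[OF Q.open_S order_refl sm\<Gamma>])
    have sm2: "smooth_on U (\<lambda>y. h y v w *\<^sub>R \<xi> (f y))"
      by (rule smooth_on_scaleR[OF Q.open_S smh sm\<xi>])
    have "cova u (cova v (\<lambda>y. der f y w)) y = cova u (\<lambda>y. der f y (\<Gamma>Q y v w) - h y v w *\<^sub>R \<xi> (f y)) y"
      by (rule cova_cong[OF Q.open_S y gauss_formula_const])
    also have "\<dots> = der f y (Q.cov u (\<lambda>y. \<Gamma>Q y v w) y) - h y u (\<Gamma>Q y v w) *\<^sub>R \<xi> (f y)
        - (der (\<lambda>y. h y v w) y u *\<^sub>R \<xi> (f y) + h y v w *\<^sub>R cov (der f y u) \<xi> (f y))"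
      by (simp add: cova_diff[OF y differentiable_U[OF sm1 y] differentiable_U[OF sm2 y]]
          gauss_formula[OF y differentiable_U[OF sm\<Gamma> y]]
          cova_scaleR[OF y differentiable_U[OF smh y] differentiable_U[OF sm\<xi> y]] cova_compose[OF \<xi>_smooth y])
    finally show ?thesis
      using der_f_perp[OF y, of t] G_sym[OF fy, of "\<xi> (f y)" "der f y t"]
      by (simp add: G_simps[OF fy] h_def GQ[OF y])
  qed
  have "Q.R y u v w = Q.cov u (\<lambda>y. \<Gamma>Q y v w) y - Q.cov v (\<lambda>y. \<Gamma>Q y u w) y"
    using Q.ricci_const[OF y smooth_on_const[OF Q.open_S, of w], of u v] by (simp add: Q.cov_const[abs_def])
  then have "Q.K y u v w t = GQ y (Q.cov u (\<lambda>y. \<Gamma>Q y v w) y) t - GQ y (Q.cov v (\<lambda>y. \<Gamma>Q y u w) y) t"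
    by (simp add: Q.K_def Q.G_simps[OF y])
  moreover have "K (f y) (der f y u) (der f y v) (der f y w) (der f y t)
      = G (f y) (cova u (cova v (\<lambda>y. der f y w)) y) (der f y t) - G (f y) (cova v (cova u (\<lambda>y. der f y w)) y) (der f y t)"
    unfolding K_def R_f[OF y, symmetric] by (simp add: G_simps[OF fy])
  ultimately show ?thesis using 1 by simp
qed

text \<open>On D the form h is k/2 times the metric: the product of its diagonal values gives k^2/4,
  and the mixed term vanishes because Ju is orthogonal to u.\<close>

lemma K_phi:
  assumes y: "y \<in> U" and u: "der f y u \<in> D (f y)" and v: "der f y v = J (f y) (der f y u)"
  shows "Q.K y u v v u = (a (f y) + (k (f y))\<^sup>2 / 4) * (GQ y u u)\<^sup>2"
    and "GQ y v v = GQ y u u" and "GQ y u v = 0"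
proof -
  note fy = f_in[OF y]
  let ?x = "der f y u"
  have h1: "h y v v = k (f y) / 2 * GQ y u u" "h y u u = k (f y) / 2 * GQ y u u" "h y u v = 0"
    using cov_\<xi>[OF fy u] cov_\<xi>[OF fy J_D[OF fy u]]
    by (simp_all add: h_def v G_simps[OF fy] GQ[OF y] G_J_J[OF fy] G_J_self[OF fy])
  have K: "K (f y) ?x (der f y v) (der f y v) ?x = a (f y) * (GQ y u u)\<^sup>2"
    using K_D[OF fy] u by (simp add: D_def GQ[OF y] v)
  show "Q.K y u v v u = (a (f y) + (k (f y))\<^sup>2 / 4) * (GQ y u u)\<^sup>2"
    unfolding gauss_equation[OF y] h1 K by (simp add: power2_eq_square field_simps)
  show "GQ y v v = GQ y u u" "GQ y u v = 0"
    by (simp_all add: GQ[OF y] v G_J_J[OF fy] G_J_self[OF fy])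
qed

lemma has_derivative_zero_f:
  assumes F: "smooth_on S F" "\<And>z v. z \<in> S \<Longrightarrow> G z v (\<xi> z) = 0 \<Longrightarrow> der F z v = 0" and y: "y \<in> U"
  shows "((\<lambda>y. F (f y)) has_derivative (\<lambda>u. 0)) (at y)"
  using has_derivative_compose_f[OF F(1) y] F(2)[OF f_in[OF y] der_f_perp[OF y]] by simp

text \<open>The derivatives vanish in all directions of the hypersurface, and a ball is convex;
  connectedness is left to the global argument.\<close>

lemma ak_locally_constant:
  assumes y: "y \<in> U"
  obtains e where "e > 0" "ball y e \<subseteq> U" "\<And>q. q \<in> ball y e \<Longrightarrow> k (f q) = k (f y) \<and> a (f q) = a (f y)"
proof -
  obtain e where e: "e > 0" "ball y e \<subseteq> U" using y Q.open_S openE by blast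
  have c: "F (f q) = F (f y)" if q: "q \<in> ball y e" and F: "smooth_on S F"
    "\<And>z v. z \<in> S \<Longrightarrow> G z v (\<xi> z) = 0 \<Longrightarrow> der F z v = 0" for F :: "'e \<Rightarrow> real" and q
  proof -
    have "\<exists>c. \<forall>x\<in>ball y e. F (f x) = c"
    proof (rule has_derivative_zero_constant[OF convex_ball])
      show "((\<lambda>y. F (f y)) has_derivative (\<lambda>h. 0)) (at x within ball y e)" if "x \<in> ball y e" for x
        by (rule has_derivative_at_withinI[OF has_derivative_zero_f[OF F]]) (use that e in auto)
    qed
    then show ?thesis using q e(1) by auto
  qed
  show ?thesis
    by (rule that[OF e]) (use c[OF _ k_smooth der_k_perp] c[OF _ a_smooth der_a_perp] in blast)
qed

end

section \<open>Charts, tangent vectors and vector fields\<close>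

lemma scaleR_fun_apply: "(r *\<^sub>R F) x = r *\<^sub>R F x" for F :: "'a \<Rightarrow> 'b::real_vector"
  by (simp add: scaleR_fun_def)

lemma sum_fun_apply: "(\<Sum>i\<in>I. F i) c = (\<Sum>i\<in>I. F i c)" for F :: "'i \<Rightarrow> 'x \<Rightarrow> 'y::comm_monoid_add"
  by (induction I rule: infinite_finite_induct) auto

lemma mem_span2E:
  assumes "v \<in> span {x, y}"
  obtains \<alpha> \<beta> where "v = \<alpha> *\<^sub>R x + \<beta> *\<^sub>R y"
proof -
  obtain \<alpha> where "v - \<alpha> *\<^sub>R x \<in> span {y}"
    using assms span_breakdown_eq[of v x "{y}"] by auto
  then obtain \<beta> where "v - \<alpha> *\<^sub>R x = \<beta> *\<^sub>R y" by (auto simp: span_singleton)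
  then show ?thesis by (intro that[of \<alpha> \<beta>]) (simp add: algebra_simps)
qed

locale mfd =
  fixes M :: "('m, 'e::euclidean_space) manifold"
  assumes smooth_M: "smooth_manifold M"
begin

lemma chart_openin: "c \<in> atlas M \<Longrightarrow> openin (mtop M) (fst c)"
  and chart_image_open: "c \<in> atlas M \<Longrightarrow> open (snd c ` fst c)"
  and chart_homeo: "c \<in> atlas M \<Longrightarrow>
    homeomorphic_map (subtopology (mtop M) (fst c)) (top_of_set (snd c ` fst c)) (snd c)"
  and transition_smooth: "c \<in> atlas M \<Longrightarrow> d \<in> atlas M \<Longrightarrow>
    smooth_on (snd c ` (fst c \<inter> fst d)) (snd d \<circ> chart_inv c)"
  and charts_cover: "(\<Union>c\<in>atlas M. fst c) = topspace (mtop M)"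
  using smooth_M unfolding smooth_manifold_def by blast+

lemma chart_inj: "c \<in> atlas M \<Longrightarrow> inj_on (snd c) (fst c)"
  using homeomorphic_imp_injective_map[OF chart_homeo] openin_subset[OF chart_openin]
  by (simp add: topspace_subtopology inf.absorb2)

lemma chart_inv_left [simp]: "c \<in> atlas M \<Longrightarrow> p \<in> fst c \<Longrightarrow> chart_inv c (snd c p) = p"
  by (simp add: chart_inv_def inv_into_f_f chart_inj)

lemma chart_inv_right [simp]: "y \<in> snd c ` fst c \<Longrightarrow> snd c (chart_inv c y) = y"
  by (simp add: chart_inv_def f_inv_into_f)

lemma charts_at_iff: "c \<in> charts_at M p \<longleftrightarrow> c \<in> atlas M \<and> p \<in> fst c"
  by (simp add: charts_at_def)

lemma chart_at: "p \<in> topspace (mtop M) \<Longrightarrow> chart_at M p \<in> charts_at M p"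
  unfolding chart_at_def using charts_cover
  by (intro someI_ex[of "\<lambda>c. c \<in> charts_at M p"]) (metis UN_E charts_at_iff)

lemma in_topspace: "c \<in> charts_at M p \<Longrightarrow> p \<in> topspace (mtop M)"
  using openin_subset[OF chart_openin] charts_at_iff by blast

lemma chart_image_openin:
  assumes "c \<in> atlas M" "openin (mtop M) W" "W \<subseteq> fst c"
  shows "open (snd c ` W)"
proof -
  have "openin (subtopology (mtop M) (fst c)) W"
    using assms by (simp add: openin_open_subtopology chart_openin)
  then have "openin (top_of_set (snd c ` fst c)) (snd c ` W)"
    using homeomorphic_imp_open_map[OF chart_homeo[OF assms(1)]] by (simp add: open_map_def)
  then show ?thesis
    using chart_image_open[OF assms(1)] openin_open_trans by blast
qed

lemma chart_preimage_openin:
  assumes "c \<in> atlas M" "open T"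
  shows "openin (mtop M) {p \<in> fst c. snd c p \<in> T}"
proof -
  have "openin (top_of_set (snd c ` fst c)) (snd c ` fst c \<inter> T)"
    using assms(2) by (simp add: openin_open_Int)
  from openin_continuous_map_preimage[OF homeomorphic_imp_continuous_map[OF chart_homeo[OF assms(1)]] this]
  have "openin (subtopology (mtop M) (fst c)) {p \<in> fst c. snd c p \<in> T}"
    using openin_subset[OF chart_openin[OF assms(1)]]
    by (auto simp: topspace_subtopology inf.absorb2 elim!: back_subst[of "openin _"])
  then show ?thesis
    using openin_trans_full chart_openin[OF assms(1)] by blast
qed

lemma overlap_open: "c \<in> atlas M \<Longrightarrow> d \<in> atlas M \<Longrightarrow> open (snd c ` (fst c \<inter> fst d))"
  by (rule chart_image_openin) (auto intro: chart_openin)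

lemma transition_has_derivative:
  assumes "c \<in> charts_at M p" "d \<in> charts_at M p"
  shows "(snd d \<circ> chart_inv c has_derivative der (snd d \<circ> chart_inv c) (snd c p)) (at (snd c p))"
  using assms by (intro smooth_on_imp_has_derivative[OF overlap_open transition_smooth])
    (auto simp: charts_at_iff)

lemma transition_cocycle:
  assumes c: "c \<in> charts_at M p" and d: "d \<in> charts_at M p" and e: "e \<in> charts_at M p"
  shows "der (snd e \<circ> chart_inv d) (snd d p) (der (snd d \<circ> chart_inv c) (snd c p) u)
    = der (snd e \<circ> chart_inv c) (snd c p) u"
proof -
  have a: "c \<in> atlas M" "d \<in> atlas M" "p \<in> fst c" "p \<in> fst d"
    using c d by (auto simp: charts_at_iff)
  have v: "(snd d \<circ> chart_inv c) (snd c p) = snd d p" using a by simp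
  have "((snd e \<circ> chart_inv d) \<circ> (snd d \<circ> chart_inv c) has_derivative
      der (snd e \<circ> chart_inv d) (snd d p) \<circ> der (snd d \<circ> chart_inv c) (snd c p)) (at (snd c p))"
    using diff_chain_at[OF transition_has_derivative[OF c d]] transition_has_derivative[OF d e] v by metis
  moreover have "der ((snd e \<circ> chart_inv d) \<circ> (snd d \<circ> chart_inv c)) (snd c p) = der (snd e \<circ> chart_inv c) (snd c p)"
    by (rule der_cong_open[OF overlap_open[OF a(1,2)]]) (use a in auto)
  ultimately show ?thesis by (metis der_eqI comp_apply)
qed

lemma transition_self:
  assumes c: "c \<in> charts_at M p"
  shows "der (snd c \<circ> chart_inv c) (snd c p) u = u"
proof -
  have "der (snd c \<circ> chart_inv c) (snd c p) = der (\<lambda>y. y) (snd c p)"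
    by (rule der_cong_open[OF chart_image_open]) (use c in \<open>auto simp: charts_at_iff\<close>)
  then show ?thesis by simp
qed

text \<open>The value \<open>0\<close> off the chart domain makes \<open>lift c q\<close> linear for all \<open>q\<close>, so that \<open>\<lambda>q. lift c q u\<close>
  is a global field extending the coordinate field.\<close>

definition lift :: "('m, 'e) chart \<Rightarrow> 'm \<Rightarrow> 'e \<Rightarrow> ('m, 'e) tangent"
  where "lift c p u = (\<lambda>d. if c \<in> charts_at M p \<and> d \<in> charts_at M p
    then der (snd d \<circ> chart_inv c) (snd c p) u else 0)"

lemma lift_tangent: "lift c p u \<in> tangent_space M p"
proof (cases "c \<in> charts_at M p")
  case True
  then show ?thesis
    by (simp add: tangent_space_def lift_def transition_cocycle)
next
  case False
  have "der (snd d \<circ> chart_inv c') (snd c' p) 0 = 0" if "c' \<in> charts_at M p" "d \<in> charts_at M p" for c' d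
    by (rule linear_0[OF has_derivative_linear[OF transition_has_derivative[OF that]]])
  with False show ?thesis
    by (auto simp: tangent_space_def lift_def)
qed

lemma lift_self [simp]: "c \<in> charts_at M p \<Longrightarrow> lift c p u c = u"
  by (simp add: lift_def transition_self)

lemma tangent_transition:
  "v \<in> tangent_space M p \<Longrightarrow> c \<in> charts_at M p \<Longrightarrow> d \<in> charts_at M p \<Longrightarrow>
    v d = der (snd d \<circ> chart_inv c) (snd c p) (v c)"
  unfolding tangent_space_def by blast

lemma tangent_outside: "v \<in> tangent_space M p \<Longrightarrow> d \<notin> charts_at M p \<Longrightarrow> v d = 0"
  unfolding tangent_space_def by blast

lemma tangent_eq_lift:
  assumes v: "v \<in> tangent_space M p" and c: "c \<in> charts_at M p"
  shows "lift c p (v c) = v"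
proof
  show "lift c p (v c) d = v d" for d
    using tangent_transition[OF v c, of d] tangent_outside[OF v, of d] c by (simp add: lift_def)
qed

lemma tangent_eqI:
  "v \<in> tangent_space M p \<Longrightarrow> w \<in> tangent_space M p \<Longrightarrow> c \<in> charts_at M p \<Longrightarrow> v c = w c \<Longrightarrow> v = w"
  using tangent_eq_lift by metis

lemma linear_lift: "linear (lift c p)"
proof (cases "c \<in> charts_at M p")
  case True
  have "linear (der (snd d \<circ> chart_inv c) (snd c p))" if "d \<in> charts_at M p" for d
    by (rule has_derivative_linear[OF transition_has_derivative[OF True that]])
  then show ?thesis
    by (intro linearI) (auto simp: lift_def fun_eq_iff scaleR_fun_apply linear_add linear_scale)
next
  case False
  then show ?thesis
    by (intro linearI) (auto simp: lift_def fun_eq_iff scaleR_fun_apply)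
qed

lemma tangent_spaceI:
  assumes "\<And>c d. c \<in> charts_at M p \<Longrightarrow> d \<in> charts_at M p \<Longrightarrow> v d = der (snd d \<circ> chart_inv c) (snd c p) (v c)"
    and "\<And>d. d \<notin> charts_at M p \<Longrightarrow> v d = 0"
  shows "v \<in> tangent_space M p"
  using assms unfolding tangent_space_def by blast

lemma subspace_tangent: "subspace (tangent_space M p)"
proof (rule subspaceI)
  have lin: "linear (der (snd d \<circ> chart_inv c) (snd c p))" if "c \<in> charts_at M p" "d \<in> charts_at M p" for c d
    by (rule has_derivative_linear[OF transition_has_derivative[OF that]])
  show "0 \<in> tangent_space M p"
    by (rule tangent_spaceI) (simp_all add: linear_0[OF lin])
  show "x + y \<in> tangent_space M p" if xy: "x \<in> tangent_space M p" "y \<in> tangent_space M p" for x y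
  proof (rule tangent_spaceI)
    fix c d assume c: "c \<in> charts_at M p" and d: "d \<in> charts_at M p"
    show "(x + y) d = der (snd d \<circ> chart_inv c) (snd c p) ((x + y) c)"
      using tangent_transition[OF xy(1) c d] tangent_transition[OF xy(2) c d] linear_add[OF lin[OF c d], of "x c" "y c"]
      by simp
  qed (use xy in \<open>simp add: tangent_outside\<close>)
  show "r *\<^sub>R x \<in> tangent_space M p" if x: "x \<in> tangent_space M p" for x r
  proof (rule tangent_spaceI)
    fix c d assume c: "c \<in> charts_at M p" and d: "d \<in> charts_at M p"
    show "(r *\<^sub>R x) d = der (snd d \<circ> chart_inv c) (snd c p) ((r *\<^sub>R x) c)"
      using tangent_transition[OF x c d] linear_scale[OF lin[OF c d], of r "x c"]
      by (simp add: scaleR_fun_apply)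
  qed (use x in \<open>simp add: tangent_outside scaleR_fun_apply\<close>)
qed

section \<open>Smoothness and derivatives in a single chart\<close>

lemma smooth_field_atD:
  assumes X: "smooth_field_at M p X" and c: "c \<in> charts_at M p"
  obtains T where "open T" "snd c p \<in> T" "T \<subseteq> snd c ` fst c" "smooth_on T (\<lambda>y. X (chart_inv c y) c)"
    "\<And>y. y \<in> T \<Longrightarrow> X (chart_inv c y) \<in> tangent_space M (chart_inv c y)"
proof -
  obtain W where W: "openin (mtop M) W" "p \<in> W" "\<And>q. q \<in> W \<Longrightarrow> X q \<in> tangent_space M q"
    "\<And>c. c \<in> atlas M \<Longrightarrow> smooth_on (snd c ` (W \<inter> fst c)) (\<lambda>y. X (chart_inv c y) c)"
    using X unfolding smooth_field_at_def by blast
  have a: "c \<in> atlas M" "p \<in> fst c" using c by (auto simp: charts_at_iff)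
  show ?thesis
    by (rule that[of "snd c ` (W \<inter> fst c)"])
      (use a W in \<open>auto intro!: chart_image_openin openin_Int chart_openin\<close>)
qed

text \<open>One chart is enough: in any other chart the components are transformed by the derivative
  of a transition map, which is smooth.\<close>

lemma smooth_field_atI:
  assumes c: "c \<in> charts_at M p" and T: "open T" "snd c p \<in> T" "T \<subseteq> snd c ` fst c"
    and sm: "smooth_on T (\<lambda>y. X (chart_inv c y) c)"
    and tg: "\<And>y. y \<in> T \<Longrightarrow> X (chart_inv c y) \<in> tangent_space M (chart_inv c y)"
  shows "smooth_field_at M p X"
proof -
  have a: "c \<in> atlas M" "p \<in> fst c" using c by (auto simp: charts_at_iff)
  define W where "W = {p \<in> fst c. snd c p \<in> T}"
  have W: "openin (mtop M) W" unfolding W_def by (rule chart_preimage_openin[OF a(1) T(1)])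
  have tgW: "X q \<in> tangent_space M q" if "q \<in> W" for q
    using tg[of "snd c q"] that a(1) by (auto simp: W_def)
  have "smooth_on (snd d ` (W \<inter> fst d)) (\<lambda>y. X (chart_inv d y) d)" if d: "d \<in> atlas M" for d
  proof -
    let ?W = "snd d ` (W \<inter> fst d)" and ?V = "snd c ` (fst c \<inter> fst d)"
    have oW: "open ?W" by (rule chart_image_openin[OF d]) (auto intro: W chart_openin[OF d])
    have oV: "open ?V" by (rule overlap_open[OF a(1) d])
    have sg: "smooth_on ?W (\<lambda>y. snd c (chart_inv d y))"
      by (rule smooth_on_subset[OF transition_smooth[OF d a(1), unfolded comp_def]]) (auto simp: W_def)
    have gV: "(\<lambda>y. snd c (chart_inv d y)) ` ?W \<subseteq> ?V" and gT: "(\<lambda>y. snd c (chart_inv d y)) ` ?W \<subseteq> T"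
      using d by (auto simp: W_def)
    have 1: "smooth_on ?W (\<lambda>y. X (chart_inv c (snd c (chart_inv d y))) c)"
      by (rule smooth_on_compose[OF oW T(1) gT sg sm])
    have 2: "smooth_on ?W (\<lambda>y. der (snd d \<circ> chart_inv c) (snd c (chart_inv d y)) u)" for u
      by (rule smooth_on_compose[OF oW oV gV sg smooth_on_der[OF transition_smooth[OF a(1) d]]])
    have 3: "linear (der (snd d \<circ> chart_inv c) (snd c (chart_inv d y)))" if "y \<in> ?W" for y
      using gV that by (intro linear_der[OF oV transition_smooth[OF a(1) d]]) auto
    have 4: "smooth_on ?W (\<lambda>y. der (snd d \<circ> chart_inv c) (snd c (chart_inv d y)) (X (chart_inv c (snd c (chart_inv d y))) c))"
      by (rule smooth_on_family[OF oW 3 2 1])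
    show ?thesis
    proof (rule smooth_on_cong[OF oW 4])
      fix y assume "y \<in> ?W"
      then obtain q where q: "q \<in> W" "q \<in> fst d" "y = snd d q" by auto
      then have "c \<in> charts_at M q" "d \<in> charts_at M q"
        using a d by (auto simp: charts_at_iff W_def)
      then show "der (snd d \<circ> chart_inv c) (snd c (chart_inv d y)) (X (chart_inv c (snd c (chart_inv d y))) c)
          = X (chart_inv d y) d"
        using tangent_transition[OF tgW[OF q(1)], of c d] q a d by (simp add: W_def)
    qed
  qed
  then show ?thesis
    unfolding smooth_field_at_def using W tgW a T(2) by (intro exI[of _ W]) (auto simp: W_def)
qed

lemma smooth_fun_atD:
  assumes f: "smooth_fun_at M p f" and c: "c \<in> charts_at M p"
  obtains T where "open T" "snd c p \<in> T" "T \<subseteq> snd c ` fst c" "smooth_on T (\<lambda>y. f (chart_inv c y))"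
proof -
  obtain W where W: "openin (mtop M) W" "p \<in> W"
    "\<And>c. c \<in> atlas M \<Longrightarrow> smooth_on (snd c ` (W \<inter> fst c)) (f \<circ> chart_inv c)"
    using f unfolding smooth_fun_at_def by blast
  have a: "c \<in> atlas M" "p \<in> fst c" using c by (auto simp: charts_at_iff)
  show ?thesis
    by (rule that[of "snd c ` (W \<inter> fst c)"])
      (use a W in \<open>auto intro!: chart_image_openin openin_Int chart_openin simp: comp_def\<close>)
qed

lemma smooth_fun_atI:
  assumes c: "c \<in> charts_at M p" and T: "open T" "snd c p \<in> T" "T \<subseteq> snd c ` fst c"
    and sm: "smooth_on T (\<lambda>y. f (chart_inv c y))"
  shows "smooth_fun_at M p f"
proof -
  have a: "c \<in> atlas M" "p \<in> fst c" using c by (auto simp: charts_at_iff)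
  define W where "W = {p \<in> fst c. snd c p \<in> T}"
  have W: "openin (mtop M) W" unfolding W_def by (rule chart_preimage_openin[OF a(1) T(1)])
  have "smooth_on (snd d ` (W \<inter> fst d)) (f \<circ> chart_inv d)" if d: "d \<in> atlas M" for d
  proof -
    let ?W = "snd d ` (W \<inter> fst d)"
    have oW: "open ?W" by (rule chart_image_openin[OF d]) (auto intro: W chart_openin[OF d])
    have sg: "smooth_on ?W (\<lambda>y. snd c (chart_inv d y))"
      by (rule smooth_on_subset[OF transition_smooth[OF d a(1), unfolded comp_def]]) (auto simp: W_def)
    have gT: "(\<lambda>y. snd c (chart_inv d y)) ` ?W \<subseteq> T"
      using d by (auto simp: W_def)
    show ?thesis
      by (rule smooth_on_cong[OF oW smooth_on_compose[OF oW T(1) gT sg sm]]) (use a d in \<open>auto simp: W_def\<close>)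
  qed
  then show ?thesis
    unfolding smooth_fun_at_def using W a T(2) by (intro exI[of _ W]) (auto simp: W_def)
qed

lemma smooth_fun_at_differentiable:
  assumes "smooth_fun_at M p f" "c \<in> charts_at M p"
  shows "(f \<circ> chart_inv c) differentiable at (snd c p)"
  using assms by (elim smooth_fun_atD) (auto simp: comp_def intro: smooth_on_imp_differentiable)

lemma smooth_field_at_tangent: "smooth_field_at M p X \<Longrightarrow> X p \<in> tangent_space M p"
  unfolding smooth_field_at_def by blast

text \<open>Makes the chart chosen in \<open>dir_deriv\<close> and \<open>differential\<close>
  immaterial; h is an arbitrary map so that both cases are covered.\<close>

lemma der_chart_change:
  assumes c: "c \<in> charts_at M p" and d: "d \<in> charts_at M p" and v: "v \<in> tangent_space M p"
    and h: "(h \<circ> chart_inv d) differentiable at (snd d p)"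
  shows "der (h \<circ> chart_inv c) (snd c p) (v c) = der (h \<circ> chart_inv d) (snd d p) (v d)"
proof -
  have a: "c \<in> atlas M" "d \<in> atlas M" "p \<in> fst c" "p \<in> fst d"
    using c d by (auto simp: charts_at_iff)
  have h': "(h \<circ> chart_inv d has_derivative der (h \<circ> chart_inv d) (snd d p)) (at ((snd d \<circ> chart_inv c) (snd c p)))"
    using h a by (simp add: frechet_derivative_works)
  have "der (h \<circ> chart_inv c) (snd c p) = der ((h \<circ> chart_inv d) \<circ> (snd d \<circ> chart_inv c)) (snd c p)"
    by (rule der_cong_open[OF overlap_open[OF a(1,2)]]) (use a in auto)
  also have "\<dots> = der (h \<circ> chart_inv d) (snd d p) \<circ> der (snd d \<circ> chart_inv c) (snd c p)"
    by (rule der_eqI[OF diff_chain_at[OF transition_has_derivative[OF c d] h']])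
  finally show ?thesis
    using tangent_transition[OF v c d] by simp
qed

lemma dir_deriv_chart:
  assumes "c \<in> charts_at M p" "v \<in> tangent_space M p" "smooth_fun_at M p f"
  shows "dir_deriv M p v f = der (\<lambda>y. f (chart_inv c y)) (snd c p) (v c)"
  using der_chart_change[OF chart_at[OF in_topspace[OF assms(1)]] assms(1,2) smooth_fun_at_differentiable[OF assms(3,1)]]
  by (simp add: dir_deriv_def Let_def comp_def)

lemma smooth_fun_at_const: "p \<in> topspace (mtop M) \<Longrightarrow> smooth_fun_at M p (\<lambda>q. r)"
  by (rule smooth_fun_atI[OF chart_at chart_image_open])
    (use chart_at charts_at_iff in \<open>auto intro!: smooth_on_const chart_image_open\<close>)

lemma smooth_field_at_lift:
  assumes c: "c \<in> charts_at M p"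
  shows "smooth_field_at M p (\<lambda>q. lift c q u)"
proof (rule smooth_field_atI[OF c])
  have a: "c \<in> atlas M" using c by (simp add: charts_at_iff)
  show o: "open (snd c ` fst c)" by (rule chart_image_open[OF a])
  show "smooth_on (snd c ` fst c) (\<lambda>y. lift c (chart_inv c y) u c)"
    by (rule smooth_on_cong[OF o smooth_on_const[OF o, of u]])
      (use a in \<open>auto simp: charts_at_iff\<close>)
qed (use c in \<open>auto simp: charts_at_iff lift_tangent\<close>)

lemma smooth_field_at_add:
  assumes "smooth_field_at M p X" "smooth_field_at M p Y" "p \<in> topspace (mtop M)"
  shows "smooth_field_at M p (\<lambda>q. X q + Y q)"
proof -
  note c = chart_at[OF assms(3)]
  let ?c = "chart_at M p"
  obtain T where T: "open T" "snd ?c p \<in> T" "T \<subseteq> snd ?c ` fst ?c" "smooth_on T (\<lambda>y. X (chart_inv ?c y) ?c)"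
    "\<And>y. y \<in> T \<Longrightarrow> X (chart_inv ?c y) \<in> tangent_space M (chart_inv ?c y)"
    by (rule smooth_field_atD[OF assms(1) c]) (rule that)
  obtain T' where T': "open T'" "snd ?c p \<in> T'" "smooth_on T' (\<lambda>y. Y (chart_inv ?c y) ?c)"
    "\<And>y. y \<in> T' \<Longrightarrow> Y (chart_inv ?c y) \<in> tangent_space M (chart_inv ?c y)"
    by (rule smooth_field_atD[OF assms(2) c]) (rule that)
  have o: "open (T \<inter> T')" using T T' by auto
  show ?thesis
    by (rule smooth_field_atI[OF c, of "T \<inter> T'"])
      (use T T' o in \<open>auto intro!: subspace_add[OF subspace_tangent] smooth_on_add intro: smooth_on_subset\<close>)
qed

lemma smooth_field_at_scale:
  assumes "smooth_fun_at M p f" "smooth_field_at M p Y" "p \<in> topspace (mtop M)"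
  shows "smooth_field_at M p (\<lambda>q. f q *\<^sub>R Y q)"
proof -
  note c = chart_at[OF assms(3)]
  let ?c = "chart_at M p"
  obtain T where T: "open T" "snd ?c p \<in> T" "T \<subseteq> snd ?c ` fst ?c" "smooth_on T (\<lambda>y. f (chart_inv ?c y))"
    by (rule smooth_fun_atD[OF assms(1) c]) (rule that)
  obtain T' where T': "open T'" "snd ?c p \<in> T'" "smooth_on T' (\<lambda>y. Y (chart_inv ?c y) ?c)"
    "\<And>y. y \<in> T' \<Longrightarrow> Y (chart_inv ?c y) \<in> tangent_space M (chart_inv ?c y)"
    by (rule smooth_field_atD[OF assms(2) c]) (rule that)
  have o: "open (T \<inter> T')" using T T' by auto
  show ?thesis
    by (rule smooth_field_atI[OF c, of "T \<inter> T'"])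
      (use T T' o in \<open>auto intro!: subspace_scale[OF subspace_tangent] smooth_on_scaleR
        intro: smooth_on_subset simp: scaleR_fun_apply\<close>)
qed

lemma smooth_field_at_sum:
  assumes "\<And>i. i \<in> I \<Longrightarrow> smooth_field_at M p (Y i)" "p \<in> topspace (mtop M)"
  shows "smooth_field_at M p (\<lambda>q. \<Sum>i\<in>I. Y i q)"
  using assms(1)
proof (induction I rule: infinite_finite_induct)
  case (insert i I)
  have "smooth_field_at M p (\<lambda>q. Y i q + (\<Sum>i\<in>I. Y i q))"
    by (intro smooth_field_at_add insert.IH insert.prems assms(2)) auto
  then show ?case by (simp only: sum.insert[OF insert.hyps])
qed (use smooth_field_at_lift[OF chart_at[OF assms(2)], of 0] linear_0[OF linear_lift] in auto)

end


section \<open>Connections in coordinates\<close>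

locale mfd_connection = mfd M for M :: "('m, 'e::euclidean_space) manifold" +
  fixes nabla :: "('m, 'e) connection"
  assumes connection: "affine_connection M nabla"
begin

lemma nabla_linear:
  "p \<in> topspace (mtop M) \<Longrightarrow> smooth_field_at M p Y \<Longrightarrow>
    linear_between (tangent_space M p) (tangent_space M p) (\<lambda>v. nabla p v Y)"
  and nabla_add: "p \<in> topspace (mtop M) \<Longrightarrow> v \<in> tangent_space M p \<Longrightarrow> smooth_field_at M p Y \<Longrightarrow>
    smooth_field_at M p Z \<Longrightarrow> nabla p v (\<lambda>q. Y q + Z q) = nabla p v Y + nabla p v Z"
  and nabla_scale: "p \<in> topspace (mtop M) \<Longrightarrow> v \<in> tangent_space M p \<Longrightarrow> smooth_fun_at M p f \<Longrightarrow>
    smooth_field_at M p Y \<Longrightarrow>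
    nabla p v (\<lambda>q. f q *\<^sub>R Y q) = dir_deriv M p v f *\<^sub>R Y p + f p *\<^sub>R nabla p v Y"
  and nabla_smooth: "p \<in> topspace (mtop M) \<Longrightarrow> smooth_field_at M p X \<Longrightarrow> smooth_field_at M p Y \<Longrightarrow>
    smooth_field_at M p (\<lambda>q. nabla q (X q) Y)"
  using connection unfolding affine_connection_def by blast+

lemma nabla_tangent:
  "p \<in> topspace (mtop M) \<Longrightarrow> smooth_field_at M p Y \<Longrightarrow> v \<in> tangent_space M p \<Longrightarrow> nabla p v Y \<in> tangent_space M p"
  using nabla_linear unfolding linear_between_def by blast

lemma nabla_local:
  assumes p: "p \<in> W" and W: "openin (mtop M) W" and v: "v \<in> tangent_space M p"
    and X: "smooth_field_at M p X" and Y: "smooth_field_at M p Y" and eq: "\<And>q. q \<in> W \<Longrightarrow> X q = Y q"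
  shows "nabla p v X = nabla p v Y"
proof -
  have pt: "p \<in> topspace (mtop M)" using p openin_subset[OF W] by blast
  note c = chart_at[OF pt]
  let ?c = "chart_at M p"
  have a: "?c \<in> atlas M" "p \<in> fst ?c" using c by (auto simp: charts_at_iff)
  \<comment> \<open>The products of f with X and with Y agree everywhere, although X and Y agree on
    W only; f is constant near p, so the Leibniz rule contributes no derivative.\<close>
  define f :: "'m \<Rightarrow> real" where "f = (\<lambda>q. if q \<in> W then 1 else 0)"
  define T where "T = snd ?c ` (W \<inter> fst ?c)"
  have T: "open T" "snd ?c p \<in> T" "T \<subseteq> snd ?c ` fst ?c"
    unfolding T_def using a p by (auto intro!: chart_image_openin openin_Int W chart_openin)
  have f1: "f (chart_inv ?c y) = 1" if "y \<in> T" for y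
    using that a by (auto simp: T_def f_def)
  have f: "smooth_fun_at M p f"
    by (rule smooth_fun_atI[OF c T]) (rule smooth_on_cong[OF T(1) smooth_on_const[OF T(1), of 1]], simp add: f1)
  have "der (\<lambda>y. f (chart_inv ?c y)) (snd ?c p) = der (\<lambda>y. 1) (snd ?c p)"
    by (rule der_cong_open[OF T(1,2)]) (rule f1)
  then have d: "dir_deriv M p v f = 0"
    by (simp add: dir_deriv_chart[OF c v f])
  have fp: "f p = 1" using p by (simp add: f_def)
  have "(\<lambda>q. f q *\<^sub>R X q) = (\<lambda>q. f q *\<^sub>R Y q)"
    using eq by (auto simp: f_def)
  then show ?thesis
    using nabla_scale[OF pt v f X] nabla_scale[OF pt v f Y] fp by (simp add: d)
qed

lemma nabla_sum:
  assumes p: "p \<in> topspace (mtop M)" and v: "v \<in> tangent_space M p"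
    and "\<And>i. i \<in> I \<Longrightarrow> smooth_field_at M p (Y i)"
  shows "nabla p v (\<lambda>q. \<Sum>i\<in>I. Y i q) = (\<Sum>i\<in>I. nabla p v (Y i))"
proof -
  have s: "smooth_field_at M p (\<lambda>q. 0)"
    using smooth_field_at_sum[of "{}" p "\<lambda>i q. 0"] p by (simp only: sum.empty) auto
  have z: "nabla p v (\<lambda>q. 0) = 0"
    using nabla_add[OF p v s s] by (metis add_0 add_cancel_right_right)
  show ?thesis
    using assms(3)
  proof (induction I rule: infinite_finite_induct)
    case (insert i I)
    have "nabla p v (\<lambda>q. Y i q + (\<Sum>i\<in>I. Y i q)) = nabla p v (Y i) + nabla p v (\<lambda>q. \<Sum>i\<in>I. Y i q)"
      by (intro nabla_add p v smooth_field_at_sum insert.prems) auto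
    also have "nabla p v (\<lambda>q. \<Sum>i\<in>I. Y i q) = (\<Sum>i\<in>I. nabla p v (Y i))"
      by (intro insert.IH insert.prems) auto
    finally show ?case by (simp only: sum.insert[OF insert.hyps])
  next
    case (infinite I)
    show ?case by (simp only: sum.infinite[OF infinite.hyps] z)
  next
    case empty
    show ?case by (simp only: sum.empty z)
  qed
qed

text \<open>The Christoffel map of the chart. Coordinate vectors are extended by
  \<open>lift\<close>, since \<open>nabla\<close> takes globally defined fields.\<close>

definition coeff :: "('m, 'e) chart \<Rightarrow> 'e \<Rightarrow> 'e \<Rightarrow> 'e \<Rightarrow> 'e"
  where "coeff c y u w = nabla (chart_inv c y) (lift c (chart_inv c y) u) (\<lambda>q. lift c q w) c"

lemma nabla_lift_sum:
  assumes c: "c \<in> charts_at M p" and v: "v \<in> tangent_space M p"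
  shows "nabla p v (\<lambda>q. lift c q w) = (\<Sum>b\<in>Basis. (w \<bullet> b) *\<^sub>R nabla p v (\<lambda>q. lift c q b))"
proof -
  note p = in_topspace[OF c]
  have s: "nabla p v (\<lambda>q. r *\<^sub>R lift c q b) = r *\<^sub>R nabla p v (\<lambda>q. lift c q b)" for r b
  proof -
    have "dir_deriv M p v (\<lambda>q. r) = 0"
      by (simp add: dir_deriv_chart[OF c v smooth_fun_at_const[OF p]])
    then show ?thesis
      using nabla_scale[OF p v smooth_fun_at_const[OF p] smooth_field_at_lift[OF c], of r b] by simp
  qed
  have "(\<lambda>q. lift c q w) = (\<lambda>q. \<Sum>b\<in>Basis. (w \<bullet> b) *\<^sub>R lift c q b)"
    using linear_expand_Basis[OF linear_lift] by blast
  then have "nabla p v (\<lambda>q. lift c q w) = (\<Sum>b\<in>Basis. nabla p v (\<lambda>q. (w \<bullet> b) *\<^sub>R lift c q b))"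
    by (simp only:) (intro nabla_sum p v smooth_field_at_scale smooth_fun_at_const smooth_field_at_lift c)
  then show ?thesis by (simp only: s)
qed

text \<open>Near p the field Y is a combination of coordinate fields with smooth coefficients;
  locality and the Leibniz rule reduce the derivative to \<open>coeff\<close>.\<close>

lemma nabla_coord:
  assumes c: "c \<in> charts_at M p" and v: "v \<in> tangent_space M p" and Y: "smooth_field_at M p Y"
  shows "nabla p v Y c = der (\<lambda>y. Y (chart_inv c y) c) (snd c p) (v c) + coeff c (snd c p) (v c) (Y p c)"
proof -
  note p = in_topspace[OF c]
  have a: "c \<in> atlas M" "p \<in> fst c" using c by (auto simp: charts_at_iff)
  define r where "r = (\<lambda>y. Y (chart_inv c y) c)"
  obtain T where T: "open T" "snd c p \<in> T" "T \<subseteq> snd c ` fst c" "smooth_on T r"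
    "\<And>y. y \<in> T \<Longrightarrow> Y (chart_inv c y) \<in> tangent_space M (chart_inv c y)"
    by (rule smooth_field_atD[OF Y c, folded r_def]) (rule that)
  define f where "f b q = Y q c \<bullet> b" for b q
  have f: "smooth_fun_at M p (f b)" for b
    by (rule smooth_fun_atI[OF c T(1-3)]) (use smooth_on_inner_const[OF T(1,4)] in \<open>simp add: f_def r_def\<close>)
  have df: "dir_deriv M p v (f b) = der r (snd c p) (v c) \<bullet> b" for b
  proof -
    have "((\<lambda>y. r y \<bullet> b) has_derivative (\<lambda>v. der r (snd c p) v \<bullet> b)) (at (snd c p))"
      by (intro has_derivative_inner_left smooth_on_imp_has_derivative[OF T(1,4,2)])
    then show ?thesis
      unfolding dir_deriv_chart[OF c v f] by (simp add: f_def r_def der_eqI)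
  qed
  \<comment> \<open>Agrees with Y only on the preimage of T, which is why \<open>nabla_local\<close>
    is required.\<close>
  let ?Z = "\<lambda>q. \<Sum>b\<in>Basis. f b q *\<^sub>R lift c q b"
  note smb = smooth_field_at_scale[OF f smooth_field_at_lift[OF c] p]
  have "nabla p v Y = nabla p v ?Z"
  proof (rule nabla_local[OF _ chart_preimage_openin[OF a(1) T(1)] v Y])
    show "p \<in> {q \<in> fst c. snd c q \<in> T}" using a T by auto
    show "smooth_field_at M p ?Z" by (intro smooth_field_at_sum p smb)
    fix q assume q: "q \<in> {q \<in> fst c. snd c q \<in> T}"
    then have "Y q \<in> tangent_space M q" "c \<in> charts_at M q"
      using T(5)[of "snd c q"] a by (auto simp: charts_at_iff)
    from tangent_eq_lift[OF this] show "Y q = ?Z q"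
      unfolding f_def linear_expand_Basis[OF linear_lift, symmetric] by simp
  qed
  also have "\<dots> = (\<Sum>b\<in>Basis. nabla p v (\<lambda>q. f b q *\<^sub>R lift c q b))"
    by (intro nabla_sum p v smb)
  also have "\<dots> = (\<Sum>b\<in>Basis. (der r (snd c p) (v c) \<bullet> b) *\<^sub>R lift c p b)
      + (\<Sum>b\<in>Basis. (Y p c \<bullet> b) *\<^sub>R nabla p v (\<lambda>q. lift c q b))"
    unfolding nabla_scale[OF p v f smooth_field_at_lift[OF c]] df sum.distrib unfolding f_def ..
  also have "\<dots> = lift c p (der r (snd c p) (v c)) + nabla p v (\<lambda>q. lift c q (Y p c))"
    by (rule arg_cong2[where f = "(+)", OF linear_expand_Basis[OF linear_lift, symmetric]
          nabla_lift_sum[OF c v, symmetric]])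
  finally show ?thesis
    using a c tangent_eq_lift[OF v c] by (simp add: coeff_def r_def)
qed

lemma coeff_smooth:
  assumes c: "c \<in> atlas M"
  shows "smooth_on (snd c ` fst c) (\<lambda>y. coeff c y u w)"
proof (rule smooth_on_local[OF chart_image_open[OF c]])
  fix y assume y: "y \<in> snd c ` fst c"
  then have c': "c \<in> charts_at M (chart_inv c y)" using c by (auto simp: charts_at_iff)
  note L = smooth_field_at_lift[OF c']
  have "smooth_field_at M (chart_inv c y) (\<lambda>q. nabla q (lift c q u) (\<lambda>q. lift c q w))"
    by (rule nabla_smooth[OF in_topspace[OF c'] L L])
  then obtain T where "open T" "snd c (chart_inv c y) \<in> T"
    "smooth_on T (\<lambda>y. nabla (chart_inv c y) (lift c (chart_inv c y) u) (\<lambda>q. lift c q w) c)"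
    by (rule smooth_field_atD[OF _ c']) (rule that)
  then show "\<exists>T. open T \<and> y \<in> T \<and> smooth_on T (\<lambda>y. coeff c y u w)"
    using y unfolding coeff_def by (intro exI[of _ T]) simp
qed

lemma coeff_linear:
  assumes c: "c \<in> atlas M" and y: "y \<in> snd c ` fst c"
  shows "linear (coeff c y u)"
proof -
  have c': "c \<in> charts_at M (chart_inv c y)" using c y by (auto simp: charts_at_iff)
  have "coeff c y u w = (\<Sum>b\<in>Basis. (w \<bullet> b) *\<^sub>R coeff c y u b)" for w
    unfolding coeff_def by (subst nabla_lift_sum[OF c' lift_tangent]) (simp add: sum_fun_apply scaleR_fun_apply)
  then have eq: "coeff c y u = (\<lambda>w. \<Sum>b\<in>Basis. (w \<bullet> b) *\<^sub>R coeff c y u b)"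
    by (rule ext)
  show ?thesis
    by (subst eq, rule linearI) (simp_all add: inner_add_left scaleR_left.add sum.distrib scaleR_sum_right)
qed

end

section \<open>Levi-Civita connections in a chart\<close>

locale riem_mfd = mfd_connection M nabla
  for M :: "('m, 'e::euclidean_space) manifold" and nabla +
  fixes g :: "('m, 'e) metric"
  assumes metric: "riemannian_metric M g" and levi_civita: "levi_civita_connection M g nabla"
begin

lemma g_linear: "p \<in> topspace (mtop M) \<Longrightarrow> x \<in> tangent_space M p \<Longrightarrow> linear_between (tangent_space M p) UNIV (g p x)"
  and g_sym: "p \<in> topspace (mtop M) \<Longrightarrow> x \<in> tangent_space M p \<Longrightarrow> y \<in> tangent_space M p \<Longrightarrow> g p x y = g p y x"
  and g_pos: "p \<in> topspace (mtop M) \<Longrightarrow> x \<in> tangent_space M p \<Longrightarrow> x \<noteq> 0 \<Longrightarrow> g p x x > 0"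
  and g_smooth: "p \<in> topspace (mtop M) \<Longrightarrow> smooth_field_at M p X \<Longrightarrow> smooth_field_at M p Y \<Longrightarrow>
    smooth_fun_at M p (\<lambda>q. g q (X q) (Y q))"
  using metric unfolding riemannian_metric_def by blast+

lemma torsion_free: "p \<in> topspace (mtop M) \<Longrightarrow> smooth_field_at M p X \<Longrightarrow> smooth_field_at M p Y \<Longrightarrow>
    nabla p (X p) Y - nabla p (Y p) X = lie_bracket M X Y p"
  and metric_compatible: "p \<in> topspace (mtop M) \<Longrightarrow> smooth_field_at M p X \<Longrightarrow> smooth_field_at M p Y \<Longrightarrow>
    v \<in> tangent_space M p \<Longrightarrow> dir_deriv M p v (\<lambda>q. g q (X q) (Y q)) =
      g p (nabla p v X) (Y p) + g p (X p) (nabla p v Y)"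
  using levi_civita unfolding levi_civita_connection_def by blast+

definition mco :: "('m, 'e) chart \<Rightarrow> 'e \<Rightarrow> 'e \<Rightarrow> 'e \<Rightarrow> real"
  where "mco c y u w = g (chart_inv c y) (lift c (chart_inv c y) u) (lift c (chart_inv c y) w)"

lemma g_coord:
  assumes "c \<in> charts_at M p" "x \<in> tangent_space M p" "y \<in> tangent_space M p"
  shows "g p x y = mco c (snd c p) (x c) (y c)"
  using assms by (simp add: mco_def tangent_eq_lift charts_at_iff)

lemma nabla_lift:
  assumes c: "c \<in> charts_at M p"
  shows "nabla p (lift c p u) (\<lambda>q. lift c q w) = lift c p (coeff c (snd c p) u w)"
  using tangent_eq_lift[OF nabla_tangent[OF in_topspace[OF c] smooth_field_at_lift[OF c, of w]
        lift_tangent[of c p u]] c] c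
  by (simp add: coeff_def charts_at_iff)

text \<open>Constant vectors in the chart are coordinate fields. Their brackets vanish, so
  torsion-freeness gives the symmetry of \<open>coeff\<close>, and metric compatibility gives the
  parallelism axiom.\<close>

lemma patch:
  assumes c: "c \<in> atlas M"
  shows "riem_patch (snd c ` fst c) (mco c) (coeff c)"
proof (rule riem_patch.intro)
  let ?S = "snd c ` fst c"
  show o: "open ?S" by (rule chart_image_open[OF c])
  have ch: "c \<in> charts_at M (chart_inv c y)" if "y \<in> ?S" for y
    using that c by (auto simp: charts_at_iff)
  note top = in_topspace[OF ch] and L = smooth_field_at_lift[OF ch]
  show "smooth_on ?S (\<lambda>z. mco c z u v)" for u v
  proof (rule smooth_on_local[OF o])
    fix y assume y: "y \<in> ?S"
    have "smooth_fun_at M (chart_inv c y) (\<lambda>q. g q (lift c q u) (lift c q v))"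
      by (rule g_smooth[OF top[OF y] L[OF y] L[OF y]])
    then obtain T where "open T" "snd c (chart_inv c y) \<in> T" "smooth_on T (\<lambda>y. g (chart_inv c y)
        (lift c (chart_inv c y) u) (lift c (chart_inv c y) v))"
      by (rule smooth_fun_atD[OF _ ch[OF y]]) (rule that)
    then show "\<exists>T. open T \<and> y \<in> T \<and> smooth_on T (\<lambda>z. mco c z u v)"
      using y unfolding mco_def by (intro exI[of _ T]) simp
  qed
  show "smooth_on ?S (\<lambda>z. coeff c z u v)" for u v by (rule coeff_smooth[OF c])
  fix z assume z: "z \<in> ?S"
  note g = g_linear[OF top[OF z] lift_tangent, unfolded linear_between_def]
  show "linear (mco c z u)" for u
  proof (rule linearI)
    show "mco c z u (v + w) = mco c z u v + mco c z u w" for v w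
      using g[of c u] by (simp add: mco_def linear_add[OF linear_lift] lift_tangent)
    show "mco c z u (r *\<^sub>R w) = r *\<^sub>R mco c z u w" for r w
      using g[of c u] by (simp add: mco_def linear_scale[OF linear_lift] lift_tangent)
  qed
  show "mco c z u v = mco c z v u" for u v
    unfolding mco_def by (rule g_sym[OF top[OF z] lift_tangent lift_tangent])
  show "mco c z u u > 0" if "u \<noteq> 0" for u
  proof -
    have "lift c (chart_inv c z) u \<noteq> 0"
      using lift_self[OF ch[OF z], of u] that by (metis zero_fun_apply)
    then show ?thesis unfolding mco_def by (rule g_pos[OF top[OF z] lift_tangent])
  qed
  show "linear (coeff c z u)" for u by (rule coeff_linear[OF c z])
  show "coeff c z u v = coeff c z v u" for u v
  proof -
    have "der (\<lambda>y. lift c (chart_inv c y) w c) z = der (\<lambda>y. w) z" for w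
      by (rule der_cong_open[OF o z]) (simp add: ch)
    then have "lie_bracket M (\<lambda>q. lift c q u) (\<lambda>q. lift c q v) (chart_inv c z) c = 0"
      using ch[OF z] z by (simp add: lie_bracket_def)
    then show ?thesis
      using fun_cong[OF torsion_free[OF top[OF z] L[OF z, of u] L[OF z, of v]], of c]
      by (simp add: coeff_def)
  qed
  show "der (\<lambda>z. mco c z u v) z x = mco c z (coeff c z x u) v + mco c z u (coeff c z x v)" for u v x
    using metric_compatible[OF top[OF z] L[OF z, of u] L[OF z, of v] lift_tangent, of c x]
      dir_deriv_chart[OF ch[OF z] lift_tangent g_smooth[OF top[OF z] L[OF z, of u] L[OF z, of v]], of c x]
      nabla_lift[OF ch[OF z], of x] z ch[OF z]
    by (simp add: mco_def)
qed

text \<open>Read off from torsion-freeness, which avoids second derivatives of transition maps in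
  the transformation law of the bracket.\<close>

lemma lie_bracket_tangent:
  assumes p: "p \<in> topspace (mtop M)" and X: "smooth_field_at M p X" and Y: "smooth_field_at M p Y"
  shows "lie_bracket M X Y p \<in> tangent_space M p"
  unfolding torsion_free[OF p X Y, symmetric]
  by (intro subspace_diff[OF subspace_tangent] nabla_tangent p X Y smooth_field_at_tangent)

section \<open>Curvature and sectional curvature in a chart\<close>

definition cRm :: "('m, 'e) chart \<Rightarrow> 'e \<Rightarrow> 'e \<Rightarrow> 'e \<Rightarrow> 'e \<Rightarrow> 'e"
  where "cRm c = riem_patch.R (coeff c)"

definition cK :: "('m, 'e) chart \<Rightarrow> 'e \<Rightarrow> 'e \<Rightarrow> 'e \<Rightarrow> 'e \<Rightarrow> 'e \<Rightarrow> real"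
  where "cK c = riem_patch.K (mco c) (coeff c)"

text \<open>The right-hand side involves the fields only through their values at p; this
  tensoriality gives \<open>curvature\<close> its value.\<close>

lemma curvature_on_fields_coord:
  assumes c: "c \<in> charts_at M p"
    and X: "smooth_field_at M p X" and Y: "smooth_field_at M p Y" and Z: "smooth_field_at M p Z"
  shows "curvature_on_fields M nabla X Y Z p = lift c p (cRm c (snd c p) (X p c) (Y p c) (Z p c))"
proof (rule tangent_eqI[OF _ lift_tangent c])
  note p = in_topspace[OF c]
  have a: "c \<in> atlas M" "p \<in> fst c" using c by (auto simp: charts_at_iff)
  interpret P: riem_patch "snd c ` fst c" "mco c" "coeff c" by (rule patch[OF a(1)])
  have sm: "smooth_field_at M p (\<lambda>q. nabla q (V q) W)" if "smooth_field_at M p V" "smooth_field_at M p W" for V W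
    by (rule nabla_smooth[OF p that])
  note tg = smooth_field_at_tangent
  show "curvature_on_fields M nabla X Y Z p \<in> tangent_space M p"
    unfolding curvature_on_fields_def
    by (intro subspace_diff[OF subspace_tangent] nabla_tangent p sm X Y Z tg lie_bracket_tangent)
  define r where "r W y = W (chart_inv c y) c" for W :: "('m, 'e) field" and y
  let ?good = "\<lambda>W T. open T \<and> snd c p \<in> T \<and> T \<subseteq> snd c ` fst c \<and> smooth_on T (r W) \<and>
      (\<forall>y\<in>T. W (chart_inv c y) \<in> tangent_space M (chart_inv c y))"
  have ex: "\<exists>T. ?good W T" if "smooth_field_at M p W" for W
    by (rule smooth_field_atD[OF that c]) (auto simp: r_def[abs_def])
  obtain T1 T2 T3 where "?good X T1" "?good Y T2" "?good Z T3"
    using ex[OF X] ex[OF Y] ex[OF Z] by metis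
  then have good: "?good X (T1 \<inter> T2 \<inter> T3)" "?good Y (T1 \<inter> T2 \<inter> T3)" "?good Z (T1 \<inter> T2 \<inter> T3)"
    by (auto intro: smooth_on_subset)
  define T where "T = T1 \<inter> T2 \<inter> T3"
  have T: "open T" "snd c p \<in> T" "T \<subseteq> snd c ` fst c" using good(1) by (auto simp: T_def)
  have smT: "smooth_on T (r X)" "smooth_on T (r Y)" "smooth_on T (r Z)" using good by (auto simp: T_def)
  have tgT: "X (chart_inv c y) \<in> tangent_space M (chart_inv c y)"
    "Y (chart_inv c y) \<in> tangent_space M (chart_inv c y)" "Z (chart_inv c y) \<in> tangent_space M (chart_inv c y)"
    if "y \<in> T" for y using good that by (auto simp: T_def)
  have chT: "c \<in> charts_at M (chart_inv c y)" "snd c (chart_inv c y) = y" if "y \<in> T" for y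
    using that T(3) a by (auto simp: charts_at_iff)
  \<comment> \<open>The inner covariant derivative is taken at points near p, so smoothness of Z
    must be available at each of them.\<close>
  have ZT: "smooth_field_at M (chart_inv c y) Z" if "y \<in> T" for y
    by (rule smooth_field_atI[OF chT(1)[OF that] T(1)])
      (use that chT T smT(3) tgT(3) in \<open>auto simp: r_def[abs_def]\<close>)
  have 1: "nabla p (V p) (\<lambda>q. nabla q (W q) Z) c = P.cov (r V (snd c p)) (\<lambda>y. P.cov (r W y) (r Z) y) (snd c p)"
    if V: "smooth_field_at M p V" and W: "smooth_field_at M p W"
      "\<And>y. y \<in> T \<Longrightarrow> W (chart_inv c y) \<in> tangent_space M (chart_inv c y)" for V W
  proof -
    have eq: "nabla (chart_inv c y) (W (chart_inv c y)) Z c = P.cov (r W y) (r Z) y" if "y \<in> T" for y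
      using nabla_coord[OF chT(1)[OF that] W(2)[OF that] ZT[OF that]] chT(2)[OF that]
      by (simp add: P.cov_def r_def[abs_def])
    have "nabla p (V p) (\<lambda>q. nabla q (W q) Z) c
        = P.cov (r V (snd c p)) (\<lambda>y. nabla (chart_inv c y) (W (chart_inv c y)) Z c) (snd c p)"
      using nabla_coord[OF c tg[OF V] sm[OF W(1) Z]] a by (simp add: P.cov_def r_def)
    then show ?thesis
      using P.cov_cong[OF T(1,2) eq] by simp
  qed
  have 2: "nabla p (lie_bracket M X Y p) Z c
      = P.cov (der (r Y) (snd c p) (r X (snd c p)) - der (r X) (snd c p) (r Y (snd c p))) (r Z) (snd c p)"
    using nabla_coord[OF c lie_bracket_tangent[OF p X Y] Z] a c
    by (simp add: P.cov_def r_def[abs_def] lie_bracket_def)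
  show "curvature_on_fields M nabla X Y Z p c = lift c p (cRm c (snd c p) (X p c) (Y p c) (Z p c)) c"
    using P.ricci[OF T(1) T(3) T(2) smT] a c
    by (simp add: curvature_on_fields_def 1[OF X Y tgT(2)] 1[OF Y X tgT(1)] 2 cRm_def r_def)
qed

text \<open>All extensions give the same value, and the fields with constant coordinates show that
  extensions exist; together these resolve the definite description.\<close>

lemma curvature_coord:
  assumes c: "c \<in> charts_at M p"
    and x: "x \<in> tangent_space M p" and y: "y \<in> tangent_space M p" and z: "z \<in> tangent_space M p"
  shows "curvature M nabla p x y z = lift c p (cRm c (snd c p) (x c) (y c) (z c))"
  unfolding curvature_def
proof (rule the_equality)
  show "\<forall>X Y Z. smooth_field_at M p X \<and> smooth_field_at M p Y \<and> smooth_field_at M p Z \<and> X p = x \<and> Y p = y \<and> Z p = z \<longrightarrow>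
      curvature_on_fields M nabla X Y Z p = lift c p (cRm c (snd c p) (x c) (y c) (z c))"
    using curvature_on_fields_coord[OF c] by blast
  fix w
  assume w: "\<forall>X Y Z. smooth_field_at M p X \<and> smooth_field_at M p Y \<and> smooth_field_at M p Z \<and> X p = x \<and> Y p = y \<and> Z p = z \<longrightarrow>
      curvature_on_fields M nabla X Y Z p = w"
  let ?E = "\<lambda>v q. lift c q (v c)"
  have "curvature_on_fields M nabla (?E x) (?E y) (?E z) p = w"
    using w smooth_field_at_lift[OF c] tangent_eq_lift[OF x c] tangent_eq_lift[OF y c] tangent_eq_lift[OF z c] by blast
  then show "w = lift c p (cRm c (snd c p) (x c) (y c) (z c))"
    using curvature_on_fields_coord[OF c smooth_field_at_lift[OF c] smooth_field_at_lift[OF c] smooth_field_at_lift[OF c],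
        of "x c" "y c" "z c"] c by simp
qed

text \<open>Under a change of basis the numerator and the Gram determinant are both multiplied by
  the squared determinant, so the quotient depends on the plane alone.\<close>

lemma sectional_curvature_coord:
  assumes c: "c \<in> charts_at M p" and x: "x \<in> tangent_space M p" and y: "y \<in> tangent_space M p"
    and nz: "g p x x * g p y y - (g p x y)\<^sup>2 \<noteq> 0"
  shows "sectional_curvature M g nabla p (span {x, y})
    = cK c (snd c p) (x c) (y c) (y c) (x c) / (g p x x * g p y y - (g p x y)\<^sup>2)"
proof -
  have a: "c \<in> atlas M" "p \<in> fst c" using c by (auto simp: charts_at_iff)
  interpret P: riem_patch "snd c ` fst c" "mco c" "coeff c" by (rule patch[OF a(1)])
  let ?z = "snd c p"
  have z: "?z \<in> snd c ` fst c" using a by auto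
  let ?gram = "\<lambda>x y. g p x x * g p y y - (g p x y)\<^sup>2"
  let ?K = "\<lambda>x y. g p (curvature M nabla p x y y) x"
  have K: "?K x y = P.K ?z (x c) (y c) (y c) (x c)" if "x \<in> tangent_space M p" "y \<in> tangent_space M p" for x y
    unfolding curvature_coord[OF c that that(2)] g_coord[OF c lift_tangent that(1)]
    using c by (simp add: P.K_def cRm_def)
  have lin: "(\<alpha> *\<^sub>R x + \<beta> *\<^sub>R y) \<in> tangent_space M p"
    if "x \<in> tangent_space M p" "y \<in> tangent_space M p" for x y \<alpha> \<beta>
    by (intro subspace_add[OF subspace_tangent] subspace_scale[OF subspace_tangent] that)
  have gram_det: "?gram (\<alpha> *\<^sub>R x + \<beta> *\<^sub>R y) (\<gamma> *\<^sub>R x + \<delta> *\<^sub>R y) = (\<alpha> * \<delta> - \<beta> * \<gamma>)\<^sup>2 * ?gram x y"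
    if "x \<in> tangent_space M p" "y \<in> tangent_space M p" for x y \<alpha> \<beta> \<gamma> \<delta>
    unfolding g_coord[OF c lin[OF that] lin[OF that]] g_coord[OF c that(1,1)] g_coord[OF c that] g_coord[OF c that(2,2)]
    using P.G_sym[OF z, of "y c" "x c"]
    by (simp add: scaleR_fun_apply P.G_simps[OF z] power2_eq_square algebra_simps)
  have K_det: "?K (\<alpha> *\<^sub>R x + \<beta> *\<^sub>R y) (\<gamma> *\<^sub>R x + \<delta> *\<^sub>R y) = (\<alpha> * \<delta> - \<beta> * \<gamma>)\<^sup>2 * ?K x y"
    if "x \<in> tangent_space M p" "y \<in> tangent_space M p" for x y \<alpha> \<beta> \<gamma> \<delta>
  proof -
    let ?u = "x c" and ?v = "y c"
    have 1: "P.K ?z (\<alpha> *\<^sub>R ?u + \<beta> *\<^sub>R ?v) (\<gamma> *\<^sub>R ?u + \<delta> *\<^sub>R ?v) w t = (\<alpha> * \<delta> - \<beta> * \<gamma>) * P.K ?z ?u ?v w t" for w t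
      using P.K_antisym12[OF z, of ?u ?u w t] P.K_antisym12[OF z, of ?v ?v w t] P.K_antisym12[OF z, of ?v ?u w t]
      by (simp add: P.K_def P.R_simps[OF z] P.G_simps[OF z] algebra_simps)
    have 2: "P.K ?z s r (\<gamma> *\<^sub>R ?u + \<delta> *\<^sub>R ?v) (\<alpha> *\<^sub>R ?u + \<beta> *\<^sub>R ?v) = (\<alpha> * \<delta> - \<beta> * \<gamma>) * P.K ?z s r ?v ?u" for s r
      using P.K_antisym34[OF z, of s r ?u ?u] P.K_antisym34[OF z, of s r ?v ?v] P.K_antisym34[OF z, of s r ?u ?v]
      by (simp add: P.K_def P.R_simps[OF z] P.G_simps[OF z] algebra_simps)
    show ?thesis
      unfolding K[OF lin[OF that] lin[OF that]] K[OF that]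
      by (simp add: scaleR_fun_apply 1 2 power2_eq_square)
  qed
  show ?thesis
    unfolding sectional_curvature_def
  proof (rule the_equality)
    show "\<forall>x' y'. span {x', y'} = span {x, y} \<longrightarrow> cK c ?z (x c) (y c) (y c) (x c) / ?gram x y = ?K x' y' / ?gram x' y'"
    proof (intro allI impI)
      fix x' y' assume eq: "span {x', y'} = span {x, y}"
      have "x' \<in> span {x, y}" "y' \<in> span {x, y}"
        using eq span_base[of x' "{x', y'}"] span_base[of y' "{x', y'}"] by auto
      then obtain \<alpha> \<beta> \<gamma> \<delta> where 1: "x' = \<alpha> *\<^sub>R x + \<beta> *\<^sub>R y" "y' = \<gamma> *\<^sub>R x + \<delta> *\<^sub>R y"
        by (metis mem_span2E)
      have "x \<in> span {x', y'}" "y \<in> span {x', y'}"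
        unfolding eq by (simp_all add: span_base)
      then obtain \<alpha>' \<beta>' \<gamma>' \<delta>' where 2: "x = \<alpha>' *\<^sub>R x' + \<beta>' *\<^sub>R y'" "y = \<gamma>' *\<^sub>R x' + \<delta>' *\<^sub>R y'"
        by (metis mem_span2E)
      have mem: "x' \<in> tangent_space M p" "y' \<in> tangent_space M p"
        using 1 lin[OF x y] by auto
      have g': "?gram x' y' = (\<alpha> * \<delta> - \<beta> * \<gamma>)\<^sup>2 * ?gram x y"
        unfolding 1 by (rule gram_det[OF x y])
      \<comment> \<open>Expressing x, y through x', y' as well shows that the determinant is
        nonzero, since the Gram determinant of x, y is.\<close>
      have "?gram x y = (\<alpha>' * \<delta>' - \<beta>' * \<gamma>')\<^sup>2 * ?gram x' y'"
        using gram_det[OF mem, of \<alpha>' \<beta>' \<gamma>' \<delta>'] unfolding 2[symmetric] .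
      then have "(\<alpha> * \<delta> - \<beta> * \<gamma>)\<^sup>2 \<noteq> 0" using g' nz by auto
      moreover have "?K x' y' = (\<alpha> * \<delta> - \<beta> * \<gamma>)\<^sup>2 * ?K x y"
        unfolding 1 by (rule K_det[OF x y])
      ultimately show "cK c ?z (x c) (y c) (y c) (x c) / ?gram x y = ?K x' y' / ?gram x' y'"
        unfolding g' by (simp add: K[OF x y] cK_def)
    qed
    fix \<kappa> assume "\<forall>x' y'. span {x', y'} = span {x, y} \<longrightarrow> \<kappa> = ?K x' y' / ?gram x' y'"
    then show "\<kappa> = cK c ?z (x c) (y c) (y c) (x c) / ?gram x y"
      using K[OF x y] by (simp add: cK_def)
  qed
qed

end

lemma dim_span_pair:
  fixes x y :: "'a::real_vector"
  assumes "x \<noteq> 0" "\<And>r. y \<noteq> r *\<^sub>R x"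
  shows "dim (span {x, y}) = 2"
proof -
  have "y \<notin> span {x}" using assms(2) by (auto simp: span_singleton)
  moreover have "y \<noteq> x" using assms(2)[of 1] by simp
  ultimately have "independent {y, x}" using assms(1) by (simp add: independent_insert)
  then have "dim (span {y, x}) = card {y, x}" by (rule real_vector.dim_span_eq_card_independent)
  then show ?thesis using \<open>y \<noteq> x\<close> by (simp add: insert_commute)
qed

section \<open>Kaehler manifolds with a \<open>B\<^sub>0\<close>-distribution in coordinates\<close>

locale B0_mfd = riem_mfd M nabla g
  for M :: "('m, 'e::euclidean_space) manifold" and nabla and g +
  fixes J :: "'m \<Rightarrow> ('m, 'e) tangent \<Rightarrow> ('m, 'e) tangent"
    and D :: "'m \<Rightarrow> ('m, 'e) tangent set" and \<xi> :: "('m, 'e) field" and k ps a :: "'m \<Rightarrow> real"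
  assumes dim_ge: "6 \<le> DIM('e)"
    and kaehler: "kaehler_manifold M g J nabla"
    and distribution: "J_invariant_distribution M g J D \<xi>"
    and B0: "\<And>p. p \<in> topspace (mtop M) \<Longrightarrow> k p \<noteq> 0 \<and> (\<forall>x\<in>D p. nabla p x \<xi> = (k p / 2) *\<^sub>R x) \<and>
      nabla p (J p (\<xi> p)) \<xi> = - (ps p *\<^sub>R J p (\<xi> p)) \<and> nabla p (\<xi> p) \<xi> = 0"
    and hol: "holomorphic_curvature_on M g J nabla D a"
begin

lemma J_endo: "p \<in> topspace (mtop M) \<Longrightarrow> linear_between (tangent_space M p) (tangent_space M p) (J p)"
  and J_smooth_field: "p \<in> topspace (mtop M) \<Longrightarrow> smooth_field_at M p X \<Longrightarrow> smooth_field_at M p (\<lambda>q. J q (X q))"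
  and J_squared: "p \<in> topspace (mtop M) \<Longrightarrow> x \<in> tangent_space M p \<Longrightarrow> J p (J p x) = - x"
  and J_isometry: "p \<in> topspace (mtop M) \<Longrightarrow> x \<in> tangent_space M p \<Longrightarrow> y \<in> tangent_space M p \<Longrightarrow>
    g p (J p x) (J p y) = g p x y"
  and nabla_J: "p \<in> topspace (mtop M) \<Longrightarrow> v \<in> tangent_space M p \<Longrightarrow> smooth_field_at M p Y \<Longrightarrow>
    nabla p v (\<lambda>q. J q (Y q)) = J p (nabla p v Y)"
  using kaehler unfolding kaehler_manifold_def almost_hermitian_def smooth_endomorphism_field_def by blast+

lemma xi_smooth: "p \<in> topspace (mtop M) \<Longrightarrow> smooth_field_at M p \<xi>"
  and xi_unit: "p \<in> topspace (mtop M) \<Longrightarrow> g p (\<xi> p) (\<xi> p) = 1"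
  and subspace_D: "p \<in> topspace (mtop M) \<Longrightarrow> subspace (D p)"
  and D_tangent: "p \<in> topspace (mtop M) \<Longrightarrow> D p \<subseteq> tangent_space M p"
  and dim_D: "p \<in> topspace (mtop M) \<Longrightarrow> dim (D p) + 2 = DIM('e)"
  and J_D: "p \<in> topspace (mtop M) \<Longrightarrow> J p ` D p \<subseteq> D p"
  and D_complement: "p \<in> topspace (mtop M) \<Longrightarrow> orth_complement M g p (D p) = span {\<xi> p, J p (\<xi> p)}"
  using distribution unfolding J_invariant_distribution_def smooth_vector_field_def by blast+

lemma J_tangent: "p \<in> topspace (mtop M) \<Longrightarrow> x \<in> tangent_space M p \<Longrightarrow> J p x \<in> tangent_space M p"
  using J_endo unfolding linear_between_def by blast

lemma xi_tangent: "p \<in> topspace (mtop M) \<Longrightarrow> \<xi> p \<in> tangent_space M p"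
  by (rule smooth_field_at_tangent[OF xi_smooth])

definition jco :: "('m, 'e) chart \<Rightarrow> 'e \<Rightarrow> 'e \<Rightarrow> 'e"
  where "jco c y u = J (chart_inv c y) (lift c (chart_inv c y) u) c"

definition xco :: "('m, 'e) chart \<Rightarrow> 'e \<Rightarrow> 'e"
  where "xco c y = \<xi> (chart_inv c y) c"

lemma J_coord: "c \<in> charts_at M p \<Longrightarrow> x \<in> tangent_space M p \<Longrightarrow> J p x c = jco c (snd c p) (x c)"
  by (simp add: jco_def tangent_eq_lift charts_at_iff)

lemma xi_coord: "c \<in> charts_at M p \<Longrightarrow> \<xi> p c = xco c (snd c p)"
  by (simp add: xco_def charts_at_iff)

lemma smooth_coord_field:
  assumes c: "c \<in> atlas M" and X: "\<And>p. p \<in> fst c \<Longrightarrow> smooth_field_at M p X"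
  shows "smooth_on (snd c ` fst c) (\<lambda>y. X (chart_inv c y) c)"
proof (rule smooth_on_local[OF chart_image_open[OF c]])
  fix y assume y: "y \<in> snd c ` fst c"
  then have ch: "c \<in> charts_at M (chart_inv c y)" using c by (auto simp: charts_at_iff)
  have "smooth_field_at M (chart_inv c y) X" using X ch by (simp add: charts_at_iff)
  then obtain T where "open T" "snd c (chart_inv c y) \<in> T" "smooth_on T (\<lambda>y. X (chart_inv c y) c)"
    by (rule smooth_field_atD[OF _ ch]) (rule that)
  then show "\<exists>T. open T \<and> y \<in> T \<and> smooth_on T (\<lambda>y. X (chart_inv c y) c)"
    using y by (intro exI[of _ T]) simp
qed

lemma patch_kaehler:
  assumes c: "c \<in> atlas M"
  shows "kaehler_patch (snd c ` fst c) (mco c) (coeff c) (jco c)"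
proof (rule kaehler_patch.intro[OF patch[OF c]], rule kaehler_patch_axioms.intro)
  let ?S = "snd c ` fst c"
  have ch: "c \<in> charts_at M p" if "p \<in> fst c" for p using that c by (simp add: charts_at_iff)
  show "smooth_on ?S (\<lambda>z. jco c z u)" for u
    unfolding jco_def
    by (rule smooth_coord_field[OF c]) (intro J_smooth_field in_topspace[OF ch] smooth_field_at_lift ch)
  fix z assume z: "z \<in> ?S"
  then obtain p where p: "p \<in> fst c" "z = snd c p" by auto
  note chp = ch[OF p(1)] and top = in_topspace[OF ch[OF p(1)]]
  have zi: "chart_inv c z = p" using c p by simp
  note Jlin = J_endo[OF top, unfolded linear_between_def]
  show "linear (jco c z)"
  proof (rule linearI)
    show "jco c z (u + v) = jco c z u + jco c z v" for u v
      using Jlin by (simp add: jco_def zi linear_add[OF linear_lift] lift_tangent)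
    show "jco c z (r *\<^sub>R u) = r *\<^sub>R jco c z u" for r u
      using Jlin by (simp add: jco_def zi linear_scale[OF linear_lift] lift_tangent scaleR_fun_apply)
  qed
  have Jl: "J p (lift c p u) c = jco c z u" for u by (simp add: jco_def zi)
  have Jt: "J p (lift c p u) \<in> tangent_space M p" for u by (rule J_tangent[OF top lift_tangent])
  show "jco c z (jco c z u) = - u" for u
    using J_coord[OF chp Jt, of u] J_squared[OF top lift_tangent, of c u] chp
    by (simp add: Jl p(2)[symmetric])
  show "mco c z (jco c z u) (jco c z v) = mco c z u v" for u v
    using J_isometry[OF top lift_tangent lift_tangent, of c u c v] chp
    unfolding g_coord[OF chp Jt Jt] g_coord[OF chp lift_tangent lift_tangent] by (simp add: Jl p(2)[symmetric])
  note L = smooth_field_at_lift[OF chp]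
  show "der (\<lambda>z. jco c z w) z x + coeff c z x (jco c z w) = jco c z (coeff c z x w)" for w x
  proof -
    have "nabla p (lift c p x) (\<lambda>q. J q (lift c q w)) c = J p (lift c p (coeff c z x w)) c"
      using nabla_J[OF top lift_tangent L, of c x w] nabla_lift[OF chp, of x w] p(2) by simp
    moreover have "nabla p (lift c p x) (\<lambda>q. J q (lift c q w)) c
        = der (\<lambda>z. jco c z w) z x + coeff c z x (jco c z w)"
      using nabla_coord[OF chp lift_tangent[of c p x] J_smooth_field[OF top L, of w]] chp
      by (simp add: jco_def zi p(2)[symmetric])
    ultimately show ?thesis by (simp add: Jl)
  qed
qed

text \<open>D is given through its codimension and its orthogonal complement; that it is conversely
  the complement of \<xi> and J\<xi> is a dimension count. The count takes place in a chart because
  tangent vectors are functions and not elements of a Euclidean space.\<close>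

lemma D_iff:
  assumes top: "p \<in> topspace (mtop M)" and x: "x \<in> tangent_space M p"
  shows "x \<in> D p \<longleftrightarrow> g p x (\<xi> p) = 0 \<and> g p x (J p (\<xi> p)) = 0"
proof -
  define c where "c = chart_at M p"
  have c: "c \<in> charts_at M p" unfolding c_def by (rule chart_at[OF top])
  then have a: "c \<in> atlas M" "p \<in> fst c" by (auto simp: charts_at_iff)
  let ?z = "snd c p"
  have z: "?z \<in> snd c ` fst c" using a by auto
  interpret P: kaehler_patch "snd c ` fst c" "mco c" "coeff c" "jco c" by (rule patch_kaehler[OF a(1)])
  note xt = xi_tangent[OF top] and Jxt = J_tangent[OF top xi_tangent[OF top]]
  define x1 where "x1 = xco c ?z"
  define x2 where "x2 = jco c ?z x1"
  have x1: "\<xi> p c = x1" by (simp add: x1_def xi_coord[OF c])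
  have x2: "J p (\<xi> p) c = x2" by (simp add: x2_def J_coord[OF c xt] x1)
  have n: "mco c ?z x1 x1 = 1" "mco c ?z x2 x2 = 1" "mco c ?z x1 x2 = 0" "mco c ?z x2 x1 = 0"
    using xi_unit[OF top] P.G_J_J[OF z] P.G_J_self[OF z, of x1] P.G_sym[OF z, of x1 x2]
    by (auto simp: g_coord[OF c xt xt] x1 x2_def)
  have sub: "g p y (\<xi> p) = 0 \<and> g p y (J p (\<xi> p)) = 0" if "y \<in> D p" for y
  proof -
    have "\<xi> p \<in> orth_complement M g p (D p)" "J p (\<xi> p) \<in> orth_complement M g p (D p)"
      unfolding D_complement[OF top] by (auto simp: span_base)
    then have "g p (\<xi> p) y = 0" "g p (J p (\<xi> p)) y = 0"
      using that unfolding orth_complement_def by blast+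
    moreover have "y \<in> tangent_space M p" using that D_tangent[OF top] by blast
    ultimately show ?thesis
      using g_sym[OF top xt, of y] g_sym[OF top Jxt, of y] by simp
  qed
  define W where "W = {u. mco c ?z u x1 = 0 \<and> mco c ?z u x2 = 0}"
  define Dc where "Dc = (\<lambda>v. v c) ` D p"
  have lin: "linear (\<lambda>v::('m, 'e) tangent. v c)" by (rule linearI) (auto simp: scaleR_fun_apply)
  have sW: "subspace W" unfolding W_def by (rule subspaceI) (auto simp: P.G_simps[OF z])
  have sDc: "subspace Dc" unfolding Dc_def by (rule linear_subspace_image[OF lin subspace_D[OF top]])
  have DW: "Dc \<subseteq> W"
    using sub D_tangent[OF top] by (auto simp: Dc_def W_def g_coord[OF c _ xt] g_coord[OF c _ Jxt] x1 x2 subset_iff)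
  have "dim W + 2 \<le> DIM('e)"
  proof -
    have "x2 \<noteq> r *\<^sub>R x1" for r
    proof
      assume e: "x2 = r *\<^sub>R x1"
      then have "r = 0" using n(1,3) by (simp add: P.G_simps[OF z])
      then show False using e n(2) by (simp add: P.G_simps[OF z])
    qed
    moreover have "x1 \<noteq> 0" using n(1) P.G_simps[OF z] by auto
    ultimately have d2: "dim (span {x1, x2}) = 2" by (intro dim_span_pair)
    have "u = 0" if "u \<in> W" "u \<in> span {x1, x2}" for u
    proof -
      obtain \<alpha> \<beta> where u: "u = \<alpha> *\<^sub>R x1 + \<beta> *\<^sub>R x2"
        using \<open>u \<in> span {x1, x2}\<close> span_breakdown_eq[of u x1 "{x2}"]
        by (auto simp: span_singleton algebra_simps diff_eq_eq)
      then show "u = 0" using that(1) by (simp add: W_def P.G_simps[OF z] n)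
    qed
    then have "W \<inter> span {x1, x2} \<subseteq> {0}" by blast
    then have d0: "dim (W \<inter> span {x1, x2}) = 0" by (simp only: dim_eq_0)
    have "dim {x + y |x y. x \<in> W \<and> y \<in> span {x1, x2}} = dim W + 2"
      using dim_sums_Int[OF sW subspace_span, of "{x1, x2}"] unfolding d2 d0 by simp
    then show ?thesis
      using dim_subset_UNIV[of "{x + y |x y. x \<in> W \<and> y \<in> span {x1, x2}}"] by simp
  qed
  \<comment> \<open>Evaluation at the chart c is injective on tangent vectors, so a basis of
    \<open>D p\<close> stays independent.\<close>
  moreover have "dim (D p) \<le> dim Dc"
  proof -
    obtain B where B: "B \<subseteq> D p" "independent B" "D p \<subseteq> span B" "card B = dim (D p)"
      by (rule real_vector.basis_exists)
    have "span B \<subseteq> D p" by (rule span_minimal[OF B(1) subspace_D[OF top]])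
    then have inj: "inj_on (\<lambda>v. v c) (span B)"
      using D_tangent[OF top] tangent_eqI[OF _ _ c] by (intro inj_onI) blast
    have "independent ((\<lambda>v. v c) ` B)"
      by (rule linear_independent_injective_image[OF lin B(2) inj])
    moreover have "card ((\<lambda>v. v c) ` B) = card B"
      by (rule card_image[OF inj_on_subset[OF inj span_superset]])
    ultimately show ?thesis
      using independent_card_le_dim[of "(\<lambda>v. v c) ` B" Dc] B(1,4) by (auto simp: Dc_def)
  qed
  ultimately have "dim W \<le> dim Dc" using dim_D[OF top] by linarith
  then have "Dc = W" by (rule subspace_dim_equal[OF sDc sW DW])
  show ?thesis
  proof
    assume "g p x (\<xi> p) = 0 \<and> g p x (J p (\<xi> p)) = 0"
    then have "x c \<in> W" by (simp add: W_def g_coord[OF c x xt] g_coord[OF c x Jxt] x1 x2)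
    then obtain y where y: "y \<in> D p" "x c = y c" using \<open>Dc = W\<close> by (auto simp: Dc_def)
    then have "x = y" using tangent_eqI[OF x _ c] D_tangent[OF top] by blast
    then show "x \<in> D p" using y by simp
  qed (rule sub)
qed

lemma patch_B0:
  assumes c: "c \<in> atlas M"
  shows "B0_patch (snd c ` fst c) (mco c) (coeff c) (jco c) (xco c)
    (\<lambda>y. k (chart_inv c y)) (\<lambda>y. ps (chart_inv c y)) (\<lambda>y. a (chart_inv c y))"
proof (rule B0_patch.intro[OF patch_kaehler[OF c]], rule B0_patch_axioms.intro)
  let ?S = "snd c ` fst c"
  interpret P: kaehler_patch ?S "mco c" "coeff c" "jco c" by (rule patch_kaehler[OF c])
  have ch: "c \<in> charts_at M p" if "p \<in> fst c" for p using that c by (simp add: charts_at_iff)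
  show "6 \<le> DIM('e)" by (rule dim_ge)
  show "smooth_on ?S (xco c)"
    unfolding xco_def[abs_def] by (rule smooth_coord_field[OF c]) (intro xi_smooth in_topspace[OF ch])
  fix z assume z: "z \<in> ?S"
  then obtain p where p: "p \<in> fst c" "z = snd c p" by auto
  note chp = ch[OF p(1)] and top = in_topspace[OF ch[OF p(1)]]
  have zi: "chart_inv c z = p" using c p by simp
  note xt = xi_tangent[OF top] and Jxt = J_tangent[OF top xi_tangent[OF top]]
  have xz: "\<xi> p c = xco c z" "J p (\<xi> p) c = jco c z (xco c z)"
    using xi_coord[OF chp] J_coord[OF chp xt] p(2) by simp_all
  show "mco c z (xco c z) (xco c z) = 1"
    using xi_unit[OF top] by (simp add: g_coord[OF chp xt xt] xz p(2)[symmetric])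
  show "k (chart_inv c z) \<noteq> 0" using B0[OF top] by (simp add: zi)
  have nab: "nabla p v \<xi> c = P.cov (v c) (xco c) z" if "v \<in> tangent_space M p" for v
    using nabla_coord[OF chp that xi_smooth[OF top]]
    by (simp add: P.cov_def xco_def[abs_def] p(2)[symmetric] zi)
  have inD: "lift c p u \<in> D p" if "mco c z u (xco c z) = 0" "mco c z u (jco c z (xco c z)) = 0" for u
    using that chp by (simp add: D_iff[OF top lift_tangent] g_coord[OF chp lift_tangent xt]
        g_coord[OF chp lift_tangent Jxt] xz p(2)[symmetric])
  show "P.cov (jco c z (xco c z)) (xco c) z = - (ps (chart_inv c z) *\<^sub>R jco c z (xco c z))"
    using B0[OF top] nab[OF Jxt] xz by (simp add: zi scaleR_fun_apply)
  show "P.cov (xco c z) (xco c) z = 0"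
    using B0[OF top] nab[OF xt] xz by simp
  fix u assume u: "mco c z u (xco c z) = 0" "mco c z u (jco c z (xco c z)) = 0"
  note uD = inD[OF u]
  have "nabla p (lift c p u) \<xi> = (k p / 2) *\<^sub>R lift c p u" using B0[OF top] uD by blast
  then show "P.cov u (xco c) z = (k (chart_inv c z) / 2) *\<^sub>R u"
    using nab[OF lift_tangent, of c u] chp by (simp add: zi scaleR_fun_apply)
  show "P.K z u (jco c z u) (jco c z u) u = a (chart_inv c z) * (mco c z u u)\<^sup>2"
  \<comment> \<open>For u = 0 there is no plane to evaluate and both sides vanish; otherwise u and
    Ju span a holomorphic plane in D whose Gram determinant is the squared square length of
    u.\<close>
  proof (cases "u = 0")
    case True
    then show ?thesis using z by (simp add: P.K_def P.G_simps)
  next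
    case False
    let ?x = "lift c p u" and ?y = "J p (lift c p u)"
    have xt': "?x \<in> tangent_space M p" by (rule lift_tangent)
    have yt: "?y \<in> tangent_space M p" by (rule J_tangent[OF top xt'])
    have yD: "?y \<in> D p" using uD J_D[OF top] by blast
    have cx: "?x c = u" using chp by simp
    have cy: "?y c = jco c z u" using J_coord[OF chp xt'] cx p(2) by simp
    have gg: "g p ?x ?x = mco c z u u" "g p ?y ?y = mco c z u u" "g p ?x ?y = 0"
      using J_isometry[OF top xt' xt'] P.G_J_self[OF z, of u]
      by (simp_all add: g_coord[OF chp xt' xt'] g_coord[OF chp xt' yt] cx cy p(2)[symmetric])
    have Gp: "mco c z u u > 0" by (rule P.G_pos[OF z False])
    have ne: "?x \<noteq> 0" "?y \<noteq> r *\<^sub>R ?x" for r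
    proof -
      show "?x \<noteq> 0" using cx False by (metis zero_fun_apply)
      show "?y \<noteq> r *\<^sub>R ?x"
      proof
        assume e: "?y = r *\<^sub>R ?x"
        then have j: "jco c z u = r *\<^sub>R u" using cx cy by (metis scaleR_fun_apply)
        then have "r * mco c z u u = 0" using P.G_J_self[OF z, of u] by (simp add: P.G_simps[OF z])
        then have "jco c z u = 0" using j Gp by simp
        then show False using P.G_J_J[OF z, of u u] Gp by (simp add: P.G_simps[OF z])
      qed
    qed
    have sub: "span {?x, ?y} \<subseteq> D p"
      by (rule span_minimal[OF _ subspace_D[OF top]]) (use uD yD in auto)
    have "J p v \<in> span {?x, ?y}" if v': "v \<in> span {?x, ?y}" for v
    proof -
      obtain \<alpha> \<beta> where v: "v = \<alpha> *\<^sub>R ?x + \<beta> *\<^sub>R ?y" by (rule mem_span2E[OF v'])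
      have tt: "\<alpha> *\<^sub>R ?x \<in> tangent_space M p" "\<beta> *\<^sub>R ?y \<in> tangent_space M p"
        by (intro subspace_scale[OF subspace_tangent] xt' yt)+
      have "J p v = \<alpha> *\<^sub>R ?y + \<beta> *\<^sub>R J p ?y"
        using J_endo[OF top] tt xt' yt unfolding v linear_between_def by metis
      also have "\<dots> = \<alpha> *\<^sub>R ?y + \<beta> *\<^sub>R (- ?x)" by (simp only: J_squared[OF top xt'])
      also have "\<dots> \<in> span {?x, ?y}"
        by (intro span_add span_scale span_neg span_base) auto
      finally show ?thesis .
    qed
    then have "holomorphic_plane M J p (span {?x, ?y})"
      using sub D_tangent[OF top] dim_span_pair[OF ne]
      by (auto simp: holomorphic_plane_def tangent_plane_def)
    then have "sectional_curvature M g nabla p (span {?x, ?y}) = a p"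
      using hol top sub unfolding holomorphic_curvature_on_def by blast
    moreover have "g p ?x ?x * g p ?y ?y - (g p ?x ?y)\<^sup>2 = (mco c z u u)\<^sup>2"
      by (simp add: gg power2_eq_square)
    moreover have "(mco c z u u)\<^sup>2 \<noteq> 0" using Gp by simp
    ultimately have "a p = cK c z u (jco c z u) (jco c z u) u / (mco c z u u)\<^sup>2"
      using sectional_curvature_coord[OF chp xt' yt] 
      by (simp only: cx cy p(2)[symmetric] not_False_eq_True simp_thms)
    then show ?thesis using Gp by (simp add: cK_def zi)
  qed
qed

end

lemma (in riem_patch) riem_patch_subset:
  assumes "open T" "T \<subseteq> S"
  shows "riem_patch T G \<Gamma>"
  by (rule riem_patch.intro)
    (use assms G_linear G_sym G_pos \<Gamma>_linear \<Gamma>_sym G_parallel in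
      \<open>auto intro: smooth_on_subset[OF G_smooth] smooth_on_subset[OF \<Gamma>_smooth]\<close>)

section \<open>Integral submanifolds of \<open>\<xi>\<^sup>\<bottom>\<close>\<close>

locale B0_hypersurface = B0_mfd M nabla g J D \<xi> k ps a
  for M :: "('m, 'e::euclidean_space) manifold" and nabla g J D \<xi> k ps a +
  fixes Q :: "('m, 'f::euclidean_space) manifold" and nablaQ :: "('m, 'f) connection"
  assumes integral: "integral_submanifold Q M (orth_distribution M g \<xi>)"
    and levi_civita_Q: "levi_civita_connection Q (induced_metric Q M g) nablaQ"
begin

abbreviation \<iota> :: "'m \<Rightarrow> ('m, 'f) tangent \<Rightarrow> ('m, 'e) tangent"
  where "\<iota> p \<equiv> differential Q M (\<lambda>p. p) p"

lemma smooth_Q: "smooth_manifold Q"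
  and smooth_inclusion: "smooth_map Q M (\<lambda>p. p)"
  and \<iota>_inj: "p \<in> topspace (mtop Q) \<Longrightarrow> inj_on (\<iota> p) (tangent_space Q p)"
  and \<iota>_image: "p \<in> topspace (mtop Q) \<Longrightarrow> \<iota> p ` tangent_space Q p = orth_distribution M g \<xi> p"
  and connected_Q: "connected_space (mtop Q)"
  using integral unfolding integral_submanifold_def immersed_submanifold_def by blast+

sublocale Q0: mfd Q
  by (rule mfd.intro) (rule smooth_Q)

sublocale Q1: mfd_connection Q nablaQ
  by (rule mfd_connection.intro[OF Q0.mfd_axioms], rule mfd_connection_axioms.intro)
    (use levi_civita_Q in \<open>simp add: levi_civita_connection_def\<close>)

lemma Q_top: "p \<in> topspace (mtop Q) \<Longrightarrow> p \<in> topspace (mtop M)"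
  using smooth_inclusion unfolding smooth_map_def by (auto dest: continuous_map_image_subset_topspace)

section \<open>The inclusion of the submanifold in charts\<close>

definition dom :: "('m, 'f) chart \<Rightarrow> ('m, 'e) chart \<Rightarrow> 'f set"
  where "dom c d = snd c ` (fst c \<inter> fst d)"

definition inc :: "('m, 'f) chart \<Rightarrow> ('m, 'e) chart \<Rightarrow> 'f \<Rightarrow> 'e"
  where "inc c d y = snd d (chart_inv c y)"

text \<open>The submanifold has its own, possibly finer topology, so openness is derived from
  continuity of the inclusion.\<close>

lemma dom_open:
  assumes c: "c \<in> atlas Q" and d: "d \<in> atlas M"
  shows "open (dom c d)"
proof -
  have "openin (mtop Q) {p \<in> topspace (mtop Q). p \<in> fst d}"
    using smooth_inclusion chart_openin[OF d] unfolding smooth_map_def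
    by (auto dest: openin_continuous_map_preimage)
  then have "openin (mtop Q) (fst c \<inter> {p \<in> topspace (mtop Q). p \<in> fst d})"
    by (intro openin_Int Q0.chart_openin[OF c])
  moreover have "fst c \<inter> {p \<in> topspace (mtop Q). p \<in> fst d} = fst c \<inter> fst d"
    using openin_subset[OF Q0.chart_openin[OF c]] by auto
  ultimately show ?thesis
    unfolding dom_def by (intro Q0.chart_image_openin[OF c]) auto
qed

lemma dom_subset: "dom c d \<subseteq> snd c ` fst c"
  by (auto simp: dom_def)

lemma inc_smooth:
  assumes c: "c \<in> atlas Q" and d: "d \<in> atlas M"
  shows "smooth_on (dom c d) (inc c d)"
proof -
  have "smooth_on (snd c ` {p \<in> fst c. p \<in> fst d}) (snd d \<circ> (\<lambda>p. p) \<circ> chart_inv c)"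
    using smooth_inclusion c d unfolding smooth_map_def by blast
  moreover have "{p \<in> fst c. p \<in> fst d} = fst c \<inter> fst d" by auto
  ultimately show ?thesis by (simp add: dom_def inc_def[abs_def] comp_def)
qed

lemma inc_in: "c \<in> atlas Q \<Longrightarrow> y \<in> dom c d \<Longrightarrow> inc c d y \<in> snd d ` fst d"
  by (auto simp: dom_def inc_def)

lemma dom_charts:
  assumes "c \<in> atlas Q" "d \<in> atlas M" "y \<in> dom c d"
  shows "c \<in> charts_at Q (chart_inv c y)" "d \<in> charts_at M (chart_inv c y)" "snd c (chart_inv c y) = y"
    "chart_inv d (inc c d y) = chart_inv c y" "chart_inv c y \<in> topspace (mtop Q)"
proof -
  obtain p where p: "p \<in> fst c" "p \<in> fst d" "y = snd c p" using assms(3) by (auto simp: dom_def)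
  then show "c \<in> charts_at Q (chart_inv c y)" "d \<in> charts_at M (chart_inv c y)" "snd c (chart_inv c y) = y"
    "chart_inv d (inc c d y) = chart_inv c y"
    using assms(1,2) by (auto simp: charts_at_iff Q0.charts_at_iff inc_def)
  then show "chart_inv c y \<in> topspace (mtop Q)" using Q0.in_topspace by blast
qed

lemma in_dom:
  assumes "c \<in> charts_at Q p" "d \<in> charts_at M p"
  shows "snd c p \<in> dom c d" "inc c d (snd c p) = snd d p" "chart_inv c (snd c p) = p"
  using assms by (auto simp: dom_def inc_def charts_at_iff Q0.charts_at_iff)

lemma inc_has_derivative:
  assumes "c \<in> charts_at Q p" "d \<in> charts_at M p"
  shows "(inc c d has_derivative der (inc c d) (snd c p)) (at (snd c p))"
  using assms by (intro smooth_on_imp_has_derivative[OF dom_open inc_smooth in_dom(1)])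
    (auto simp: charts_at_iff Q0.charts_at_iff)

lemma inc_comp: "inc c d = snd d \<circ> chart_inv c"
  by (simp add: inc_def fun_eq_iff)

lemma \<iota>_chart:
  assumes c: "c \<in> charts_at Q p" and d: "d \<in> charts_at M p" and v: "v \<in> tangent_space Q p"
  shows "\<iota> p v d = der (inc c d) (snd c p) (v c)"
proof -
  note cat = Q0.chart_at[OF Q0.in_topspace[OF c]]
  have "(snd d \<circ> chart_inv c) differentiable at (snd c p)"
    using inc_has_derivative[OF c d] unfolding inc_comp by (rule differentiableI)
  from Q0.der_chart_change[OF cat c v this] show ?thesis
    using d by (simp add: differential_def Let_def inc_comp comp_def)
qed

text \<open>Linear on all functions on charts, not only on tangent vectors, because
  \<open>differential\<close> merely evaluates its argument at one fixed chart.\<close>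

lemma linear_\<iota>:
  assumes p: "p \<in> topspace (mtop Q)"
  shows "linear (\<iota> p)"
proof -
  note cat = Q0.chart_at[OF p]
  have lin: "linear (der (snd d \<circ> (\<lambda>p. p) \<circ> chart_inv (chart_at Q p)) (snd (chart_at Q p) p))"
    if "d \<in> charts_at M p" for d
    using has_derivative_linear[OF inc_has_derivative[OF cat that]] by (simp add: inc_comp comp_def)
  show ?thesis
    by (rule linearI; rule ext; simp add: differential_def Let_def scaleR_fun_apply
        linear_add[OF lin] linear_scale[OF lin])
qed

lemma \<iota>_mem:
  assumes p: "p \<in> topspace (mtop Q)" and x: "x \<in> tangent_space Q p"
  shows "\<iota> p x \<in> tangent_space M p" "g p (\<xi> p) (\<iota> p x) = 0"
  using \<iota>_image[OF p] x unfolding orth_distribution_def by blast+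

lemma as_tangent_mem:
  assumes p: "p \<in> topspace (mtop Q)" and X: "X \<in> tangent_space M p" "g p (\<xi> p) X = 0"
  shows "as_tangent Q M p X \<in> tangent_space Q p" "\<iota> p (as_tangent Q M p X) = X"
proof -
  have "X \<in> \<iota> p ` tangent_space Q p"
    unfolding \<iota>_image[OF p] orth_distribution_def using X by simp
  then show "as_tangent Q M p X \<in> tangent_space Q p" "\<iota> p (as_tangent Q M p X) = X"
    unfolding as_tangent_def by (rule inv_into_into, rule f_inv_into_f)
qed

lemma tangent_Q_eqI:
  assumes p: "p \<in> topspace (mtop Q)" and "x \<in> tangent_space Q p" "y \<in> tangent_space Q p"
    and d: "d \<in> charts_at M p" "\<iota> p x d = \<iota> p y d"
  shows "x = y"
proof -
  have "\<iota> p x = \<iota> p y"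
    by (rule tangent_eqI[OF \<iota>_mem(1)[OF p assms(2)] \<iota>_mem(1)[OF p assms(3)] d])
  then show ?thesis by (rule inj_onD[OF \<iota>_inj[OF p] _ assms(2,3)])
qed

abbreviation "gQ \<equiv> induced_metric Q M g"

lemma gQ_coord:
  assumes "c \<in> charts_at Q p" "d \<in> charts_at M p" "x \<in> tangent_space Q p" "y \<in> tangent_space Q p"
  shows "gQ p x y = mco d (snd d p) (\<iota> p x d) (\<iota> p y d)"
  unfolding induced_metric_def
  by (rule g_coord[OF assms(2) \<iota>_mem(1)[OF _ assms(3)] \<iota>_mem(1)[OF _ assms(4)]]) (rule Q0.in_topspace[OF assms(1)])+

lemma smooth_on_G_inc:
  assumes c: "c \<in> atlas Q" and d: "d \<in> atlas M" and T: "open T" "T \<subseteq> dom c d"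
    and X: "smooth_on T X" and Y: "smooth_on T Y"
  shows "smooth_on T (\<lambda>y. mco d (inc c d y) (X y) (Y y))"
proof -
  interpret P: riem_patch "snd d ` fst d" "mco d" "coeff d" by (rule patch[OF d])
  have i: "inc c d y \<in> snd d ` fst d" if "y \<in> T" for y using inc_in[OF c] that T(2) by blast
  have sm: "smooth_on T (\<lambda>y. mco d (inc c d y) u v)" for u v
    by (rule smooth_on_compose[OF T(1) P.open_S _ smooth_on_subset[OF inc_smooth[OF c d] T(2)] P.G_smooth])
      (use i in auto)
  show ?thesis
    by (rule smooth_on_family2[OF T(1) P.G_linear_left[OF i] P.G_linear[OF i] sm X Y])
qed

lemma smooth_on_der_inc:
  assumes c: "c \<in> atlas Q" and d: "d \<in> atlas M" and T: "open T" "T \<subseteq> dom c d" and X: "smooth_on T X"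
  shows "smooth_on T (\<lambda>y. der (inc c d) y (X y))"
proof (rule smooth_on_family[OF T(1) _ _ X])
  show "linear (der (inc c d) y)" if "y \<in> T" for y
    using that T(2) by (intro linear_der[OF dom_open[OF c d] inc_smooth[OF c d]]) auto
  show "smooth_on T (\<lambda>y. der (inc c d) y b)" for b
    by (rule smooth_on_subset[OF smooth_on_der[OF inc_smooth[OF c d]] T(2)])
qed

lemma obtain_charts:
  assumes "p \<in> topspace (mtop Q)"
  obtains c d where "c \<in> charts_at Q p" "d \<in> charts_at M p" "c \<in> atlas Q" "d \<in> atlas M"
  using that[OF Q0.chart_at[OF assms] chart_at[OF Q_top[OF assms]]] Q0.chart_at[OF assms]
    chart_at[OF Q_top[OF assms]] Q0.charts_at_iff charts_at_iff by blast

lemma field_on_dom: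
  assumes X: "smooth_field_at Q p X" and c: "c \<in> charts_at Q p" and d: "d \<in> charts_at M p"
  obtains T where "open T" "snd c p \<in> T" "T \<subseteq> dom c d" "smooth_on T (\<lambda>y. X (chart_inv c y) c)"
    "\<And>y. y \<in> T \<Longrightarrow> X (chart_inv c y) \<in> tangent_space Q (chart_inv c y)"
proof -
  obtain T where T: "open T" "snd c p \<in> T" "smooth_on T (\<lambda>y. X (chart_inv c y) c)"
    "\<And>y. y \<in> T \<Longrightarrow> X (chart_inv c y) \<in> tangent_space Q (chart_inv c y)"
    by (rule Q0.smooth_field_atD[OF X c]) (rule that)
  have o: "open (dom c d)" using c d by (intro dom_open) (auto simp: charts_at_iff Q0.charts_at_iff)
  show ?thesis
    by (rule that[of "T \<inter> dom c d"])
      (use T o in_dom(1)[OF c d] smooth_on_subset[OF T(3), of "T \<inter> dom c d"] in auto)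
qed

lemma \<iota>_on_dom:
  assumes c: "c \<in> atlas Q" and d: "d \<in> atlas M" and y: "y \<in> dom c d" and v: "v \<in> tangent_space Q (chart_inv c y)"
  shows "\<iota> (chart_inv c y) v d = der (inc c d) y (v c)"
  using \<iota>_chart[OF dom_charts(1,2)[OF c d y] v] dom_charts(3)[OF c d y] by simp

section \<open>The induced metric\<close>

lemma riemannian_gQ: "riemannian_metric Q gQ"
  unfolding riemannian_metric_def
proof (intro ballI conjI allI impI)
  fix p assume p: "p \<in> topspace (mtop Q)"
  note top = Q_top[OF p] and lin = linear_\<iota>[OF p]
  show "linear_between (tangent_space Q p) UNIV (gQ p x)" if x: "x \<in> tangent_space Q p" for x
    using g_linear[OF top \<iota>_mem(1)[OF p x]] \<iota>_mem(1)[OF p]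
    by (auto simp: linear_between_def induced_metric_def linear_add[OF lin] linear_scale[OF lin])
  show "gQ p x y = gQ p y x" if "x \<in> tangent_space Q p" "y \<in> tangent_space Q p" for x y
    unfolding induced_metric_def by (intro g_sym top \<iota>_mem p that)
  show "0 < gQ p x x" if x: "x \<in> tangent_space Q p" "x \<noteq> 0" for x
  proof -
    have "\<iota> p x \<noteq> \<iota> p 0"
      using inj_onD[OF \<iota>_inj[OF p] _ x(1) subspace_0[OF Q0.subspace_tangent]] x(2) by blast
    then have "\<iota> p x \<noteq> 0" by (simp only: linear_0[OF lin] not_False_eq_True)
    then show ?thesis
      unfolding induced_metric_def by (rule g_pos[OF top \<iota>_mem(1)[OF p x(1)]])
  qed
  fix X Y assume X: "smooth_field_at Q p X" and Y: "smooth_field_at Q p Y"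
  obtain c d where c: "c \<in> charts_at Q p" "c \<in> atlas Q" and d: "d \<in> charts_at M p" "d \<in> atlas M"
    by (rule obtain_charts[OF p]) (rule that)
  obtain T1 where T1: "open T1" "snd c p \<in> T1" "T1 \<subseteq> dom c d" "smooth_on T1 (\<lambda>y. X (chart_inv c y) c)"
    "\<And>y. y \<in> T1 \<Longrightarrow> X (chart_inv c y) \<in> tangent_space Q (chart_inv c y)"
    by (rule field_on_dom[OF X c(1) d(1)]) (rule that)
  obtain T2 where T2: "open T2" "snd c p \<in> T2" "T2 \<subseteq> dom c d" "smooth_on T2 (\<lambda>y. Y (chart_inv c y) c)"
    "\<And>y. y \<in> T2 \<Longrightarrow> Y (chart_inv c y) \<in> tangent_space Q (chart_inv c y)"
    by (rule field_on_dom[OF Y c(1) d(1)]) (rule that)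
  let ?T = "T1 \<inter> T2"
  have T: "open ?T" "snd c p \<in> ?T" "?T \<subseteq> dom c d" "?T \<subseteq> snd c ` fst c"
    using T1 T2 dom_subset by blast+
  have "smooth_on ?T (\<lambda>y. mco d (inc c d y) (der (inc c d) y (X (chart_inv c y) c)) (der (inc c d) y (Y (chart_inv c y) c)))"
    by (intro smooth_on_G_inc[OF c(2) d(2) T(1,3)] smooth_on_der_inc[OF c(2) d(2) T(1,3)])
      (use smooth_on_subset T1(4) T2(4) in blast)+
  then have "smooth_on ?T (\<lambda>y. gQ (chart_inv c y) (X (chart_inv c y)) (Y (chart_inv c y)))"
  proof (rule smooth_on_cong[OF T(1)])
    fix y assume y: "y \<in> ?T"
    then have yd: "y \<in> dom c d" and t: "X (chart_inv c y) \<in> tangent_space Q (chart_inv c y)"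
      "Y (chart_inv c y) \<in> tangent_space Q (chart_inv c y)" using T(3) T1(5) T2(5) by auto
    show "mco d (inc c d y) (der (inc c d) y (X (chart_inv c y) c)) (der (inc c d) y (Y (chart_inv c y) c))
        = gQ (chart_inv c y) (X (chart_inv c y)) (Y (chart_inv c y))"
      unfolding gQ_coord[OF dom_charts(1,2)[OF c(2) d(2) yd] t] \<iota>_on_dom[OF c(2) d(2) yd t(1)]
        \<iota>_on_dom[OF c(2) d(2) yd t(2)] by (simp add: inc_def)
  qed
  then show "smooth_fun_at Q p (\<lambda>q. gQ q (X q) (Y q))"
    by (rule Q0.smooth_fun_atI[OF c(1) T(1,2,4)])
qed

sublocale Q2: riem_mfd Q nablaQ gQ
  by (rule riem_mfd.intro[OF Q1.mfd_connection_axioms], rule riem_mfd_axioms.intro)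
    (rule riemannian_gQ, rule levi_civita_Q)

text \<open>Transfers the coordinate results to each pair of charts. Integrality of Q is the range
  condition, with \<open>as_tangent\<close> supplying preimages of vectors orthogonal to
  \<xi>.\<close>

lemma hypersurface:
  assumes c: "c \<in> atlas Q" and d: "d \<in> atlas M"
  shows "hypersurface_patch (snd d ` fst d) (mco d) (coeff d) (jco d) (xco d)
    (\<lambda>y. k (chart_inv d y)) (\<lambda>y. ps (chart_inv d y)) (\<lambda>y. a (chart_inv d y))
    (dom c d) (Q2.mco c) (Q1.coeff c) (inc c d)"
proof (rule hypersurface_patch.intro[OF patch_B0[OF d]
      riem_patch.riem_patch_subset[OF Q2.patch[OF c] dom_open[OF c d] dom_subset]], rule hypersurface_patch_axioms.intro)
  show "smooth_on (dom c d) (inc c d)" by (rule inc_smooth[OF c d])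
  fix y assume y: "y \<in> dom c d"
  show "inc c d y \<in> snd d ` fst d" by (rule inc_in[OF c y])
  define p where "p = chart_inv c y"
  note ch = dom_charts[OF c d y, folded p_def]
  note top = Q_top[OF ch(5)]
  have \<iota>y: "\<iota> p (Q0.lift c p u) d = der (inc c d) y u" for u
    using \<iota>_on_dom[OF c d y, of "Q0.lift c p u"] ch(1) by (simp add: p_def Q0.lift_tangent)
  have xi: "xco d (inc c d y) = \<xi> p d" by (simp add: xco_def ch)
  have z: "snd d p = inc c d y" by (simp add: inc_def p_def)
  show "range (der (inc c d) y) = {v. mco d (inc c d y) v (xco d (inc c d y)) = 0}"
  proof (intro equalityI subsetI)
    fix v assume "v \<in> range (der (inc c d) y)"
    then obtain u where v: "v = \<iota> p (Q0.lift c p u) d" using \<iota>y by auto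
    note m = \<iota>_mem[OF ch(5) Q0.lift_tangent, of c u]
    have "g p (\<iota> p (Q0.lift c p u)) (\<xi> p) = 0"
      using m(2) g_sym[OF top m(1) xi_tangent[OF top]] by simp
    then show "v \<in> {v. mco d (inc c d y) v (xco d (inc c d y)) = 0}"
      using g_coord[OF ch(2) m(1) xi_tangent[OF top]] by (simp add: v xi z)
  next
    fix v assume v: "v \<in> {v. mco d (inc c d y) v (xco d (inc c d y)) = 0}"
    let ?V = "lift d p v"
    have "g p ?V (\<xi> p) = 0"
      using v ch(2) unfolding g_coord[OF ch(2) lift_tangent xi_tangent[OF top]] by (simp add: xi z)
    then have "g p (\<xi> p) ?V = 0" using g_sym[OF top lift_tangent xi_tangent[OF top]] by simp
    note t = as_tangent_mem[OF ch(5) lift_tangent this]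
    have "der (inc c d) y (as_tangent Q M p ?V c) = v"
      using \<iota>_on_dom[OF c d y, folded p_def, OF t(1)] t(2) ch(2) by simp
    then show "v \<in> range (der (inc c d) y)" by (metis rangeI)
  qed
  show "Q2.mco c y u v = mco d (inc c d y) (der (inc c d) y u) (der (inc c d) y v)" for u v
    unfolding Q2.mco_def p_def[symmetric] gQ_coord[OF ch(1,2) Q0.lift_tangent Q0.lift_tangent] \<iota>y z ..
qed

section \<open>The induced almost contact structure\<close>

abbreviation "\<phi>Q \<equiv> induced_phi Q M g J \<xi>"
abbreviation "\<xi>Q \<equiv> induced_xi Q M J \<xi>"
abbreviation "\<eta>Q \<equiv> induced_eta Q M g J \<xi>"

lemma g_xi_Jxi: "p \<in> topspace (mtop M) \<Longrightarrow> g p (\<xi> p) (J p (\<xi> p)) = 0"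
proof -
  assume p: "p \<in> topspace (mtop M)"
  note d = chart_at[OF p]
  have a: "chart_at M p \<in> atlas M" "p \<in> fst (chart_at M p)" using d by (auto simp: charts_at_iff)
  interpret P: kaehler_patch "snd (chart_at M p) ` fst (chart_at M p)" "mco (chart_at M p)" "coeff (chart_at M p)"
    "jco (chart_at M p)" by (rule patch_kaehler[OF a(1)])
  show ?thesis
    unfolding g_coord[OF d xi_tangent[OF p] J_tangent[OF p xi_tangent[OF p]]] J_coord[OF d xi_tangent[OF p]]
    by (rule P.G_J_self) (use a in auto)
qed

lemma \<xi>Q:
  assumes p: "p \<in> topspace (mtop Q)"
  shows "\<xi>Q p \<in> tangent_space Q p" "\<iota> p (\<xi>Q p) = J p (\<xi> p)"
  unfolding induced_xi_def using Q_top[OF p]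
  by (auto intro!: as_tangent_mem[OF p] J_tangent xi_tangent g_xi_Jxi)

lemma \<eta>Q_eq: "p \<in> topspace (mtop Q) \<Longrightarrow> \<eta>Q p x = g p (\<iota> p x) (J p (\<xi> p))"
  by (simp add: induced_eta_def induced_metric_def \<xi>Q)

text \<open>\<open>as_tangent\<close> is meaningful for \<phi>x because the normal component
  -\<eta>(x) of Jx is compensated by the term \<eta>(x)\<xi>.\<close>

lemma point_coords:
  assumes p: "p \<in> topspace (mtop Q)" and d: "d \<in> charts_at M p" and x: "x \<in> tangent_space Q p"
  shows "mco d (snd d p) (\<iota> p x d) (xco d (snd d p)) = 0"
    and "\<iota> p (\<xi>Q p) d = jco d (snd d p) (xco d (snd d p))"
    and "\<eta>Q p x = mco d (snd d p) (\<iota> p x d) (jco d (snd d p) (xco d (snd d p)))"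
    and "\<phi>Q p x \<in> tangent_space Q p"
    and "\<iota> p (\<phi>Q p x) d = jco d (snd d p) (\<iota> p x d) + \<eta>Q p x *\<^sub>R xco d (snd d p)"
proof -
  note top = Q_top[OF p]
  note xt = xi_tangent[OF top] and Jxt = J_tangent[OF top xi_tangent[OF top]]
  note m = \<iota>_mem[OF p x]
  have a: "d \<in> atlas M" "p \<in> fst d" using d by (auto simp: charts_at_iff)
  let ?z = "snd d p"
  have z: "?z \<in> snd d ` fst d" using a by auto
  interpret P: B0_patch "snd d ` fst d" "mco d" "coeff d" "jco d" "xco d"
    "\<lambda>y. k (chart_inv d y)" "\<lambda>y. ps (chart_inv d y)" "\<lambda>y. a (chart_inv d y)"
    by (rule patch_B0[OF a(1)])
  have xz: "\<xi> p d = xco d ?z" "J p (\<xi> p) d = jco d ?z (xco d ?z)"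
    using xi_coord[OF d] J_coord[OF d xt] by simp_all
  show o: "mco d ?z (\<iota> p x d) (xco d ?z) = 0"
    using m(2) g_sym[OF top m(1) xt] unfolding g_coord[OF d m(1) xt] xz by simp
  show "\<iota> p (\<xi>Q p) d = jco d ?z (xco d ?z)" by (simp add: \<xi>Q[OF p] xz)
  show e: "\<eta>Q p x = mco d ?z (\<iota> p x d) (jco d ?z (xco d ?z))"
    unfolding \<eta>Q_eq[OF p] g_coord[OF d m(1) Jxt] xz ..
  let ?V = "J p (\<iota> p x) + \<eta>Q p x *\<^sub>R \<xi> p"
  have V: "?V \<in> tangent_space M p"
    by (intro subspace_add[OF subspace_tangent] subspace_scale[OF subspace_tangent] J_tangent top m xt)
  have Vd: "?V d = jco d ?z (\<iota> p x d) + \<eta>Q p x *\<^sub>R xco d ?z"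
    by (simp add: scaleR_fun_apply J_coord[OF d m(1)] xz)
  have "g p (\<xi> p) ?V = 0"
    unfolding g_coord[OF d xt V] unfolding Vd unfolding xz e
    using P.G_J_skew[OF z, of "xco d ?z" "\<iota> p x d"]
    by (simp add: P.G_simps[OF z] P.\<xi>_unit[OF z])
  note t = as_tangent_mem[OF p V this]
  show "\<phi>Q p x \<in> tangent_space Q p" unfolding induced_phi_def by (rule t(1))
  show "\<iota> p (\<phi>Q p x) d = jco d ?z (\<iota> p x d) + \<eta>Q p x *\<^sub>R xco d ?z"
    unfolding induced_phi_def t(2) Vd ..
qed

text \<open>\<open>as_tangent\<close> is a pointwise inverse and carries no smoothness of its own;
  \<open>smooth_on_pullback\<close> recovers it from the smooth image J\<xi>.\<close>

lemma \<xi>Q_smooth_chart: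
  assumes c: "c \<in> atlas Q" and d: "d \<in> atlas M"
  shows "smooth_on (dom c d) (\<lambda>y. \<xi>Q (chart_inv c y) c)"
    and "\<And>y. y \<in> dom c d \<Longrightarrow> der (inc c d) y (\<xi>Q (chart_inv c y) c) = jco d (inc c d y) (xco d (inc c d y))"
proof -
  interpret H: hypersurface_patch "snd d ` fst d" "mco d" "coeff d" "jco d" "xco d"
    "\<lambda>y. k (chart_inv d y)" "\<lambda>y. ps (chart_inv d y)" "\<lambda>y. a (chart_inv d y)"
    "dom c d" "Q2.mco c" "Q1.coeff c" "inc c d" by (rule hypersurface[OF c d])
  show *: "der (inc c d) y (\<xi>Q (chart_inv c y) c) = jco d (inc c d y) (xco d (inc c d y))" if y: "y \<in> dom c d" for y
  proof -
    note ch = dom_charts[OF c d y]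
    show ?thesis
      using \<iota>_on_dom[OF c d y \<xi>Q(1)[OF ch(5)]] point_coords(2)[OF ch(5) ch(2) \<xi>Q(1)[OF ch(5)]]
      by (simp add: inc_def)
  qed
  have "smooth_on (dom c d) (\<lambda>y. jco d (inc c d y) (xco d (inc c d y)))"
    by (rule H.smooth_on_J_f[OF H.Q.open_S order_refl H.smooth_compose_f[OF H.\<xi>_smooth]])
  then show "smooth_on (dom c d) (\<lambda>y. \<xi>Q (chart_inv c y) c)"
    by (rule H.smooth_on_pullback[OF H.Q.open_S order_refl]) (rule *)
qed

lemma \<phi>Q_chart:
  assumes c: "c \<in> atlas Q" and d: "d \<in> atlas M" and y: "y \<in> dom c d"
    and X: "X \<in> tangent_space Q (chart_inv c y)"
  shows "der (inc c d) y (\<phi>Q (chart_inv c y) X c) = jco d (inc c d y) (der (inc c d) y (X c))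
    + mco d (inc c d y) (der (inc c d) y (X c)) (jco d (inc c d y) (xco d (inc c d y))) *\<^sub>R xco d (inc c d y)"
proof -
  note ch = dom_charts[OF c d y]
  note pc = point_coords[OF ch(5) ch(2) X]
  show ?thesis
    using \<iota>_on_dom[OF c d y pc(4)] pc(5) pc(3) \<iota>_on_dom[OF c d y X] by (simp add: inc_def)
qed

lemma \<phi>Q_smooth_chart:
  assumes c: "c \<in> atlas Q" and d: "d \<in> atlas M" and T: "open T" "T \<subseteq> dom c d"
    and X: "smooth_on T (\<lambda>y. X (chart_inv c y) c)"
      "\<And>y. y \<in> T \<Longrightarrow> X (chart_inv c y) \<in> tangent_space Q (chart_inv c y)"
  shows "smooth_on T (\<lambda>y. \<phi>Q (chart_inv c y) (X (chart_inv c y)) c)"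
proof -
  interpret H: hypersurface_patch "snd d ` fst d" "mco d" "coeff d" "jco d" "xco d"
    "\<lambda>y. k (chart_inv d y)" "\<lambda>y. ps (chart_inv d y)" "\<lambda>y. a (chart_inv d y)"
    "dom c d" "Q2.mco c" "Q1.coeff c" "inc c d" by (rule hypersurface[OF c d])
  have sX: "smooth_on T (\<lambda>y. der (inc c d) y (X (chart_inv c y) c))"
    by (rule smooth_on_der_inc[OF c d T X(1)])
  have s\<xi>: "smooth_on T (\<lambda>y. xco d (inc c d y))"
    by (rule smooth_on_subset[OF H.smooth_compose_f[OF H.\<xi>_smooth] T(2)])
  have "smooth_on T (\<lambda>y. jco d (inc c d y) (der (inc c d) y (X (chart_inv c y) c))
    + mco d (inc c d y) (der (inc c d) y (X (chart_inv c y) c)) (jco d (inc c d y) (xco d (inc c d y))) *\<^sub>R xco d (inc c d y))"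
    by (rule smooth_on_add[OF T(1) H.smooth_on_J_f[OF T sX]
          smooth_on_scaleR[OF T(1) smooth_on_G_inc[OF c d T sX H.smooth_on_J_f[OF T s\<xi>]] s\<xi>]])
  then show ?thesis
    by (rule H.smooth_on_pullback[OF T]) (use \<phi>Q_chart[OF c d _ X(2)] T(2) in blast)
qed

lemma \<phi>Q_smooth:
  assumes p: "p \<in> topspace (mtop Q)" and X: "smooth_field_at Q p X"
  shows "smooth_field_at Q p (\<lambda>q. \<phi>Q q (X q))"
proof -
  obtain c d where c: "c \<in> charts_at Q p" "c \<in> atlas Q" and d: "d \<in> charts_at M p" "d \<in> atlas M"
    by (rule obtain_charts[OF p]) (rule that)
  obtain T where T: "open T" "snd c p \<in> T" "T \<subseteq> dom c d" "smooth_on T (\<lambda>y. X (chart_inv c y) c)"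
    "\<And>y. y \<in> T \<Longrightarrow> X (chart_inv c y) \<in> tangent_space Q (chart_inv c y)"
    by (rule field_on_dom[OF X c(1) d(1)]) (rule that)
  show ?thesis
  proof (rule Q0.smooth_field_atI[OF c(1) T(1,2) subset_trans[OF T(3) dom_subset]])
    show "smooth_on T (\<lambda>y. \<phi>Q (chart_inv c y) (X (chart_inv c y)) c)"
      by (rule \<phi>Q_smooth_chart[OF c(2) d(2) T(1,3-5)])
    fix y assume y: "y \<in> T"
    then have "y \<in> dom c d" using T(3) by blast
    note ch = dom_charts[OF c(2) d(2) this]
    show "\<phi>Q (chart_inv c y) (X (chart_inv c y)) \<in> tangent_space Q (chart_inv c y)"
      by (rule point_coords(4)[OF ch(5,2) T(5)[OF y]])
  qed
qed

lemma \<xi>Q_smooth: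
  assumes p: "p \<in> topspace (mtop Q)"
  shows "smooth_field_at Q p \<xi>Q"
proof -
  obtain c d where c: "c \<in> charts_at Q p" "c \<in> atlas Q" and d: "d \<in> charts_at M p" "d \<in> atlas M"
    by (rule obtain_charts[OF p]) (rule that)
  show ?thesis
    by (rule Q0.smooth_field_atI[OF c(1) dom_open[OF c(2) d(2)] in_dom(1)[OF c(1) d(1)] dom_subset])
      (rule \<xi>Q_smooth_chart(1)[OF c(2) d(2)], rule \<xi>Q(1)[OF dom_charts(5)[OF c(2) d(2)]])
qed

text \<open>As \<open>\<iota>\<close> is injective on tangent vectors of Q, identities between such
  vectors are verified for their images in one chart of M, where they are algebra with G, J and
  \<xi>.\<close>

lemma almost_contact: "almost_contact_riemannian Q gQ \<phi>Q \<xi>Q \<eta>Q"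
  unfolding almost_contact_riemannian_def
proof (intro conjI ballI)
  show "smooth_manifold Q" by (rule smooth_Q)
  show "riemannian_metric Q gQ" by (rule riemannian_gQ)
  show "smooth_vector_field Q \<xi>Q" unfolding smooth_vector_field_def using \<xi>Q_smooth by blast
  show "smooth_one_form Q \<eta>Q"
    unfolding smooth_one_form_def
  proof (intro ballI conjI allI impI)
    fix p assume p: "p \<in> topspace (mtop Q)"
    show "linear_between (tangent_space Q p) UNIV (\<eta>Q p)"
      unfolding linear_between_def induced_eta_def
    proof (intro conjI ballI allI)
      note s = Q2.g_sym[OF p _ \<xi>Q(1)[OF p]]
      note l = Q2.g_linear[OF p \<xi>Q(1)[OF p], unfolded linear_between_def]
      show "gQ p (x + y) (\<xi>Q p) = gQ p x (\<xi>Q p) + gQ p y (\<xi>Q p)"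
        if "x \<in> tangent_space Q p" "y \<in> tangent_space Q p" for x y
        unfolding s[OF that(1)] s[OF that(2)] s[OF subspace_add[OF Q0.subspace_tangent that]] using l that by blast
      show "gQ p (r *\<^sub>R x) (\<xi>Q p) = r *\<^sub>R gQ p x (\<xi>Q p)" if "x \<in> tangent_space Q p" for r x
        unfolding s[OF that] s[OF subspace_scale[OF Q0.subspace_tangent that]] using l that by blast
    qed simp
    show "smooth_fun_at Q p (\<lambda>q. \<eta>Q q (X q))" if "smooth_field_at Q p X" for X
      unfolding induced_eta_def by (rule Q2.g_smooth[OF p that \<xi>Q_smooth[OF p]])
  qed
  have coords: "\<exists>d. d \<in> charts_at M p \<and> d \<in> atlas M \<and> snd d p \<in> snd d ` fst d" if "p \<in> topspace (mtop Q)" for p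
    using chart_at[OF Q_top[OF that]] charts_at_iff by blast
  show "smooth_endomorphism_field Q \<phi>Q"
    unfolding smooth_endomorphism_field_def
  proof (intro ballI conjI allI impI)
    fix p assume p: "p \<in> topspace (mtop Q)"
    obtain d where d: "d \<in> charts_at M p" "d \<in> atlas M" "snd d p \<in> snd d ` fst d" using coords[OF p] by blast
    interpret P: B0_patch "snd d ` fst d" "mco d" "coeff d" "jco d" "xco d"
      "\<lambda>y. k (chart_inv d y)" "\<lambda>y. ps (chart_inv d y)" "\<lambda>y. a (chart_inv d y)"
      by (rule patch_B0[OF d(2)])
    note pc = point_coords[OF p d(1)] and lin = linear_\<iota>[OF p]
    show "linear_between (tangent_space Q p) (tangent_space Q p) (\<phi>Q p)"
      unfolding linear_between_def
    proof (intro conjI ballI allI)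
      show "\<phi>Q p ` tangent_space Q p \<subseteq> tangent_space Q p" using pc(4) by blast
      show "\<phi>Q p (x + y) = \<phi>Q p x + \<phi>Q p y" if x: "x \<in> tangent_space Q p" and y: "y \<in> tangent_space Q p" for x y
      proof (rule tangent_Q_eqI[OF p _ _ d(1)])
        have xy: "x + y \<in> tangent_space Q p" by (rule subspace_add[OF Q0.subspace_tangent x y])
        show "\<phi>Q p (x + y) \<in> tangent_space Q p" by (rule pc(4)[OF xy])
        show "\<phi>Q p x + \<phi>Q p y \<in> tangent_space Q p" by (intro subspace_add[OF Q0.subspace_tangent] pc x y)
        show "\<iota> p (\<phi>Q p (x + y)) d = \<iota> p (\<phi>Q p x + \<phi>Q p y) d"
          by (simp add: linear_add[OF lin] pc(5)[OF xy] pc(5)[OF x] pc(5)[OF y] pc(3)[OF xy] pc(3)[OF x] pc(3)[OF y]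
              P.J_simps[OF d(3)] P.G_simps[OF d(3)] algebra_simps)
      qed
      show "\<phi>Q p (r *\<^sub>R x) = r *\<^sub>R \<phi>Q p x" if x: "x \<in> tangent_space Q p" for r x
      proof (rule tangent_Q_eqI[OF p _ _ d(1)])
        have rx: "r *\<^sub>R x \<in> tangent_space Q p" by (rule subspace_scale[OF Q0.subspace_tangent x])
        show "\<phi>Q p (r *\<^sub>R x) \<in> tangent_space Q p" by (rule pc(4)[OF rx])
        show "r *\<^sub>R \<phi>Q p x \<in> tangent_space Q p" by (intro subspace_scale[OF Q0.subspace_tangent] pc x)
        show "\<iota> p (\<phi>Q p (r *\<^sub>R x)) d = \<iota> p (r *\<^sub>R \<phi>Q p x) d"
          by (simp add: linear_scale[OF lin] scaleR_fun_apply pc(5)[OF rx] pc(5)[OF x] pc(3)[OF rx] pc(3)[OF x]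
              P.J_simps[OF d(3)] P.G_simps[OF d(3)] algebra_simps)
      qed
    qed
    show "smooth_field_at Q p (\<lambda>q. \<phi>Q q (X q))" if "smooth_field_at Q p X" for X
      by (rule \<phi>Q_smooth[OF p that])
  qed
  fix p assume p: "p \<in> topspace (mtop Q)"
  obtain d where d: "d \<in> charts_at M p" "d \<in> atlas M" "snd d p \<in> snd d ` fst d" using coords[OF p] by blast
  interpret P: B0_patch "snd d ` fst d" "mco d" "coeff d" "jco d" "xco d"
    "\<lambda>y. k (chart_inv d y)" "\<lambda>y. ps (chart_inv d y)" "\<lambda>y. a (chart_inv d y)"
    by (rule patch_B0[OF d(2)])
  note pc = point_coords[OF p d(1)] and lin = linear_\<iota>[OF p]
  obtain c where c: "c \<in> charts_at Q p" using Q0.chart_at[OF p] by blast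
  note Gs = P.J_simps[OF d(3)] P.G_simps[OF d(3)] P.G_J_J[OF d(3)] P.\<xi>_unit[OF d(3)] P.\<xi>_J\<xi>[OF d(3)] P.J_J[OF d(3)]
  show "gQ p (\<phi>Q p x) (\<phi>Q p y) = gQ p x y - \<eta>Q p x * \<eta>Q p y"
    if x: "x \<in> tangent_space Q p" and y: "y \<in> tangent_space Q p" for x y
  proof -
    let ?z = "snd d p" and ?X = "\<iota> p x d" and ?Y = "\<iota> p y d"
    have 1: "mco d ?z (xco d ?z) (jco d ?z ?Y) = - \<eta>Q p y"
      using P.G_J_skew[OF d(3), of "xco d ?z" ?Y] pc(3)[OF y] by simp
    have 2: "mco d ?z (jco d ?z ?X) (xco d ?z) = - \<eta>Q p x"
      using P.G_J_left[OF d(3), of ?X "xco d ?z"] pc(3)[OF x] by simp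
    show ?thesis
      unfolding gQ_coord[OF c d(1) pc(4)[OF x] pc(4)[OF y]] gQ_coord[OF c d(1) x y] pc(5)[OF x] pc(5)[OF y]
      by (simp add: Gs 1 2)
  qed
  show "\<phi>Q p (\<phi>Q p x) = - x + \<eta>Q p x *\<^sub>R \<xi>Q p" if x: "x \<in> tangent_space Q p" for x
  proof (rule tangent_Q_eqI[OF p _ _ d(1)])
    show "\<phi>Q p (\<phi>Q p x) \<in> tangent_space Q p" by (intro pc x)
    show "- x + \<eta>Q p x *\<^sub>R \<xi>Q p \<in> tangent_space Q p"
      by (intro subspace_add[OF Q0.subspace_tangent] subspace_neg[OF Q0.subspace_tangent]
          subspace_scale[OF Q0.subspace_tangent] x \<xi>Q p)
    have "\<eta>Q p (\<phi>Q p x) = 0"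
      unfolding pc(3)[OF pc(4)[OF x]] pc(5)[OF x] by (simp add: Gs pc(1)[OF x])
    then show "\<iota> p (\<phi>Q p (\<phi>Q p x)) d = \<iota> p (- x + \<eta>Q p x *\<^sub>R \<xi>Q p) d"
      by (simp add: linear_add[OF lin] linear_neg[OF lin] linear_scale[OF lin] scaleR_fun_apply
          pc(5)[OF pc(4)[OF x]] pc(5)[OF x] pc(2)[OF x] Gs del: add_uminus_conv_diff uminus_add_conv_diff)
  qed
  show "\<phi>Q p (\<xi>Q p) = 0"
  proof (rule tangent_Q_eqI[OF p _ _ d(1)])
    note xt = \<xi>Q(1)[OF p]
    show "\<phi>Q p (\<xi>Q p) \<in> tangent_space Q p" by (rule pc(4)[OF xt])
    show "0 \<in> tangent_space Q p" by (rule subspace_0[OF Q0.subspace_tangent])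
    show "\<iota> p (\<phi>Q p (\<xi>Q p)) d = \<iota> p 0 d"
      by (simp add: linear_0[OF lin] pc(5)[OF xt] pc(2)[OF xt] pc(3)[OF xt] Gs)
  qed
qed

section \<open>Sasakian identities and sectional curvature on the submanifold\<close>

lemma nablaQ_xi:
  assumes p: "p \<in> topspace (mtop Q)" and x: "x \<in> tangent_space Q p"
  shows "nablaQ p x \<xi>Q = (k p / 2) *\<^sub>R \<phi>Q p x"
proof -
  obtain c d where c: "c \<in> charts_at Q p" "c \<in> atlas Q" and d: "d \<in> charts_at M p" "d \<in> atlas M"
    by (rule obtain_charts[OF p]) (rule that)
  interpret H: hypersurface_patch "snd d ` fst d" "mco d" "coeff d" "jco d" "xco d"
    "\<lambda>y. k (chart_inv d y)" "\<lambda>y. ps (chart_inv d y)" "\<lambda>y. a (chart_inv d y)"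
    "dom c d" "Q2.mco c" "Q1.coeff c" "inc c d" by (rule hypersurface[OF c(2) d(2)])
  note y = in_dom[OF c(1) d(1)] and pc = point_coords[OF p d(1) x]
  have zi: "chart_inv d (snd d p) = p" using d by (simp add: charts_at_iff)
  have n: "nablaQ p x \<xi>Q \<in> tangent_space Q p" by (rule Q1.nabla_tangent[OF p \<xi>Q_smooth[OF p] x])
  have "nablaQ p x \<xi>Q c = H.Q.cov (x c) (\<lambda>y. \<xi>Q (chart_inv c y) c) (snd c p)"
    using Q1.nabla_coord[OF c(1) x \<xi>Q_smooth[OF p]] y(3) by (simp add: H.Q.cov_def)
  then have "\<iota> p (nablaQ p x \<xi>Q) d = (k p / 2) *\<^sub>R (jco d (snd d p) (\<iota> p x d) + \<eta>Q p x *\<^sub>R xco d (snd d p))"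
    using H.sasaki_xi[OF H.Q.open_S order_refl y(1) \<xi>Q_smooth_chart[OF c(2) d(2)], of "x c"]
    unfolding \<iota>_chart[OF c(1) d(1) n] pc(3) \<iota>_chart[OF c(1) d(1) x] by (simp add: y zi)
  then show ?thesis
    by (intro tangent_Q_eqI[OF p n subspace_scale[OF Q0.subspace_tangent pc(4)] d(1)])
      (simp add: linear_scale[OF linear_\<iota>[OF p]] scaleR_fun_apply pc(5))
qed

lemma nablaQ_phi:
  assumes p: "p \<in> topspace (mtop Q)" and x: "x \<in> tangent_space Q p" and Y: "smooth_field_at Q p Y"
  shows "nablaQ p x (\<lambda>q. \<phi>Q q (Y q)) - \<phi>Q p (nablaQ p x Y)
    = (k p / 2) *\<^sub>R (\<eta>Q p (Y p) *\<^sub>R x - gQ p x (Y p) *\<^sub>R \<xi>Q p)"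
proof -
  obtain c d where c: "c \<in> charts_at Q p" "c \<in> atlas Q" and d: "d \<in> charts_at M p" "d \<in> atlas M"
    by (rule obtain_charts[OF p]) (rule that)
  interpret H: hypersurface_patch "snd d ` fst d" "mco d" "coeff d" "jco d" "xco d"
    "\<lambda>y. k (chart_inv d y)" "\<lambda>y. ps (chart_inv d y)" "\<lambda>y. a (chart_inv d y)"
    "dom c d" "Q2.mco c" "Q1.coeff c" "inc c d" by (rule hypersurface[OF c(2) d(2)])
  note y = in_dom[OF c(1) d(1)]
  have zi: "chart_inv d (snd d p) = p" using d by (simp add: charts_at_iff)
  obtain T where T: "open T" "snd c p \<in> T" "T \<subseteq> dom c d" "smooth_on T (\<lambda>y. Y (chart_inv c y) c)"
    "\<And>y. y \<in> T \<Longrightarrow> Y (chart_inv c y) \<in> tangent_space Q (chart_inv c y)"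
    by (rule field_on_dom[OF Y c(1) d(1)]) (rule that)
  note PY = \<phi>Q_smooth[OF p Y]
  have Yp: "Y p \<in> tangent_space Q p" by (rule Q0.smooth_field_at_tangent[OF Y])
  have n1: "nablaQ p x Y \<in> tangent_space Q p" and n2: "nablaQ p x (\<lambda>q. \<phi>Q q (Y q)) \<in> tangent_space Q p"
    by (rule Q1.nabla_tangent[OF p _ x], rule Y, rule Q1.nabla_tangent[OF p _ x], rule PY)
  note pc1 = point_coords[OF p d(1) n1] and pcY = point_coords[OF p d(1) Yp] and lin = linear_\<iota>[OF p]
  have e: "nablaQ p x W c = H.Q.cov (x c) (\<lambda>y. W (chart_inv c y) c) (snd c p)" if "smooth_field_at Q p W" for W
    using Q1.nabla_coord[OF c(1) x that] y(3) by (simp add: H.Q.cov_def)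
  have sT: "smooth_on T (\<lambda>y. \<phi>Q (chart_inv c y) (Y (chart_inv c y)) c)"
    by (rule \<phi>Q_smooth_chart[OF c(2) d(2) T(1,3-5)])
  have dT: "der (inc c d) y (\<phi>Q (chart_inv c y) (Y (chart_inv c y)) c) = jco d (inc c d y) (der (inc c d) y (Y (chart_inv c y) c))
    + mco d (inc c d y) (der (inc c d) y (Y (chart_inv c y) c)) (jco d (inc c d y) (xco d (inc c d y))) *\<^sub>R xco d (inc c d y)"
    if "y \<in> T" for y
    by (rule \<phi>Q_chart[OF c(2) d(2) _ T(5)[OF that]]) (use that T(3) in blast)
  have main: "\<iota> p (nablaQ p x (\<lambda>q. \<phi>Q q (Y q))) d - \<iota> p (\<phi>Q p (nablaQ p x Y)) d
    = (k p / 2) *\<^sub>R (\<eta>Q p (Y p) *\<^sub>R \<iota> p x d - gQ p x (Y p) *\<^sub>R \<iota> p (\<xi>Q p) d)"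
    using H.sasaki_phi[OF T(1,3,2) T(4) sT dT, of "x c"]
    unfolding pc1(5) pc1(3) pcY(3) pcY(2) gQ_coord[OF c(1) d(1) x Yp] \<iota>_chart[OF c(1) d(1) n1]
      \<iota>_chart[OF c(1) d(1) n2] \<iota>_chart[OF c(1) d(1) x] \<iota>_chart[OF c(1) d(1) Yp] e[OF Y] e[OF PY]
    by (simp add: y zi)
  show ?thesis
  proof (rule tangent_Q_eqI[OF p _ _ d(1)])
    show "nablaQ p x (\<lambda>q. \<phi>Q q (Y q)) - \<phi>Q p (nablaQ p x Y) \<in> tangent_space Q p"
      by (rule subspace_diff[OF Q0.subspace_tangent n2 pc1(4)])
    show "(k p / 2) *\<^sub>R (\<eta>Q p (Y p) *\<^sub>R x - gQ p x (Y p) *\<^sub>R \<xi>Q p) \<in> tangent_space Q p"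
      by (intro subspace_diff[OF Q0.subspace_tangent] subspace_scale[OF Q0.subspace_tangent] x \<xi>Q p)
    show "\<iota> p (nablaQ p x (\<lambda>q. \<phi>Q q (Y q)) - \<phi>Q p (nablaQ p x Y)) d
        = \<iota> p ((k p / 2) *\<^sub>R (\<eta>Q p (Y p) *\<^sub>R x - gQ p x (Y p) *\<^sub>R \<xi>Q p)) d"
      using main by (simp only: linear_diff[OF lin] linear_scale[OF lin] scaleR_fun_apply minus_apply)
  qed
qed

text \<open>Since \<eta>(x) = 0, the image of x lies in D and \<phi>x corresponds to Jx; the Gram
  determinant is the squared square length of x and cancels the factor in
  \<open>K_phi\<close>.\<close>

lemma phi_sectional_curvature:
  assumes p: "p \<in> topspace (mtop Q)" and x: "x \<in> tangent_space Q p" "gQ p x (\<xi>Q p) = 0" "x \<noteq> 0"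
  shows "sectional_curvature Q gQ nablaQ p (span {x, \<phi>Q p x}) = a p + (k p)\<^sup>2 / 4"
proof -
  obtain c d where c: "c \<in> charts_at Q p" "c \<in> atlas Q" and d: "d \<in> charts_at M p" "d \<in> atlas M"
    by (rule obtain_charts[OF p]) (rule that)
  interpret H: hypersurface_patch "snd d ` fst d" "mco d" "coeff d" "jco d" "xco d"
    "\<lambda>y. k (chart_inv d y)" "\<lambda>y. ps (chart_inv d y)" "\<lambda>y. a (chart_inv d y)"
    "dom c d" "Q2.mco c" "Q1.coeff c" "inc c d" by (rule hypersurface[OF c(2) d(2)])
  note y = in_dom[OF c(1) d(1)] and pc = point_coords[OF p d(1) x(1)]
  have zi: "chart_inv d (snd d p) = p" using d by (simp add: charts_at_iff)
  let ?u = "x c" and ?v = "\<phi>Q p x c" and ?y = "snd c p"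
  have \<eta>: "\<eta>Q p x = 0" using x(2) by (simp add: induced_eta_def)
  have u: "der (inc c d) ?y ?u = \<iota> p x d" using \<iota>_chart[OF c(1) d(1) x(1)] by simp
  have "\<iota> p x d \<in> H.D (inc c d ?y)"
    using pc(1,3) \<eta> by (simp add: H.D_def y)
  moreover have "der (inc c d) ?y ?v = jco d (inc c d ?y) (der (inc c d) ?y ?u)"
    using \<iota>_chart[OF c(1) d(1) pc(4)] pc(5) \<eta> by (simp add: u y)
  ultimately have K: "H.Q.K ?y ?u ?v ?v ?u = (a p + (k p)\<^sup>2 / 4) * (gQ p x x)\<^sup>2"
    and g: "gQ p (\<phi>Q p x) (\<phi>Q p x) = gQ p x x" "gQ p x (\<phi>Q p x) = 0"
    using H.K_phi[OF y(1), of ?u ?v]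
    unfolding Q2.g_coord[OF c(1) x(1) x(1)] Q2.g_coord[OF c(1) pc(4) pc(4)] Q2.g_coord[OF c(1) x(1) pc(4)] u
    by (simp_all add: y zi)
  have pos: "gQ p x x > 0" by (rule Q2.g_pos[OF p x(1,3)])
  have gram: "gQ p x x * gQ p (\<phi>Q p x) (\<phi>Q p x) - (gQ p x (\<phi>Q p x))\<^sup>2 = (gQ p x x)\<^sup>2"
    by (simp add: g power2_eq_square)
  have "(gQ p x x)\<^sup>2 \<noteq> 0" using pos by simp
  then show ?thesis
    using Q2.sectional_curvature_coord[OF c(1) x(1) pc(4), unfolded gram] K pos by (simp add: Q2.cK_def)
qed

section \<open>Constancy along the submanifold and conclusion\<close>

text \<open>Local constancy makes the set of points with the same values open and closed in the
  topology of Q, which is the topology that is connected.\<close>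

lemma ka_constant:
  assumes p: "p \<in> topspace (mtop Q)" and q: "q \<in> topspace (mtop Q)"
  shows "k q = k p \<and> a q = a p"
proof -
  have loc: "\<exists>W. openin (mtop Q) W \<and> r \<in> W \<and> (\<forall>s\<in>W. k s = k r \<and> a s = a r)" if r: "r \<in> topspace (mtop Q)" for r
  proof -
    obtain c d where c: "c \<in> charts_at Q r" "c \<in> atlas Q" and d: "d \<in> charts_at M r" "d \<in> atlas M"
      by (rule obtain_charts[OF r]) (rule that)
    interpret H: hypersurface_patch "snd d ` fst d" "mco d" "coeff d" "jco d" "xco d"
      "\<lambda>y. k (chart_inv d y)" "\<lambda>y. ps (chart_inv d y)" "\<lambda>y. a (chart_inv d y)"
      "dom c d" "Q2.mco c" "Q1.coeff c" "inc c d" by (rule hypersurface[OF c(2) d(2)])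
    note y = in_dom[OF c(1) d(1)]
    obtain e where e: "e > 0" "ball (snd c r) e \<subseteq> dom c d"
      "\<And>q. q \<in> ball (snd c r) e \<Longrightarrow> k (chart_inv d (inc c d q)) = k (chart_inv d (inc c d (snd c r)))
        \<and> a (chart_inv d (inc c d q)) = a (chart_inv d (inc c d (snd c r)))"
      by (rule H.ak_locally_constant[OF y(1)]) (rule that)
    define W where "W = {s \<in> fst c. snd c s \<in> ball (snd c r) e}"
    have "openin (mtop Q) W" unfolding W_def by (rule Q0.chart_preimage_openin[OF c(2) open_ball])
    moreover have "r \<in> W" using c e(1) by (simp add: W_def Q0.charts_at_iff)
    moreover have "k s = k r \<and> a s = a r" if s: "s \<in> W" for s
    proof -
      have sb: "snd c s \<in> ball (snd c r) e" "s \<in> fst c" using s by (auto simp: W_def)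
      then have "snd c s \<in> dom c d" using e(2) by blast
      from dom_charts(4)[OF c(2) d(2) this] dom_charts(4)[OF c(2) d(2) y(1)]
      show ?thesis using e(3)[OF sb(1)] sb(2) c(2) y(3) by simp
    qed
    ultimately show ?thesis by blast
  qed
  define A where "A = {r \<in> topspace (mtop Q). k r = k p \<and> a r = a p}"
  have "openin (mtop Q) A"
  proof (subst openin_subopen, intro ballI)
    fix r assume r: "r \<in> A"
    then have "r \<in> topspace (mtop Q)" by (simp add: A_def)
    from loc[OF this] obtain W where W: "openin (mtop Q) W" "r \<in> W" "\<forall>s\<in>W. k s = k r \<and> a s = a r"
      by blast
    have "W \<subseteq> A"
    proof
      fix s assume "s \<in> W"
      then have "k s = k r" "a s = a r" "s \<in> topspace (mtop Q)"
        using W(3) openin_subset[OF W(1)] by blast+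
      then show "s \<in> A" using r by (simp add: A_def)
    qed
    then show "\<exists>T. openin (mtop Q) T \<and> r \<in> T \<and> T \<subseteq> A" using W by blast
  qed
  moreover have "openin (mtop Q) (topspace (mtop Q) - A)"
  proof (subst openin_subopen, intro ballI)
    fix r assume r: "r \<in> topspace (mtop Q) - A"
    then have "r \<in> topspace (mtop Q)" by simp
    from loc[OF this] obtain W where W: "openin (mtop Q) W" "r \<in> W" "\<forall>s\<in>W. k s = k r \<and> a s = a r"
      by blast
    have "W \<subseteq> topspace (mtop Q) - A"
    proof
      fix s assume "s \<in> W"
      then have "k s = k r" "a s = a r" "s \<in> topspace (mtop Q)"
        using W(3) openin_subset[OF W(1)] by blast+
      then show "s \<in> topspace (mtop Q) - A" using r by (simp add: A_def)
    qed
    then show "\<exists>T. openin (mtop Q) T \<and> r \<in> T \<and> T \<subseteq> topspace (mtop Q) - A" using W by blast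
  qed
  then have "closedin (mtop Q) A" by (auto simp: closedin_def A_def)
  moreover have "A \<noteq> {}" using p by (auto simp: A_def)
  ultimately have "A = topspace (mtop Q)"
    using connected_Q unfolding connected_space_clopen_in by blast
  then show ?thesis using q by (auto simp: A_def)
qed

lemma space_form:
  assumes "\<And>q. q \<in> topspace (mtop Q) \<Longrightarrow> \<alpha> = k q / 2 \<and> c = a q + (k q)\<^sup>2 / 4"
  shows "sasakian_space_form Q gQ \<phi>Q \<xi>Q \<eta>Q nablaQ \<alpha> c"
  unfolding sasakian_space_form_def sasakian_def
  using almost_contact levi_civita_Q nablaQ_xi nablaQ_phi phi_sectional_curvature assms by simp

end

theorem proposition5p1:
  fixes n :: nat
    and M :: "('m, 'e::euclidean_space) manifold"
    and g :: "('m, 'e) metric"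
    and J :: "'m \<Rightarrow> ('m, 'e) tangent \<Rightarrow> ('m, 'e) tangent"
    and nabla :: "('m, 'e) connection"
    and D :: "'m \<Rightarrow> ('m, 'e) tangent set"
    and \<xi> :: "('m, 'e) field"
    and k a :: "'m \<Rightarrow> real"
    and Q :: "('m, 'f::euclidean_space) manifold"
    and nablaQ :: "('m, 'f) connection"
  assumes dim_M: "DIM('e) = 2 * n" "2 * n \<ge> 6"
    and kaehler: "kaehler_manifold M g J nabla"
    and B0: "B0_distribution M g J nabla D \<xi> k"
    and qch: "quasi_constant_holomorphic_curvature M g J nabla D"
    and a: "holomorphic_curvature_on M g J nabla D a"
    and dim_Q: "DIM('f) = 2 * n - 1"
    and Q: "integral_submanifold Q M (orth_distribution M g \<xi>)"
    and nablaQ: "levi_civita_connection Q (induced_metric Q M g) nablaQ"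
  shows "\<exists>\<alpha> c.
    (\<forall>q\<in>topspace (mtop Q). \<alpha> = k q / 2) \<and>
    sasakian_space_form Q (induced_metric Q M g) (induced_phi Q M g J \<xi>) (induced_xi Q M J \<xi>)
      (induced_eta Q M g J \<xi>) nablaQ \<alpha> c \<and>
    (\<forall>q\<in>topspace (mtop Q).
      (space_form_type_I \<alpha> c \<longleftrightarrow> a q + (k q)\<^sup>2 > 0) \<and>
      (space_form_type_II \<alpha> c \<longleftrightarrow> a q + (k q)\<^sup>2 = 0) \<and>
      (space_form_type_III \<alpha> c \<longleftrightarrow> a q + (k q)\<^sup>2 < 0))"
proof -
  obtain ps where ps: "\<forall>p\<in>topspace (mtop M). k p \<noteq> 0 \<and> (\<forall>x\<in>D p. nabla p x \<xi> = (k p / 2) *\<^sub>R x) \<and>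
      nabla p (J p (\<xi> p)) \<xi> = - (ps p *\<^sub>R J p (\<xi> p)) \<and> nabla p (\<xi> p) \<xi> = 0"
    and dist: "J_invariant_distribution M g J D \<xi>"
    using B0 unfolding B0_distribution_def by blast
  have ah: "almost_hermitian M g J" and lc: "levi_civita_connection M g nabla"
    using kaehler unfolding kaehler_manifold_def by blast+
  have sM: "smooth_manifold M" and rM: "riemannian_metric M g"
    using ah unfolding almost_hermitian_def by blast+
  interpret B0_hypersurface M nabla g J D \<xi> k ps a Q nablaQ
  proof (intro B0_hypersurface.intro B0_mfd.intro riem_mfd.intro mfd_connection.intro mfd.intro
      mfd_connection_axioms.intro riem_mfd_axioms.intro B0_mfd_axioms.intro B0_hypersurface_axioms.intro)
    show "affine_connection M nabla" using lc unfolding levi_civita_connection_def by blast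
    show "6 \<le> DIM('e)" using dim_M by simp
  qed (use sM rM lc kaehler dist ps a Q nablaQ in blast)+
  \<comment> \<open>Any point serves by \<open>ka_constant\<close>. If Q is empty the choice is
    arbitrary, and the conditions on \<alpha> and c are vacuous.\<close>
  define q0 where "q0 = (SOME q. q \<in> topspace (mtop Q))"
  define \<alpha> c where "\<alpha> = k q0 / 2" and "c = a q0 + (k q0)\<^sup>2 / 4"
  have eq: "\<alpha> = k q / 2 \<and> c = a q + (k q)\<^sup>2 / 4" if q: "q \<in> topspace (mtop Q)" for q
  proof -
    have "q0 \<in> topspace (mtop Q)" unfolding q0_def using q by (rule someI)
    from ka_constant[OF this q] show ?thesis by (simp add: \<alpha>_def c_def)
  qed
  have type: "c + 3 * \<alpha>\<^sup>2 = a q + (k q)\<^sup>2" if "q \<in> topspace (mtop Q)" for q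
  proof -
    have ac: "\<alpha> = k q / 2" "c = a q + (k q)\<^sup>2 / 4" using eq[OF that] by blast+
    show ?thesis unfolding ac power_divide by simp
  qed
  show ?thesis
  proof (rule exI[of _ \<alpha>], rule exI[of _ c], intro conjI ballI)
    show "\<alpha> = k q / 2" if "q \<in> topspace (mtop Q)" for q using eq[OF that] by blast
    show "sasakian_space_form Q gQ \<phi>Q \<xi>Q \<eta>Q nablaQ \<alpha> c" by (rule space_form[OF eq])
  qed (simp_all only: space_form_type_I_def space_form_type_II_def space_form_type_III_def type)
qed

end
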